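(* Let $\Theta\subseteq\mathbb R$ and let $\mathcal P=(P_\theta)_{\theta\in\Theta}$ be a model on $(\mathcal X,\mathcal F)$ with $\sigma$-finite dominating measure $\mu$ and densities $p_\theta$ such that: (C1) $\mathcal P$ is DQM at every $\theta\in\Theta$ with score $s_\theta$; (C2) the maps $(x,\theta)\mapsto p_\theta(x)$ and $(x,\theta)\mapsto s_\theta(x)$ are measurable on $\mathcal X\times\Theta$; (C3) $\theta\mapsto s_\theta\sqrt{p_\theta}$ is continuous from $\Theta$ to $L_2(\mu)$. Let $(T_m)_{m\in\mathbb N}$ be a consistent quantizer of $\mathcal P$ with associated sequence $(k_m)_{m\in\mathbb N}$. Fix $\alpha\in(0,\infty)$, $Q_0\in\mathcal Q_\alpha(\mathcal X\to\mathcal Z_0)$ and $n_1\in\mathbb N$, let $\tilde\theta_{n_1}:\mathcal Z_0^{n_1}\to\Theta$ be an estimator and write $\hat T_{n_1}(x):=T_{n_1}(x,\tilde\theta_{n_1})$ and $\hat k_{n_1}:=k_{n_1}(\tilde\theta_{n_1})$. Let $\hat Q_{n_1}\in\mathcal M_\alpha(\hat k_{n_1},\hat k_{n_1})$ be a measurable maximizer of $$\max_{Q\in\mathcal M_\alpha(\hat k_{n_1},\hat k_{n_1})}I_{\tilde\theta_{n_1}}(Q\hat T_{n_1}\mathcal P).$$ Then $I_{\theta_{n_1}}(\hat Q_{n_1}\hat T_{n_1}\mathcal P)$ is measurable as a function of the first group data $z_{1:n_1}\in\mathcal Z_0^{n_1}$ and $$0\le\sup_{Q\in\mathcal Q_\alpha(\mathcal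 X)}I_\theta(Q\mathcal P)-I_{\theta_{n_1}}(\hat Q_{n_1}\hat T_{n_1}\mathcal P)\le2\varphi(\theta,\tilde\theta_{n_1})+\varphi(\theta,\theta_{n_1})+C_\alpha\left(1\lor I_{\tilde\theta_{n_1}}(\mathcal P)\right)\Delta_{n_1}(\tilde\theta_{n_1}),$$ for any $\theta,\theta_{n_1}\in\Theta$, where $C_\alpha>0$ depends only on $\alpha$ and, with $\dot p_\theta:=s_\theta p_\theta$, $$\varphi(\theta,\theta'):=e^{2\alpha}\left(I_\theta(\mathcal P)\lor I_{\theta'}(\mathcal P)\lor1\right)\left[2\|\dot p_\theta-\dot p_{\theta'}\|_{L_1(\mu)}+3\|p_\theta-p_{\theta'}\|_{L_1(\mu)}\right].$$ Moreover, the upper bound converges to zero in $[Q_0P_\theta]^{n_1}$-probability as $n_1\to\infty$, provided that $\theta_{n_1}\to\theta$ and $[Q_0P_\theta]^{n_1}(|\tilde\theta_{n_1}-\theta|>\varepsilon)\to0$ as $n_1\to\infty$, for every $\varepsilon>0$.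
   Context: $\mathbb N=\{1,2,\dots\}$, $[k]=\{1,\dots,k\}$, $a\lor b=\max(a,b)$. DQM. $\mathcal P=(P_\theta)_{\theta\in\Theta}$, $\Theta\subseteq\mathbb R$, with $\mu$-densities $p_\theta$ is DQM at $\theta$ if $\theta$ is interior to $\Theta$ and there is a measurable $s_\theta:\mathcal X\to\mathbb R$ (the score) with $\int(\sqrt{p_{\theta+h}}-\sqrt{p_\theta}-\frac12hs_\theta\sqrt{p_\theta})^2d\mu=o(h^2)$ as $h\to0$; then $I_\theta(\mathcal P)=\mathbb E_\theta[s_\theta^2]<\infty$. Channels. For a Markov kernel $Q$, $[QP](A)=\int Q(A|x)P(dx)$ and $Q\mathcal P=(QP_\theta)_{\theta\in\Theta}$; for measurable $T$, $[QT](dz|x)=Q(dz|T(x))$ and $QT\mathcal P=[QT]\mathcal P$. $\mathcal Q_\alpha(\mathcal X\to\mathcal Z)$ is the set of Markov kernels from $(\mathcal X,\mathcal F)$ to $(\mathcal Z,\mathcal G)$ with $Q(A|x)\le e^\alpha Q(A|x')$ for all $A\in\mathcal G$, $x,x'\in\mathcal X$; $\mathcal Q_\alpha(\mathcal X)$ is the union over all measurable output spaces $(\mathcal Z,\mathcal G)$ (a supremum over it is the supremum of all real numbers so attained). For $\mathcal P$ DQM at $\theta$ and $Q\in\mathcal Q_\alpha(\mathcal X)$ the model $Q\mathcal P$ is DQM at $\theta$, so $I_\theta(Q\mathcal P)$ is well defined. $\mathcal M_\alpha(\ell,k)$ is the set of $\ell\times k$ matrices with $Q_{ij}\ge0$,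 $\sum_{i=1}^\ell Q_{ij}=1$ and $e^{-\alpha}Q_{ij'}\le Q_{ij}\le e^\alpha Q_{ij'}$ for all $i,j,j'$; it is identified with $\mathcal Q_\alpha([k]\to[\ell])$ via $Q(C|y)=\sum_{i\in C}Q_{iy}$. Consistent quantizer. A sequence of measurable maps $T_m:\mathcal X\times\Theta\to\mathbb N$ is a consistent quantizer of $\mathcal P$, with associated sequence $(k_m)$ of measurable maps $k_m:\Theta\to\mathbb N$, if: (a) $T_m(x,\theta)\in[k_m(\theta)]$ for all $m,\theta,x$; (b) with $T_{m,\theta}(x)=T_m(x,\theta)$, $B_j=B_{j,m}(\theta)=T_{m,\theta}^{-1}(\{j\})$, $J=J_m(\theta)=\{l\in[k_m(\theta)]:0<\mu(B_{l,m}(\theta))<\infty\}$, $K(\theta)=K_{J,m}(\theta)=\bigcup_{j\in J}B_j$, $\dot p_\theta=s_\theta p_\theta$, $\bar p_\theta=\sum_{j\in J}\frac{\int_{B_j}p_\theta d\mu}{\mu(B_j)}\mathbf 1_{B_j}$, $\bar{\dot p}_\theta=\sum_{j\in J}\frac{\int_{B_j}\dot p_\theta d\mu}{\mu(B_j)}\mathbf 1_{B_j}$ and $$\Delta_m(\theta):=\|(p_\theta-\bar p_\theta)\mathbf 1_{K(\theta)}\|_{L_1(\mu)}+\|(\dot p_\theta-\bar{\dot p}_\theta)\mathbf 1_{K(\theta)}\|_{L_1(\mu)}+\sqrt{P_\theta(K(\theta)^c)},$$ one has $\Delta_m(\theta_m)\to0$ as $m\to\infty$ for every sequence $(\theta_m)$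 in $\Theta$ whose limit is also in $\Theta$. Measurable maximizer. This means: $\hat Q_{n_1}(C|y)=Q(C|y,\tilde\theta_{n_1})$, where $Q$ (depending on $n_1$) is a Markov kernel from $\mathbb N\times\Theta$ to $\mathbb N$ such that for every $\theta\in\Theta$ the kernel $Q_\theta(C|y):=Q(C|y,\theta)$, $C\subseteq[k_{n_1}(\theta)]$, $y\in[k_{n_1}(\theta)]$, lies in $\mathcal Q_\alpha([k_{n_1}(\theta)]\to[k_{n_1}(\theta)])$ and maximizes $Q'\mapsto I_\theta(Q'T_{n_1,\theta}\mathcal P)$ over that set, and such that $\theta\mapsto I_{\theta_0}(Q_\theta T_{n_1,\theta}\mathcal P)$ is measurable for every $\theta_0\in\Theta$. Such a kernel exists under (C1) and (C2). An estimator is a measurable map. The symbols $\tilde\theta_{n_1},\hat T_{n_1},\hat k_{n_1},\hat Q_{n_1}$ all depend on $z_{1:n_1}\in\mathcal Z_0^{n_1}$, and $I_{\theta_{n_1}}(\hat Q_{n_1}\hat T_{n_1}\mathcal P)$ denotes the Fisher information at $\theta_{n_1}$ of the model $\hat Q_{n_1}\hat T_{n_1}\mathcal P$ with $z_{1:n_1}$ held fixed.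
   Formalization: The lower bound 0 ≤ gap fails for θ_{n1}≠θ (Bernoulli, e^α=3, θ=1/2, θ_{n1}=1/10); it is proved for θ_{n1}=θ, with gap ≥ −φ(θ,θ_{n1}) in general. C_α is formally chosen per carrier type of the spaces; one C_α for all follows by putting countably many spaces in one disjoint union. *)

theory Defs
  imports "HOL-Probability.Probability" "HOL-Library.Infinite_Typeclass"
begin

section \<open>Dominated models and differentiability in quadratic mean\<close>

definition dominated_model ::
  "'x measure \<Rightarrow> real set \<Rightarrow> (real \<Rightarrow> 'x measure) \<Rightarrow> (real \<Rightarrow> 'x \<Rightarrow> real) \<Rightarrow> bool" where
  "dominated_model \<mu> \<Theta> P p \<longleftrightarrow>
     sigma_finite_measure \<mu> \<and>
     (\<forall>\<theta>\<in>\<Theta>. prob_space (P \<theta>) \<and> p \<theta> \<in> borel_measurable \<mu> \<and> (\<forall>x\<in>space \<mu>. 0 \<le> p \<theta> x) \<and>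
             P \<theta> = density \<mu> (\<lambda>x. ennreal (p \<theta> x)))"

text \<open>The integral is taken in the extended nonnegative reals, so that an infinite value
  is not silently replaced by zero.\<close>

definition DQM_at ::
  "'x measure \<Rightarrow> real set \<Rightarrow> (real \<Rightarrow> 'x \<Rightarrow> real) \<Rightarrow> real \<Rightarrow> ('x \<Rightarrow> real) \<Rightarrow> bool" where
  "DQM_at \<mu> \<Theta> p \<theta> s \<longleftrightarrow>
     \<theta> \<in> interior \<Theta> \<and> s \<in> borel_measurable \<mu> \<and>
     ((\<lambda>h. (\<integral>\<^sup>+x. ennreal ((sqrt (p (\<theta> + h) x) - sqrt (p \<theta> x) - 1/2 * h * s x * sqrt (p \<theta> x))\<^sup>2) \<partial>\<mu>)
            / ennreal (h\<^sup>2)) \<longlongrightarrow> 0) (at 0)"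

text \<open>A model such as the image of \<open>P\<close> under a channel comes without a distinguished dominating
  measure, hence the existential quantifier. The score at \<open>\<theta>\<close> does not depend on the choice of
  the dominating measure and the densities, up to \<open>P \<theta>\<close>-null sets, so \<open>fisher_information\<close> is
  the value \<open>E\<^sub>\<theta>[s\<^sub>\<theta>\<^sup>2]\<close> for every score \<open>s\<^sub>\<theta>\<close>.\<close>

definition is_score ::
  "real set \<Rightarrow> (real \<Rightarrow> 'x measure) \<Rightarrow> real \<Rightarrow> ('x \<Rightarrow> real) \<Rightarrow> bool" where
  "is_score \<Theta> P \<theta> s \<longleftrightarrow> (\<exists>\<mu> p. dominated_model \<mu> \<Theta> P p \<and> DQM_at \<mu> \<Theta> p \<theta> s)"

definition fisher_information :: "real set \<Rightarrow> (real \<Rightarrow> 'x measure) \<Rightarrow> real \<Rightarrow> real" where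
  "fisher_information \<Theta> P \<theta> = (\<integral>x. ((SOME s. is_score \<Theta> P \<theta> s) x)\<^sup>2 \<partial>(P \<theta>))"

abbreviation borel_on :: "real set \<Rightarrow> real measure" where
  "borel_on \<Theta> \<equiv> restrict_space borel \<Theta>"

text \<open>Conditions (C1), (C2), (C3), in this order, for a dominated model.\<close>

definition regular_model ::
  "'x measure \<Rightarrow> real set \<Rightarrow> (real \<Rightarrow> 'x measure) \<Rightarrow> (real \<Rightarrow> 'x \<Rightarrow> real) \<Rightarrow> (real \<Rightarrow> 'x \<Rightarrow> real) \<Rightarrow> bool" where
  "regular_model \<mu> \<Theta> P p s \<longleftrightarrow>
     dominated_model \<mu> \<Theta> P p \<and>
     (\<forall>\<theta>\<in>\<Theta>. DQM_at \<mu> \<Theta> p \<theta> (s \<theta>)) \<and>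
     (\<lambda>(x, \<theta>). p \<theta> x) \<in> borel_measurable (\<mu> \<Otimes>\<^sub>M borel_on \<Theta>) \<and>
     (\<lambda>(x, \<theta>). s \<theta> x) \<in> borel_measurable (\<mu> \<Otimes>\<^sub>M borel_on \<Theta>) \<and>
     (\<forall>\<theta>\<in>\<Theta>. ((\<lambda>\<theta>'. \<integral>\<^sup>+x. ennreal ((s \<theta>' x * sqrt (p \<theta>' x) - s \<theta> x * sqrt (p \<theta> x))\<^sup>2) \<partial>\<mu>) \<longlongrightarrow> 0)
             (at \<theta> within \<Theta>))"

section \<open>Private channels\<close>

text \<open>\<open>M \<rightarrow>\<^sub>M prob_algebra N\<close> is the set of Markov kernels from \<open>M\<close> to \<open>N\<close>. The image \<open>Q P\<close> of a
  probability measure under a kernel is \<open>P \<bind> Q\<close>, and the kernel \<open>Q T\<close> is \<open>\<lambda>x. Q (T x)\<close>.\<close>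

definition private_channels :: "real \<Rightarrow> 'x measure \<Rightarrow> 'z measure \<Rightarrow> ('x \<Rightarrow> 'z measure) set" where
  "private_channels \<alpha> M N =
     {Q \<in> M \<rightarrow>\<^sub>M prob_algebra N.
        \<forall>A\<in>sets N. \<forall>x\<in>space M. \<forall>x'\<in>space M. measure (Q x) A \<le> exp \<alpha> * measure (Q x') A}"

definition image_model :: "('x \<Rightarrow> 'z measure) \<Rightarrow> (real \<Rightarrow> 'x measure) \<Rightarrow> real \<Rightarrow> 'z measure" where
  "image_model Q P = (\<lambda>\<theta>. P \<theta> \<bind> Q)"

text \<open>The supremum of \<open>I\<^sub>\<theta>(Q P)\<close> over all \<open>\<alpha>\<close>-private channels. The output spaces range over all
  measurable spaces whose carrier is a subset of the type \<open>'z\<close>. Quantification over all types is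
  not possible inside a formula; a statement about this constant with a free type variable \<open>'z\<close>
  covers all output spaces. The sort \<open>infinite\<close> makes sure that every finite output
  space is available. The set below is bounded by the Fisher information of \<open>P\<close>
  (data processing), so that \<open>Sup\<close> on the reals is the actual least upper bound.\<close>

definition optimal_private_information ::
  "('z::infinite) itself \<Rightarrow> real \<Rightarrow> 'x measure \<Rightarrow> real set \<Rightarrow> (real \<Rightarrow> 'x measure) \<Rightarrow> real \<Rightarrow> real" where
  "optimal_private_information _ \<alpha> M \<Theta> P \<theta> =
     Sup {fisher_information \<Theta> (image_model Q P) \<theta> | (N::'z measure) Q. Q \<in> private_channels \<alpha> M N}"

abbreviation pnat :: "nat measure" where
  "pnat \<equiv> count_space {1..}"

abbreviation fin :: "nat \<Rightarrow> nat measure" where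
  "fin k \<equiv> count_space {1..k}"

text \<open>The matrices \<open>M\<^sub>\<alpha>(l,k)\<close>, with entries \<open>A i j\<close> for \<open>i \<in> {1..l}\<close> and \<open>j \<in> {1..k}\<close>, and their
  identification with the private channels from \<open>{1..k}\<close> to \<open>{1..l}\<close>; see the two lemmas below.\<close>

definition private_matrices :: "real \<Rightarrow> nat \<Rightarrow> nat \<Rightarrow> (nat \<Rightarrow> nat \<Rightarrow> real) set" where
  "private_matrices \<alpha> l k =
     {A. (\<forall>i\<in>{1..l}. \<forall>j\<in>{1..k}. 0 \<le> A i j) \<and>
         (\<forall>j\<in>{1..k}. (\<Sum>i=1..l. A i j) = 1) \<and>
         (\<forall>i\<in>{1..l}. \<forall>j\<in>{1..k}. \<forall>j'\<in>{1..k}.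
            exp (-\<alpha>) * A i j' \<le> A i j \<and> A i j \<le> exp \<alpha> * A i j')}"

definition matrix_channel :: "nat \<Rightarrow> (nat \<Rightarrow> nat \<Rightarrow> real) \<Rightarrow> nat \<Rightarrow> nat measure" where
  "matrix_channel l A y = point_measure {1..l} (\<lambda>i. ennreal (A i y))"

lemma measure_matrix_channel:
  assumes "A \<in> private_matrices \<alpha> l k" "y \<in> {1..k}" "C \<subseteq> {1..l}"
  shows "measure (matrix_channel l A y) C = (\<Sum>i\<in>C. A i y)"
proof -
  have nn: "0 \<le> A i y" if "i \<in> C" for i
    using assms that unfolding private_matrices_def by blast
  have "emeasure (matrix_channel l A y) C = (\<Sum>i\<in>C. ennreal (A i y))"
    unfolding matrix_channel_def using assms(3)
    by (intro emeasure_point_measure_finite) auto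
  also have "\<dots> = ennreal (\<Sum>i\<in>C. A i y)"
    using nn by simp
  finally show ?thesis
    using nn by (simp add: measure_def sum_nonneg)
qed

lemma matrix_channel_private:
  assumes A: "A \<in> private_matrices \<alpha> l k"
  shows "matrix_channel l A \<in> private_channels \<alpha> (fin k) (fin l)"
proof -
  have sets: "sets (matrix_channel l A y) = sets (fin l)" for y
    by (simp add: matrix_channel_def sets_point_measure)
  have "prob_space (matrix_channel l A y)" if y: "y \<in> {1..k}" for y
  proof
    have nn: "0 \<le> A i y" if "i \<in> {1..l}" for i
      using A y that unfolding private_matrices_def by blast
    have "emeasure (matrix_channel l A y) {1..l} = (\<Sum>i\<in>{1..l}. ennreal (A i y))"
      unfolding matrix_channel_def by (intro emeasure_point_measure_finite) auto
    also have "\<dots> = ennreal (\<Sum>i=1..l. A i y)"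
      using nn by (intro sum_ennreal) auto
    also have "\<dots> = 1"
      using A y unfolding private_matrices_def by auto
    finally show "emeasure (matrix_channel l A y) (space (matrix_channel l A y)) = 1"
      by (simp add: matrix_channel_def space_point_measure)
  qed
  then have "matrix_channel l A \<in> fin k \<rightarrow>\<^sub>M prob_algebra (fin l)"
    using sets by (auto simp: space_prob_algebra)
  moreover have "measure (matrix_channel l A y) C \<le> exp \<alpha> * measure (matrix_channel l A y') C"
    if "C \<in> sets (fin l)" "y \<in> space (fin k)" "y' \<in> space (fin k)" for C y y'
  proof -
    have "(\<Sum>i\<in>C. A i y) \<le> (\<Sum>i\<in>C. exp \<alpha> * A i y')"
      using A that unfolding private_matrices_def by (intro sum_mono) auto
    then show ?thesis
      using that by (simp add: measure_matrix_channel[OF A] sum_distrib_left)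
  qed
  ultimately show ?thesis
    unfolding private_channels_def by blast
qed

lemma private_channel_matrix:
  assumes Q: "Q \<in> private_channels \<alpha> (fin k) (fin l)"
  defines "A \<equiv> \<lambda>i j. measure (Q j) {i}"
  shows "A \<in> private_matrices \<alpha> l k" "\<And>y. y \<in> {1..k} \<Longrightarrow> Q y = matrix_channel l A y"
proof -
  have Q_prob: "prob_space (Q y)" and Q_sets: "sets (Q y) = Pow {1..l}" if "y \<in> {1..k}" for y
    using Q that measurable_space[of Q "fin k" "prob_algebra (fin l)" y]
    by (auto simp: private_channels_def space_prob_algebra)
  have dp: "A i y \<le> exp \<alpha> * A i y'" if "y \<in> {1..k}" "y' \<in> {1..k}" "i \<in> {1..l}" for y y' i
    using Q that unfolding private_channels_def A_def by auto
  have one: "(\<Sum>i=1..l. A i y) = 1" if y: "y \<in> {1..k}" for y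
  proof -
    interpret prob_space "Q y" by (rule Q_prob[OF y])
    have "space (Q y) = {1..l}"
      using Q_sets[OF y] by (metis sets_eq_imp_space_eq sets_count_space space_count_space)
    moreover have "measure (Q y) {1..l} = (\<Sum>i=1..l. A i y)"
      unfolding A_def using Q_sets[OF y]
      by (intro measure_eq_sum_singleton) auto
    ultimately show ?thesis
      using prob_space by simp
  qed
  have "exp (-\<alpha>) * A i y' \<le> A i y" if "y \<in> {1..k}" "y' \<in> {1..k}" "i \<in> {1..l}" for y y' i
    using dp[of y' y i] that by (simp add: exp_minus field_simps)
  then show "A \<in> private_matrices \<alpha> l k"
    unfolding private_matrices_def using dp one by (auto simp: A_def)
  show "Q y = matrix_channel l A y" if y: "y \<in> {1..k}" for y
  proof (rule measure_eqI_finite[of _ "{1..l}"])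
    interpret prob_space "Q y" by (rule Q_prob[OF y])
    fix i assume "i \<in> {1..l}"
    then show "emeasure (Q y) {i} = emeasure (matrix_channel l A y) {i}"
      unfolding matrix_channel_def
      by (subst emeasure_point_measure_finite) (auto simp: A_def emeasure_eq_measure)
  qed (use Q_sets[OF y] in \<open>auto simp: matrix_channel_def sets_point_measure\<close>)
qed

section \<open>Consistent quantizers\<close>

definition cell ::
  "'x measure \<Rightarrow> (nat \<Rightarrow> 'x \<Rightarrow> real \<Rightarrow> nat) \<Rightarrow> nat \<Rightarrow> real \<Rightarrow> nat \<Rightarrow> 'x set" where
  "cell \<mu> T m \<theta> j = {x \<in> space \<mu>. T m x \<theta> = j}"

definition good_cells ::
  "'x measure \<Rightarrow> (nat \<Rightarrow> 'x \<Rightarrow> real \<Rightarrow> nat) \<Rightarrow> (nat \<Rightarrow> real \<Rightarrow> nat) \<Rightarrow> nat \<Rightarrow> real \<Rightarrow> nat set" where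
  "good_cells \<mu> T k m \<theta> =
     {l \<in> {1..k m \<theta>}. 0 < emeasure \<mu> (cell \<mu> T m \<theta> l) \<and> emeasure \<mu> (cell \<mu> T m \<theta> l) < \<infinity>}"

definition good_region ::
  "'x measure \<Rightarrow> (nat \<Rightarrow> 'x \<Rightarrow> real \<Rightarrow> nat) \<Rightarrow> (nat \<Rightarrow> real \<Rightarrow> nat) \<Rightarrow> nat \<Rightarrow> real \<Rightarrow> 'x set" where
  "good_region \<mu> T k m \<theta> = (\<Union>j\<in>good_cells \<mu> T k m \<theta>. cell \<mu> T m \<theta> j)"

definition cell_average ::
  "'x measure \<Rightarrow> (nat \<Rightarrow> 'x \<Rightarrow> real \<Rightarrow> nat) \<Rightarrow> (nat \<Rightarrow> real \<Rightarrow> nat) \<Rightarrow> nat \<Rightarrow> real \<Rightarrow> ('x \<Rightarrow> real) \<Rightarrow> 'x \<Rightarrow> real"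
where
  "cell_average \<mu> T k m \<theta> f x =
     (\<Sum>j\<in>good_cells \<mu> T k m \<theta>.
        (LINT y:cell \<mu> T m \<theta> j|\<mu>. f y) / measure \<mu> (cell \<mu> T m \<theta> j) * indicator (cell \<mu> T m \<theta> j) x)"

text \<open>Only applied to \<open>\<mu>\<close>-integrable functions below.\<close>

definition L1_norm :: "'x measure \<Rightarrow> ('x \<Rightarrow> real) \<Rightarrow> real" where
  "L1_norm \<mu> f = (\<integral>x. \<bar>f x\<bar> \<partial>\<mu>)"

definition quantization_error ::
  "'x measure \<Rightarrow> (real \<Rightarrow> 'x measure) \<Rightarrow> (real \<Rightarrow> 'x \<Rightarrow> real) \<Rightarrow> (real \<Rightarrow> 'x \<Rightarrow> real) \<Rightarrow>
   (nat \<Rightarrow> 'x \<Rightarrow> real \<Rightarrow> nat) \<Rightarrow> (nat \<Rightarrow> real \<Rightarrow> nat) \<Rightarrow> nat \<Rightarrow> real \<Rightarrow> real" where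
  "quantization_error \<mu> P p s T k m \<theta> =
     (let K = good_region \<mu> T k m \<theta>; pdot = (\<lambda>x. s \<theta> x * p \<theta> x) in
        L1_norm \<mu> (\<lambda>x. (p \<theta> x - cell_average \<mu> T k m \<theta> (p \<theta>) x) * indicator K x) +
        L1_norm \<mu> (\<lambda>x. (pdot x - cell_average \<mu> T k m \<theta> pdot x) * indicator K x) +
        sqrt (measure (P \<theta>) (space \<mu> - K)))"

definition consistent_quantizer ::
  "'x measure \<Rightarrow> real set \<Rightarrow> (real \<Rightarrow> 'x measure) \<Rightarrow> (real \<Rightarrow> 'x \<Rightarrow> real) \<Rightarrow> (real \<Rightarrow> 'x \<Rightarrow> real) \<Rightarrow>
   (nat \<Rightarrow> 'x \<Rightarrow> real \<Rightarrow> nat) \<Rightarrow> (nat \<Rightarrow> real \<Rightarrow> nat) \<Rightarrow> bool" where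
  "consistent_quantizer \<mu> \<Theta> P p s T k \<longleftrightarrow>
     (\<forall>m\<ge>1. (\<lambda>(x, \<theta>). T m x \<theta>) \<in> (\<mu> \<Otimes>\<^sub>M borel_on \<Theta>) \<rightarrow>\<^sub>M pnat) \<and>
     (\<forall>m\<ge>1. k m \<in> borel_on \<Theta> \<rightarrow>\<^sub>M pnat) \<and>
     (\<forall>m\<ge>1. \<forall>\<theta>\<in>\<Theta>. \<forall>x\<in>space \<mu>. T m x \<theta> \<in> {1..k m \<theta>}) \<and>
     (\<forall>\<tau> \<theta>. (\<forall>m. \<tau> m \<in> \<Theta>) \<longrightarrow> \<theta> \<in> \<Theta> \<longrightarrow> \<tau> \<longlonglongrightarrow> \<theta> \<longrightarrow>
        (\<lambda>m. quantization_error \<mu> P p s T k m (\<tau> m)) \<longlonglongrightarrow> 0)"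

section \<open>Measurable maximizers\<close>

text \<open>A kernel \<open>Q\<close> from \<open>\<nat> \<times> \<Theta>\<close> to \<open>\<nat>\<close>, read at \<open>\<theta>\<close> as a kernel with values in \<open>{1..k}\<close>.\<close>

definition kernel_at :: "(nat \<times> real \<Rightarrow> nat measure) \<Rightarrow> nat \<Rightarrow> real \<Rightarrow> nat \<Rightarrow> nat measure" where
  "kernel_at Q k \<theta> y = restrict_space (Q (y, \<theta>)) {1..k}"

definition measurable_maximizer ::
  "real \<Rightarrow> real set \<Rightarrow> (real \<Rightarrow> 'x measure) \<Rightarrow> ('x \<Rightarrow> real \<Rightarrow> nat) \<Rightarrow> (real \<Rightarrow> nat) \<Rightarrow>
   (nat \<times> real \<Rightarrow> nat measure) \<Rightarrow> bool" where
  "measurable_maximizer \<alpha> \<Theta> P T k Q \<longleftrightarrow>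
     Q \<in> (pnat \<Otimes>\<^sub>M borel_on \<Theta>) \<rightarrow>\<^sub>M prob_algebra pnat \<and>
     (\<forall>\<theta>\<in>\<Theta>. kernel_at Q (k \<theta>) \<theta> \<in> private_channels \<alpha> (fin (k \<theta>)) (fin (k \<theta>)) \<and>
        (\<forall>Q'\<in>private_channels \<alpha> (fin (k \<theta>)) (fin (k \<theta>)).
           fisher_information \<Theta> (image_model (\<lambda>x. Q' (T x \<theta>)) P) \<theta>
           \<le> fisher_information \<Theta> (image_model (\<lambda>x. kernel_at Q (k \<theta>) \<theta> (T x \<theta>)) P) \<theta>)) \<and>
     (\<forall>\<theta>\<^sub>0\<in>\<Theta>. (\<lambda>\<theta>. fisher_information \<Theta> (image_model (\<lambda>x. kernel_at Q (k \<theta>) \<theta> (T x \<theta>)) P) \<theta>\<^sub>0)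
        \<in> borel_measurable (borel_on \<Theta>))"

section \<open>The error bound\<close>

definition phi ::
  "real \<Rightarrow> 'x measure \<Rightarrow> real set \<Rightarrow> (real \<Rightarrow> 'x measure) \<Rightarrow> (real \<Rightarrow> 'x \<Rightarrow> real) \<Rightarrow> (real \<Rightarrow> 'x \<Rightarrow> real) \<Rightarrow>
   real \<Rightarrow> real \<Rightarrow> real" where
  "phi \<alpha> \<mu> \<Theta> P p s \<theta> \<theta>' =
     exp (2 * \<alpha>) * max (max (fisher_information \<Theta> P \<theta>) (fisher_information \<Theta> P \<theta>')) 1 *
     (2 * L1_norm \<mu> (\<lambda>x. s \<theta> x * p \<theta> x - s \<theta>' x * p \<theta>' x) + 3 * L1_norm \<mu> (\<lambda>x. p \<theta> x - p \<theta>' x))"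

text \<open>The arguments \<open>\<theta>\<close>, \<open>\<theta>'\<close>, \<open>\<theta>''\<close> stand for the true parameter, the preliminary estimate and
  \<open>\<theta>\<^sub>n\<close>. The quantity bounded by it, the optimal information at \<open>\<theta>\<close> minus the attained information
  at \<open>\<theta>\<^sub>n\<close>, is nonnegative for \<open>\<theta>\<^sub>n = \<theta>\<close>. For \<open>\<theta>\<^sub>n \<noteq> \<theta>\<close> it can be negative, because the
  optimal information varies with the parameter; it is then at least \<open>- phi \<theta> \<theta>\<^sub>n\<close>.\<close>

definition upper_bound ::
  "real \<Rightarrow> real \<Rightarrow> 'x measure \<Rightarrow> real set \<Rightarrow> (real \<Rightarrow> 'x measure) \<Rightarrow> (real \<Rightarrow> 'x \<Rightarrow> real) \<Rightarrow>
   (real \<Rightarrow> 'x \<Rightarrow> real) \<Rightarrow> (nat \<Rightarrow> 'x \<Rightarrow> real \<Rightarrow> nat) \<Rightarrow> (nat \<Rightarrow> real \<Rightarrow> nat) \<Rightarrow> nat \<Rightarrow>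
   real \<Rightarrow> real \<Rightarrow> real \<Rightarrow> real" where
  "upper_bound C \<alpha> \<mu> \<Theta> P p s T k n \<theta> \<theta>' \<theta>'' =
     2 * phi \<alpha> \<mu> \<Theta> P p s \<theta> \<theta>' + phi \<alpha> \<mu> \<Theta> P p s \<theta> \<theta>'' +
     C * max 1 (fisher_information \<Theta> P \<theta>') * quantization_error \<mu> P p s T k n \<theta>'"

abbreviation sample_space :: "'z measure \<Rightarrow> nat \<Rightarrow> (nat \<Rightarrow> 'z) measure" where
  "sample_space Z n \<equiv> Pi\<^sub>M {1..n} (\<lambda>_. Z)"

text \<open>Convergence in probability along a sequence of probability spaces. Measurability is part of
  the notion: \<open>measure\<close> vanishes on nonmeasurable sets, so the limit alone would be too weak.\<close>

definition tendsto_in_prob ::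
  "(nat \<Rightarrow> 'w measure) \<Rightarrow> (nat \<Rightarrow> 'w \<Rightarrow> real) \<Rightarrow> real \<Rightarrow> bool" where
  "tendsto_in_prob M X c \<longleftrightarrow>
     (\<forall>n\<ge>1. X n \<in> borel_measurable (M n)) \<and>
     (\<forall>\<epsilon>>0. (\<lambda>n. measure (M n) {w \<in> space (M n). \<epsilon> < \<bar>X n w - c\<bar>}) \<longlonglongrightarrow> 0)"

end

theory Submission
  imports Defs
begin

text \<open>The Fisher information of a privatized model has a variational form. If \<open>g\<close> is the score of the
  image of \<open>P\<close> under a private channel \<open>Q\<close>, then completing the square in \<open>\<integral>(u - g)\<^sup>2\<close> shows that the
  information is the maximum over bounded test functions \<open>u\<close> of a functional
  \<open>2 \<integral>(Q u) s p - \<integral>(Q u\<^sup>2) p\<close>, where \<open>Q u\<close> is the integral of \<open>u\<close> against the kernel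
  (\<open>score_functional_le\<close>, \<open>score_functional_attained\<close>). For fixed \<open>u\<close> the functional is linear in the
  channel and in the densities, and privacy bounds the optimal \<open>u\<close> by \<open>e\<^sup>\<alpha> \<surd>I\<close>, uniformly over all channels, with \<open>I\<close>
  the information of \<open>P\<close>. Every comparison of two informations below takes the optimal test
  function of one side, up to rounding, and uses it on the other.

  For this to make sense the image model has to be differentiable in quadratic mean. Privacy makes
  that easy: the expansion of \<open>p\<close> in \<open>L\<^sub>1\<close> becomes a uniform expansion of the densities of the image
  with respect to its distribution at \<open>\<theta>\<close> (\<open>private_image_score\<close>). The score does not depend on the
  dominating measure, because it is determined by the derivatives of expectations
  (\<open>score_unique\<close>).

  Three comparisons give the bound on the gap. Changing the parameter costs \<open>phi\<close>
  (\<open>fisher_information_continuity\<close>). Replacing the input by its cell costs a multiple of the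
  quantization error, because averaging the channel over a cell has the same effect on the
  functional as averaging the densities (\<open>input_quantization\<close>). Finally, a channel with \<open>k\<close> input
  symbols needs only \<open>k\<close> output symbols: with one value of the test function attached to each output
  symbol, the functional is linear in the rows of the channel matrix, and a basic solution of the
  resulting linear program has at most \<open>k\<close> nonzero rows (\<open>output_reduction\<close>). The maximizer over
  square matrices is therefore optimal among all channels up to the quantization error, at the
  parameter for which it was computed.

  The upper bound tends to zero along every sequence of estimates that tends to \<open>\<theta>\<close>, because \<open>p\<close> and
  \<open>s p\<close> are continuous in \<open>L\<^sub>1\<close> and the quantizer is consistent. Convergence along all sequences is
  locally uniform (\<open>locally_uniform_if_sequential\<close>), which turns convergence in probability of the
  estimator into convergence in probability of the bound.\<close>

section \<open>Expansion of the densities in \<open>L\<^sub>1\<close>\<close>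

lemma Cauchy_Schwarz_integral:
  fixes f g :: "'a \<Rightarrow> real"
  assumes [measurable]: "f \<in> borel_measurable M" "g \<in> borel_measurable M"
    and f2: "integrable M (\<lambda>x. (f x)\<^sup>2)" and g2: "integrable M (\<lambda>x. (g x)\<^sup>2)"
  shows "integrable M (\<lambda>x. f x * g x)"
    and "(\<integral>x. \<bar>f x * g x\<bar> \<partial>M) \<le> sqrt (\<integral>x. (f x)\<^sup>2 \<partial>M) * sqrt (\<integral>x. (g x)\<^sup>2 \<partial>M)"
proof -
  show int: "integrable M (\<lambda>x. f x * g x)"
  proof (rule Bochner_Integration.integrable_bound[OF Bochner_Integration.integrable_add[OF f2 g2]])
    have "\<bar>a * b\<bar> \<le> \<bar>a\<^sup>2 + b\<^sup>2\<bar>" for a b :: real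
    proof -
      have "0 \<le> (\<bar>a\<bar> - \<bar>b\<bar>)\<^sup>2" "0 \<le> a\<^sup>2" "0 \<le> b\<^sup>2" by auto
      then have "2 * (\<bar>a\<bar> * \<bar>b\<bar>) \<le> a\<^sup>2 + b\<^sup>2" by (simp add: power2_diff)
      moreover have "0 \<le> \<bar>a\<bar> * \<bar>b\<bar>" by simp
      ultimately have "\<bar>a\<bar> * \<bar>b\<bar> \<le> a\<^sup>2 + b\<^sup>2" by linarith
      then show ?thesis by (simp add: abs_mult)
    qed
    then show "AE x in M. norm (f x * g x) \<le> norm ((f x)\<^sup>2 + (g x)\<^sup>2)" by simp
  qed measurable
  have "(ennreal (\<integral>x. \<bar>f x * g x\<bar> \<partial>M))\<^sup>2 = (\<integral>\<^sup>+x. ennreal \<bar>f x\<bar> * ennreal \<bar>g x\<bar> \<partial>M)\<^sup>2"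
    using integrable_abs[OF int]
    by (subst nn_integral_eq_integral[symmetric]) (auto simp: ennreal_mult abs_mult)
  also have "\<dots> \<le> (\<integral>\<^sup>+x. (ennreal \<bar>f x\<bar>)\<^sup>2 \<partial>M) * (\<integral>\<^sup>+x. (ennreal \<bar>g x\<bar>)\<^sup>2 \<partial>M)"
    by (rule Cauchy_Schwarz_nn_integral) auto
  also have "\<dots> = ennreal (\<integral>x. (f x)\<^sup>2 \<partial>M) * ennreal (\<integral>x. (g x)\<^sup>2 \<partial>M)"
    using f2 g2 by (simp add: ennreal_power nn_integral_eq_integral)
  finally have "(\<integral>x. \<bar>f x * g x\<bar> \<partial>M)\<^sup>2 \<le> (\<integral>x. (f x)\<^sup>2 \<partial>M) * (\<integral>x. (g x)\<^sup>2 \<partial>M)"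
    by (simp add: ennreal_power ennreal_mult[symmetric] ennreal_le_iff)
  then show "(\<integral>x. \<bar>f x * g x\<bar> \<partial>M) \<le> sqrt (\<integral>x. (f x)\<^sup>2 \<partial>M) * sqrt (\<integral>x. (g x)\<^sup>2 \<partial>M)"
    by (simp add: real_le_rsqrt real_sqrt_mult[symmetric])
qed

lemma integrable_mult_bounded:
  fixes f w :: "'a \<Rightarrow> real"
  assumes f: "integrable M f" and [measurable]: "w \<in> borel_measurable M"
    and W: "\<And>x. x \<in> space M \<Longrightarrow> \<bar>w x\<bar> \<le> W"
  shows "integrable M (\<lambda>x. w x * f x)"
proof (rule Bochner_Integration.integrable_bound[of _ "\<lambda>x. W * \<bar>f x\<bar>"])
  show "AE x in M. norm (w x * f x) \<le> norm (W * \<bar>f x\<bar>)"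
  proof (rule AE_I2)
    fix x assume "x \<in> space M"
    from W[OF this] show "norm (w x * f x) \<le> norm (W * \<bar>f x\<bar>)"
      by (auto simp: abs_mult intro!: mult_right_mono)
  qed
qed (use f in auto)

lemma abs_integral_mult_le:
  fixes f w :: "'a \<Rightarrow> real"
  assumes f: "integrable M f" and [measurable]: "w \<in> borel_measurable M"
    and W: "\<And>x. x \<in> space M \<Longrightarrow> \<bar>w x\<bar> \<le> W"
  shows "\<bar>\<integral>x. w x * f x \<partial>M\<bar> \<le> W * (\<integral>x. \<bar>f x\<bar> \<partial>M)"
proof -
  have "\<bar>\<integral>x. w x * f x \<partial>M\<bar> \<le> (\<integral>x. \<bar>w x * f x\<bar> \<partial>M)"
    using integral_norm_bound[of M "\<lambda>x. w x * f x"] by simp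
  also have "\<dots> \<le> (\<integral>x. W * \<bar>f x\<bar> \<partial>M)"
    using integrable_mult_bounded[OF assms, THEN integrable_abs] f W
    by (intro integral_mono) (auto simp: abs_mult intro!: mult_right_mono)
  finally show ?thesis by simp
qed

lemma dominated_modelD:
  assumes "dominated_model \<mu> \<Theta> P p" "\<theta> \<in> \<Theta>"
  shows "prob_space (P \<theta>)" "p \<theta> \<in> borel_measurable \<mu>" "\<And>x. x \<in> space \<mu> \<Longrightarrow> 0 \<le> p \<theta> x"
    "P \<theta> = density \<mu> (\<lambda>x. ennreal (p \<theta> x))" "sets (P \<theta>) = sets \<mu>" "space (P \<theta>) = space \<mu>"
    "integrable \<mu> (p \<theta>)" "(\<integral>x. p \<theta> x \<partial>\<mu>) = 1" "sigma_finite_measure \<mu>"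
proof -
  show 1: "prob_space (P \<theta>)" "p \<theta> \<in> borel_measurable \<mu>" "\<And>x. x \<in> space \<mu> \<Longrightarrow> 0 \<le> p \<theta> x"
    "P \<theta> = density \<mu> (\<lambda>x. ennreal (p \<theta> x))" "sigma_finite_measure \<mu>"
    using assms by (auto simp: dominated_model_def)
  then show "sets (P \<theta>) = sets \<mu>" "space (P \<theta>) = space \<mu>" by simp_all
  have AE: "AE x in \<mu>. 0 \<le> p \<theta> x" using 1(3) by auto
  have "(\<integral>\<^sup>+x. ennreal (p \<theta> x) \<partial>\<mu>) = emeasure (P \<theta>) (space \<mu>)"
    using 1(2) by (subst 1(4)) (auto simp: emeasure_density cong: nn_integral_cong)
  also have "\<dots> = 1"
    using prob_space.emeasure_space_1[OF 1(1)] \<open>space (P \<theta>) = space \<mu>\<close> by simp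
  finally have nn: "(\<integral>\<^sup>+x. ennreal (p \<theta> x) \<partial>\<mu>) = ennreal 1" by simp
  show "integrable \<mu> (p \<theta>)"
    by (rule integrableI_nn_integral_finite[OF 1(2) AE nn])
  show "(\<integral>x. p \<theta> x \<partial>\<mu>) = 1"
    using integral_eq_nn_integral[OF 1(2) AE] nn by simp
qed

lemma integral_dominated_model:
  assumes "dominated_model \<mu> \<Theta> P p" "\<theta> \<in> \<Theta>" "f \<in> borel_measurable \<mu>"
  shows "integral\<^sup>L (P \<theta>) f = (\<integral>x. f x * p \<theta> x \<partial>\<mu>)"
    "integrable (P \<theta>) f \<longleftrightarrow> integrable \<mu> (\<lambda>x. f x * p \<theta> x)"
  unfolding dominated_modelD(4)[OF assms(1,2)]
  using dominated_modelD(2,3)[OF assms(1,2)] assms(3)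
  by (auto simp: integral_real_density integrable_real_density mult.commute)

text \<open>Squaring \<open>\<surd>p(\<theta> + h) = \<surd>p(\<theta>) + h s \<surd>p(\<theta>) / 2 + r\<close> gives the linear term \<open>h s p(\<theta>)\<close>, a cross
  term \<open>2 \<surd>p(\<theta>) r\<close>, which is \<open>o(h)\<close> in \<open>L\<^sub>1\<close> by Cauchy-Schwarz, and a square of order \<open>h\<^sup>2\<close>. The
  \<open>L\<^sub>1\<close>-expansion is linear in the densities, so that it survives the application of a channel.\<close>

lemma DQM_imp_L1_differentiable:
  assumes mod: "dominated_model \<mu> \<Theta> P p" and dqm: "DQM_at \<mu> \<Theta> p \<theta> s" and th: "\<theta> \<in> \<Theta>"
  shows "integrable \<mu> (\<lambda>x. (s x)\<^sup>2 * p \<theta> x)"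
    and "((\<lambda>h. (\<integral>x. \<bar>p (\<theta> + h) x - p \<theta> x - h * (s x * p \<theta> x)\<bar> \<partial>\<mu>) / \<bar>h\<bar>) \<longlongrightarrow> 0) (at 0)"
proof -
  note [measurable] = dominated_modelD(2)[OF mod]
  have [measurable]: "s \<in> borel_measurable \<mu>" using dqm by (simp add: DQM_at_def)
  define r where "r h x = sqrt (p (\<theta> + h) x) - sqrt (p \<theta> x) - 1/2 * h * s x * sqrt (p \<theta> x)" for h x
  define R where "R h = (\<integral>\<^sup>+x. ennreal ((r h x)\<^sup>2) \<partial>\<mu>)" for h
  have lim: "((\<lambda>h. R h / ennreal (h\<^sup>2)) \<longlongrightarrow> 0) (at 0)"
    using dqm by (simp add: DQM_at_def R_def r_def)
  have "\<theta> \<in> interior \<Theta>" using dqm by (simp add: DQM_at_def)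
  then obtain e where e: "e > 0" "ball \<theta> e \<subseteq> \<Theta>"
    by (auto simp: mem_interior)
  have ev_in: "\<forall>\<^sub>F h in at 0. \<theta> + h \<in> \<Theta>"
    unfolding eventually_at using e by (intro exI[of _ e]) (auto simp: subset_iff dist_norm)
  have ev_fin: "\<forall>\<^sub>F h in at 0. R h < \<infinity>"
  proof -
    have "\<forall>\<^sub>F h in at 0. R h / ennreal (h\<^sup>2) < 1"
      using lim by (rule order_tendstoD) simp
    moreover have "\<forall>\<^sub>F h in at (0::real). h \<noteq> 0" by (simp add: eventually_at_filter)
    ultimately show ?thesis
    proof eventually_elim
      case (elim h)
      then show ?case by (cases "R h = \<infinity>") (auto simp: ennreal_top_divide less_top)
    qed
  qed
  have ev_ne: "\<forall>\<^sub>F h in at (0::real). h \<noteq> 0" by (simp add: eventually_at_filter)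
  have r_int: "integrable \<mu> (\<lambda>x. (r h x)\<^sup>2)" "ennreal (\<integral>x. (r h x)\<^sup>2 \<partial>\<mu>) = R h"
    if "\<theta> + h \<in> \<Theta>" "R h < \<infinity>" for h
  proof -
    have [measurable]: "r h \<in> borel_measurable \<mu>" unfolding r_def using th that by measurable
    show i: "integrable \<mu> (\<lambda>x. (r h x)\<^sup>2)"
      using that unfolding R_def by (intro integrableI_bounded) auto
    show "ennreal (\<integral>x. (r h x)\<^sup>2 \<partial>\<mu>) = R h"
      unfolding R_def using i by (subst nn_integral_eq_integral) auto
  qed
  have int_p: "integrable \<mu> (p t)" "(\<integral>x. p t x \<partial>\<mu>) = 1" "\<And>x. x \<in> space \<mu> \<Longrightarrow> 0 \<le> p t x"
    if "t \<in> \<Theta>" for t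
    using dominated_modelD[OF mod that] by auto
  show s2: "integrable \<mu> (\<lambda>x. (s x)\<^sup>2 * p \<theta> x)"
  proof -
    have "\<forall>\<^sub>F h in at 0. h \<noteq> 0 \<and> \<theta> + h \<in> \<Theta> \<and> R h < \<infinity>"
      using ev_ne ev_in ev_fin by eventually_elim auto
    then obtain h where h: "h \<noteq> 0" "\<theta> + h \<in> \<Theta>" "R h < \<infinity>"
      using eventually_happens'[OF at_neq_bot] by blast
    \<comment> \<open>The definition of the remainder at one fixed \<open>h\<close>, solved for \<open>s \<surd>p\<close>, bounds the
      square \<open>s\<^sup>2 p\<close> by integrable functions.\<close>
    let ?B = "\<lambda>x. (16 * p (\<theta>+h) x + 16 * p \<theta> x + 8 * (r h x)\<^sup>2) / h\<^sup>2"
    show ?thesis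
    proof (rule Bochner_Integration.integrable_bound)
      show "integrable \<mu> ?B" using int_p(1) th h r_int(1) by auto
      show "AE x in \<mu>. norm ((s x)\<^sup>2 * p \<theta> x) \<le> norm (?B x)"
      proof (rule AE_I2)
        fix x assume x: "x \<in> space \<mu>"
        let ?a = "sqrt (p (\<theta>+h) x)" and ?b = "sqrt (p \<theta> x)"
        have nn: "0 \<le> p (\<theta>+h) x" "0 \<le> p \<theta> x" using int_p(3) x th h by auto
        have sq: "(a - b - c)\<^sup>2 \<le> 4 * a\<^sup>2 + 4 * b\<^sup>2 + 2 * c\<^sup>2" for a b c :: real
        proof -
          have "0 \<le> (a - b + c)\<^sup>2" "0 \<le> (a + b)\<^sup>2" by auto
          then have "0 \<le> (a - b + c)\<^sup>2 + 2 * (a + b)\<^sup>2" by simp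
          then show ?thesis by (simp add: power2_eq_square algebra_simps)
        qed
        have "h\<^sup>2 * ((s x)\<^sup>2 * p \<theta> x) = 4 * (1/2 * h * s x * ?b)\<^sup>2"
          using nn by (simp add: power_mult_distrib power_divide)
        also have "1/2 * h * s x * ?b = ?a - ?b - r h x"
          by (simp add: r_def)
        also have "4 * (?a - ?b - r h x)\<^sup>2 \<le> 4 * (4 * ?a\<^sup>2 + 4 * ?b\<^sup>2 + 2 * (r h x)\<^sup>2)"
          using sq by (intro mult_left_mono) auto
        also have "\<dots> = 16 * p (\<theta>+h) x + 16 * p \<theta> x + 8 * (r h x)\<^sup>2"
          using nn by simp
        finally have "(s x)\<^sup>2 * p \<theta> x \<le> ?B x"
          using h(1) by (simp add: field_simps)
        then show "norm ((s x)\<^sup>2 * p \<theta> x) \<le> norm (?B x)"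
          using nn by simp
      qed
    qed (use th in measurable)
  qed
  define I where "I = (\<integral>x. (s x)\<^sup>2 * p \<theta> x \<partial>\<mu>)"
  define \<rho> where "\<rho> h = enn2real (R h / ennreal (h\<^sup>2))" for h
  have rho: "(\<rho> \<longlongrightarrow> 0) (at 0)"
    using tendsto_enn2real[of _ 0, OF lim[folded ennreal_0]] unfolding \<rho>_def by simp
  have bound: "\<forall>\<^sub>F h in at 0. (\<integral>x. \<bar>p (\<theta> + h) x - p \<theta> x - h * (s x * p \<theta> x)\<bar> \<partial>\<mu>) / \<bar>h\<bar>
      \<le> 2 * sqrt (\<rho> h) + \<bar>h\<bar> / 2 * I + 2 * \<bar>h\<bar> * \<rho> h"
    using ev_ne ev_in ev_fin
  proof eventually_elim
    case (elim h)
    have [measurable]: "r h \<in> borel_measurable \<mu>" unfolding r_def using th elim by measurable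
    define S where "S = (\<integral>x. (r h x)\<^sup>2 \<partial>\<mu>)"
    have S0: "0 \<le> S" unfolding S_def by simp
    have "R h = ennreal S" using r_int(2) elim by (simp add: S_def)
    then have rhoS: "\<rho> h = S / h\<^sup>2"
      unfolding \<rho>_def using elim S0 by (simp add: divide_ennreal)
    note ri = r_int(1)[OF elim(2,3)]
    have sp: "integrable \<mu> (\<lambda>x. (sqrt (p \<theta> x))\<^sup>2)" "(\<integral>x. (sqrt (p \<theta> x))\<^sup>2 \<partial>\<mu>) = 1"
    proof -
      show "integrable \<mu> (\<lambda>x. (sqrt (p \<theta> x))\<^sup>2)"
        using int_p(1)[OF th] int_p(3)[OF th] by (subst Bochner_Integration.integrable_cong[OF refl, of _ _ "p \<theta>"]) auto
      show "(\<integral>x. (sqrt (p \<theta> x))\<^sup>2 \<partial>\<mu>) = 1"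
        using int_p(2)[OF th] int_p(3)[OF th] by (subst Bochner_Integration.integral_cong[OF refl, of _ _ "p \<theta>"]) auto
    qed
    have m1[measurable]: "(\<lambda>x. sqrt (p \<theta> x)) \<in> borel_measurable \<mu>" using th by measurable
    note cs = Cauchy_Schwarz_integral[OF m1 _ sp(1) ri]
    have pt: "\<bar>p (\<theta> + h) x - p \<theta> x - h * (s x * p \<theta> x)\<bar>
      \<le> 2 * \<bar>sqrt (p \<theta> x) * r h x\<bar> + (h\<^sup>2 / 2 * ((s x)\<^sup>2 * p \<theta> x) + 2 * (r h x)\<^sup>2)" if "x \<in> space \<mu>" for x
    proof -
      let ?b = "sqrt (p \<theta> x)"
      have nn: "0 \<le> p (\<theta>+h) x" "0 \<le> p \<theta> x" using int_p(3) that th elim by auto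
      define c where "c = 1/2 * h * s x * ?b"
      have a: "p (\<theta>+h) x = (?b + c + r h x)\<^sup>2"
        using nn by (simp add: r_def c_def)
      have b: "p \<theta> x = ?b\<^sup>2" using nn by simp
      have "h * (s x * p \<theta> x) = 2 * ?b * c"
        using nn by (simp add: c_def)
      then have "p (\<theta> + h) x - p \<theta> x - h * (s x * p \<theta> x) = 2 * (?b * r h x) + (c + r h x)\<^sup>2"
        unfolding a using b by (simp add: power2_eq_square algebra_simps)
      moreover have "(c + r h x)\<^sup>2 \<le> 2 * c\<^sup>2 + 2 * (r h x)\<^sup>2"
        using sum_squares_bound[of c "r h x"] by (simp add: power2_sum)
      moreover have "2 * c\<^sup>2 = h\<^sup>2 / 2 * ((s x)\<^sup>2 * p \<theta> x)"
        using nn by (simp add: c_def power_mult_distrib power_divide)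
      moreover have "0 \<le> (c + r h x)\<^sup>2" by simp
      ultimately show ?thesis by linarith
    qed
    have lhs_int: "integrable \<mu> (\<lambda>x. \<bar>p (\<theta> + h) x - p \<theta> x - h * (s x * p \<theta> x)\<bar>)" 
    proof (rule Bochner_Integration.integrable_bound)
      show "integrable \<mu> (\<lambda>x. 2 * \<bar>sqrt (p \<theta> x) * r h x\<bar> + (h\<^sup>2 / 2 * ((s x)\<^sup>2 * p \<theta> x) + 2 * (r h x)\<^sup>2))"
        using cs(1) s2 ri by auto
      show "AE x in \<mu>. norm \<bar>p (\<theta> + h) x - p \<theta> x - h * (s x * p \<theta> x)\<bar> \<le> norm
        (2 * \<bar>sqrt (p \<theta> x) * r h x\<bar> + (h\<^sup>2 / 2 * ((s x)\<^sup>2 * p \<theta> x) + 2 * (r h x)\<^sup>2))"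
        by (intro AE_I2) (use pt in force)
    qed (use th elim in measurable)
    have "(\<integral>x. \<bar>p (\<theta> + h) x - p \<theta> x - h * (s x * p \<theta> x)\<bar> \<partial>\<mu>)
      \<le> (\<integral>x. 2 * \<bar>sqrt (p \<theta> x) * r h x\<bar> + (h\<^sup>2 / 2 * ((s x)\<^sup>2 * p \<theta> x) + 2 * (r h x)\<^sup>2) \<partial>\<mu>)"
      using cs(1) s2 ri lhs_int pt by (intro integral_mono) auto
    also have "\<dots> = 2 * (\<integral>x. \<bar>sqrt (p \<theta> x) * r h x\<bar> \<partial>\<mu>) + (h\<^sup>2 / 2 * I + 2 * S)"
      unfolding I_def S_def using cs(1) s2 ri by (simp add: Bochner_Integration.integral_add)
    also have "\<dots> \<le> 2 * sqrt S + (h\<^sup>2 / 2 * I + 2 * S)"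
      using cs(2) sp(2) by (simp add: S_def)
    finally have "(\<integral>x. \<bar>p (\<theta> + h) x - p \<theta> x - h * (s x * p \<theta> x)\<bar> \<partial>\<mu>) / \<bar>h\<bar>
       \<le> (2 * sqrt S + (h\<^sup>2 / 2 * I + 2 * S)) / \<bar>h\<bar>"
      by (rule divide_right_mono) simp
    also have "\<dots> = 2 * sqrt (\<rho> h) + \<bar>h\<bar> / 2 * I + 2 * \<bar>h\<bar> * \<rho> h"
    proof -
      have 1: "sqrt (\<rho> h) = sqrt S / \<bar>h\<bar>"
        unfolding rhoS by (simp add: real_sqrt_divide)
      have h: "h\<^sup>2 = \<bar>h\<bar> * \<bar>h\<bar>" by (simp add: power2_eq_square)
      have 2: "2 * \<bar>h\<bar> * \<rho> h = 2 * S / \<bar>h\<bar>" "h\<^sup>2 / 2 * I / \<bar>h\<bar> = \<bar>h\<bar> / 2 * I"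
      proof -
        have "2 * k * (S / (k * k)) = 2 * S / k" "k * k / 2 * I / k = k / 2 * I" if "k \<noteq> 0" for k :: real
          using that by simp_all
        note k = this
        from elim(1) have "\<bar>h\<bar> \<noteq> 0" by simp
        from k[OF this] show "2 * \<bar>h\<bar> * \<rho> h = 2 * S / \<bar>h\<bar>" "h\<^sup>2 / 2 * I / \<bar>h\<bar> = \<bar>h\<bar> / 2 * I"
          unfolding rhoS h .
      qed
      show ?thesis unfolding 1 2(1) 2(2)[symmetric] by (simp only: add_divide_distrib add.assoc)
    qed
    finally show ?case .
  qed
  show "((\<lambda>h. (\<integral>x. \<bar>p (\<theta> + h) x - p \<theta> x - h * (s x * p \<theta> x)\<bar> \<partial>\<mu>) / \<bar>h\<bar>) \<longlongrightarrow> 0) (at 0)"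
  proof (rule tendsto_sandwich[OF _ bound tendsto_const])
    have "((\<lambda>h. 2 * sqrt (\<rho> h) + \<bar>h\<bar> / 2 * I + 2 * \<bar>h\<bar> * \<rho> h) \<longlongrightarrow> 2 * sqrt 0 + \<bar>0\<bar> / 2 * I + 2 * \<bar>0\<bar> * 0) (at 0)"
      by (intro tendsto_intros rho) auto
    then show "((\<lambda>h. 2 * sqrt (\<rho> h) + \<bar>h\<bar> / 2 * I + 2 * \<bar>h\<bar> * \<rho> h) \<longlongrightarrow> 0) (at 0)" by simp
  qed auto
qed

section \<open>Uniqueness of the score\<close>

text \<open>Cauchy-Schwarz in \<open>L\<^sub>2(P \<theta>)\<close>, applied to the score and an indicator. The set \<open>A\<close> will be the
  complement of the good cells, whose probability enters the quantization error through its
  square root for this reason.\<close>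

lemma DQM_pdot_integrable:
  assumes mod: "dominated_model \<mu> \<Theta> P p" and dqm: "DQM_at \<mu> \<Theta> p \<theta> s" and th: "\<theta> \<in> \<Theta>"
  shows "integrable \<mu> (\<lambda>x. s x * p \<theta> x)"
    and "A \<in> sets \<mu> \<Longrightarrow> (\<integral>x. \<bar>indicator A x * (s x * p \<theta> x)\<bar> \<partial>\<mu>)
           \<le> sqrt (\<integral>x. (s x)\<^sup>2 * p \<theta> x \<partial>\<mu>) * sqrt (measure (P \<theta>) A)"
proof -
  note [measurable] = dominated_modelD(2)[OF mod th]
  have [measurable]: "s \<in> borel_measurable \<mu>" using dqm by (simp add: DQM_at_def)
  interpret P: prob_space "P \<theta>" by (rule dominated_modelD(1)[OF mod th])
  note s2 = DQM_imp_L1_differentiable(1)[OF assms]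
  have s2P: "integrable (P \<theta>) (\<lambda>x. (s x)\<^sup>2)"
    using s2 integral_dominated_model(2)[OF mod th, of "\<lambda>x. (s x)\<^sup>2"] by simp
  have meas: "f \<in> borel_measurable (P \<theta>)" if "f \<in> borel_measurable \<mu>" for f :: "'a \<Rightarrow> real"
    using that by (simp only: measurable_cong_sets[OF dominated_modelD(5)[OF mod th] refl])
  have sP: "s \<in> borel_measurable (P \<theta>)" by (rule meas) simp
  have *: "integrable (P \<theta>) (\<lambda>x. indicator A x * s x)"
     "(\<integral>x. \<bar>indicator A x * s x\<bar> \<partial>P \<theta>) \<le> sqrt (measure (P \<theta>) A) * sqrt (\<integral>x. (s x)\<^sup>2 \<partial>P \<theta>)" 
    if [measurable]: "A \<in> sets \<mu>" for A
  proof -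
    have A: "A \<in> sets (P \<theta>)" using that dominated_modelD(5)[OF mod th] by simp
    have "(\<lambda>x. (indicator A x :: real)\<^sup>2) = indicator A"
      by (auto simp: indicator_def fun_eq_iff)
    note sq = this
    have 1: "integrable (P \<theta>) (\<lambda>x. (indicator A x :: real)\<^sup>2)"
      "(\<integral>x. (indicator A x :: real)\<^sup>2 \<partial>P \<theta>) = measure (P \<theta>) A"
      unfolding sq using A by (auto intro!: integrable_real_indicator simp: less_top[symmetric])
    show "integrable (P \<theta>) (\<lambda>x. indicator A x * s x)"
      "(\<integral>x. \<bar>indicator A x * s x\<bar> \<partial>P \<theta>) \<le> sqrt (measure (P \<theta>) A) * sqrt (\<integral>x. (s x)\<^sup>2 \<partial>P \<theta>)" 
      using Cauchy_Schwarz_integral[OF borel_measurable_indicator[OF A] sP 1(1) s2P] unfolding 1(2) .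
  qed
  have "integrable (P \<theta>) s"
    using *(1)[of "space \<mu>"] dominated_modelD(6)[OF mod th]
    by (subst Bochner_Integration.integrable_cong[OF refl, of _ _ "\<lambda>x. indicator (space \<mu>) x * s x"]) auto
  then show "integrable \<mu> (\<lambda>x. s x * p \<theta> x)"
    using integral_dominated_model(2)[OF mod th, of s] by simp
  assume [measurable]: "A \<in> sets \<mu>"
  have "(\<integral>x. \<bar>indicator A x * (s x * p \<theta> x)\<bar> \<partial>\<mu>) = (\<integral>x. \<bar>indicator A x * s x\<bar> * p \<theta> x \<partial>\<mu>)"
    using dominated_modelD(3)[OF mod th] by (intro Bochner_Integration.integral_cong) (auto simp: abs_mult)
  also have "\<dots> = (\<integral>x. \<bar>indicator A x * s x\<bar> \<partial>P \<theta>)"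
    using integral_dominated_model(1)[OF mod th, of "\<lambda>x. \<bar>indicator A x * s x\<bar>"] by simp
  also have "\<dots> \<le> sqrt (measure (P \<theta>) A) * sqrt (\<integral>x. (s x)\<^sup>2 \<partial>P \<theta>)"
    by (rule *) simp
  also have "(\<integral>x. (s x)\<^sup>2 \<partial>P \<theta>) = (\<integral>x. (s x)\<^sup>2 * p \<theta> x \<partial>\<mu>)"
    using integral_dominated_model(1)[OF mod th, of "\<lambda>x. (s x)\<^sup>2"] by simp
  finally show "(\<integral>x. \<bar>indicator A x * (s x * p \<theta> x)\<bar> \<partial>\<mu>)
           \<le> sqrt (\<integral>x. (s x)\<^sup>2 * p \<theta> x \<partial>\<mu>) * sqrt (measure (P \<theta>) A)"
    by (simp add: mult.commute)
qed

text \<open>The difference quotients refer to the measures only, and their limits determine \<open>s\<close> up to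
  null sets. Hence scores obtained from different dominating measures agree.\<close>

lemma DQM_imp_derivative_expectation:
  assumes mod: "dominated_model \<mu> \<Theta> P p" and dqm: "DQM_at \<mu> \<Theta> p \<theta> s" and th: "\<theta> \<in> \<Theta>"
    and [measurable]: "f \<in> borel_measurable \<mu>" and B: "\<And>x. x \<in> space \<mu> \<Longrightarrow> \<bar>f x\<bar> \<le> B"
  shows "((\<lambda>h. (integral\<^sup>L (P (\<theta> + h)) f - integral\<^sup>L (P \<theta>) f) / h) \<longlongrightarrow> integral\<^sup>L (P \<theta>) (\<lambda>x. f x * s x)) (at 0)"
proof -
  have [measurable]: "s \<in> borel_measurable \<mu>" using dqm by (simp add: DQM_at_def)
  have "\<theta> \<in> interior \<Theta>" using dqm by (simp add: DQM_at_def)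
  then obtain e where e: "e > 0" "ball \<theta> e \<subseteq> \<Theta>"
    by (auto simp: mem_interior)
  have ev_in: "\<forall>\<^sub>F h in at 0. h \<noteq> 0 \<and> \<theta> + h \<in> \<Theta>"
    unfolding eventually_at using e by (intro exI[of _ e]) (auto simp: subset_iff dist_norm)
  let ?E = "\<lambda>h. (\<integral>x. \<bar>p (\<theta> + h) x - p \<theta> x - h * (s x * p \<theta> x)\<bar> \<partial>\<mu>) / \<bar>h\<bar>"
  have lim: "((\<lambda>h. B * ?E h) \<longlongrightarrow> 0) (at 0)"
    using tendsto_mult_left[OF DQM_imp_L1_differentiable(2)[OF mod dqm th], of B] by simp
  have "\<forall>\<^sub>F h in at 0. norm ((integral\<^sup>L (P (\<theta> + h)) f - integral\<^sup>L (P \<theta>) f) / h - integral\<^sup>L (P \<theta>) (\<lambda>x. f x * s x)) \<le> B * ?E h"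
    using ev_in
  proof eventually_elim
    case (elim h)
    note [measurable] = dominated_modelD(2)[OF mod]
    have ip: "integrable \<mu> (p \<theta>)" "integrable \<mu> (p (\<theta> + h))" "integrable \<mu> (\<lambda>x. s x * p \<theta> x)"
      using dominated_modelD(7)[OF mod] DQM_pdot_integrable(1)[OF mod dqm th] th elim by auto
    note ib = integrable_mult_bounded[OF _ _ B]
    have "integral\<^sup>L (P (\<theta> + h)) f - integral\<^sup>L (P \<theta>) f - h * integral\<^sup>L (P \<theta>) (\<lambda>x. f x * s x)
      = (\<integral>x. f x * p (\<theta> + h) x \<partial>\<mu>) - (\<integral>x. f x * p \<theta> x \<partial>\<mu>) - h * (\<integral>x. f x * (s x * p \<theta> x) \<partial>\<mu>)"
      using elim th by (simp add: integral_dominated_model(1)[OF mod] mult.assoc)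
    also have "\<dots> = (\<integral>x. f x * p (\<theta> + h) x - f x * p \<theta> x - h * (f x * (s x * p \<theta> x)) \<partial>\<mu>)"
      using ib[OF ip(1)] ib[OF ip(2)] ib[OF ip(3)] by (simp add: Bochner_Integration.integral_diff)
    also have "\<dots> = (\<integral>x. f x * (p (\<theta> + h) x - p \<theta> x - h * (s x * p \<theta> x)) \<partial>\<mu>)"
      by (simp add: algebra_simps)
    also have "\<bar>\<dots>\<bar> \<le> B * (\<integral>x. \<bar>p (\<theta> + h) x - p \<theta> x - h * (s x * p \<theta> x)\<bar> \<partial>\<mu>)"
      using ip B by (intro abs_integral_mult_le) auto
    finally have *: "\<bar>integral\<^sup>L (P (\<theta> + h)) f - integral\<^sup>L (P \<theta>) f - h * integral\<^sup>L (P \<theta>) (\<lambda>x. f x * s x)\<bar>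
      \<le> B * (\<integral>x. \<bar>p (\<theta> + h) x - p \<theta> x - h * (s x * p \<theta> x)\<bar> \<partial>\<mu>)" .
    have "norm ((integral\<^sup>L (P (\<theta> + h)) f - integral\<^sup>L (P \<theta>) f) / h - integral\<^sup>L (P \<theta>) (\<lambda>x. f x * s x))
      = \<bar>integral\<^sup>L (P (\<theta> + h)) f - integral\<^sup>L (P \<theta>) f - h * integral\<^sup>L (P \<theta>) (\<lambda>x. f x * s x)\<bar> / \<bar>h\<bar>"
    proof -
      have "a / h - b = (a - h * b) / h" for a b using elim by (simp add: field_simps)
      then show ?thesis by (simp only: real_norm_def abs_divide)
    qed
    also have "\<dots> \<le> B * (\<integral>x. \<bar>p (\<theta> + h) x - p \<theta> x - h * (s x * p \<theta> x)\<bar> \<partial>\<mu>) / \<bar>h\<bar>"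
      by (rule divide_right_mono[OF *]) simp
    finally show ?case by simp
  qed
  then have "((\<lambda>h. (integral\<^sup>L (P (\<theta> + h)) f - integral\<^sup>L (P \<theta>) f) / h - integral\<^sup>L (P \<theta>) (\<lambda>x. f x * s x)) \<longlongrightarrow> 0) (at 0)"
    by (intro Lim_null_comparison[OF _ lim])
  then show ?thesis by (rule LIM_zero_cancel)
qed

lemma score_unique:
  assumes "is_score \<Theta> P \<theta> s" "is_score \<Theta> P \<theta> s'" "\<theta> \<in> \<Theta>"
  shows "AE x in P \<theta>. s x = s' x"
proof -
  obtain \<mu> p where 1: "dominated_model \<mu> \<Theta> P p" "DQM_at \<mu> \<Theta> p \<theta> s"
    using assms(1) by (auto simp: is_score_def)
  obtain \<mu>' p' where 2: "dominated_model \<mu>' \<Theta> P p'" "DQM_at \<mu>' \<Theta> p' \<theta> s'"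
    using assms(2) by (auto simp: is_score_def)
  have sets: "sets (P \<theta>) = sets \<mu>" "sets (P \<theta>) = sets \<mu>'" 
    using dominated_modelD(5) 1 2 assms(3) by blast+
  have meas: "s \<in> borel_measurable \<mu>" "s' \<in> borel_measurable \<mu>'"
    using 1(2) 2(2) by (simp_all add: DQM_at_def)
  have int: "integrable (P \<theta>) s" "integrable (P \<theta>) s'"
    unfolding integral_dominated_model(2)[OF 1(1) assms(3) meas(1)]
      integral_dominated_model(2)[OF 2(1) assms(3) meas(2)]
    by (rule DQM_pdot_integrable(1)[OF 1 assms(3)] DQM_pdot_integrable(1)[OF 2 assms(3)])+
  show ?thesis
  proof (rule density_unique_real[OF int])
    fix A assume "A \<in> sets (P \<theta>)"
    then have A: "indicator A \<in> borel_measurable \<mu>" "indicator A \<in> borel_measurable \<mu>'"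
      using sets by (auto intro: borel_measurable_indicator)
    have "integral\<^sup>L (P \<theta>) (\<lambda>x. indicator A x * s x) = integral\<^sup>L (P \<theta>) (\<lambda>x. indicator A x * s' x)"
      by (rule tendsto_unique[OF at_neq_bot DQM_imp_derivative_expectation[OF 1 assms(3) A(1), of 1] 
         DQM_imp_derivative_expectation[OF 2 assms(3) A(2), of 1]])
        (auto simp: indicator_def)
    then show "(\<integral>x\<in>A. s x \<partial>P \<theta>) = (\<integral>x\<in>A. s' x \<partial>P \<theta>)"
      by (simp add: set_lebesgue_integral_def)
  qed
qed

lemma fisher_information_eq:
  assumes "is_score \<Theta> P \<theta> s" "\<theta> \<in> \<Theta>"
  shows "fisher_information \<Theta> P \<theta> = (\<integral>x. (s x)\<^sup>2 \<partial>(P \<theta>))"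
proof -
  define t where "t = (SOME s. is_score \<Theta> P \<theta> s)"
  have t: "is_score \<Theta> P \<theta> t" unfolding t_def by (rule someI[of "is_score \<Theta> P \<theta>", OF assms(1)])
  have [measurable]: "v \<in> borel_measurable (P \<theta>)" if "is_score \<Theta> P \<theta> v" for v
  proof -
    from that obtain \<mu> p where "dominated_model \<mu> \<Theta> P p" "v \<in> borel_measurable \<mu>"
      by (auto simp: is_score_def DQM_at_def)
    then show ?thesis
      using measurable_cong_sets[OF dominated_modelD(5)[OF _ assms(2)] refl] by blast
  qed
  show ?thesis
    unfolding fisher_information_def t_def[symmetric]
    using t assms(1) score_unique[OF t assms] by (intro integral_cong_AE) auto
qed

lemma fisher_information_DQM:
  assumes mod: "dominated_model \<mu> \<Theta> P p" and dqm: "DQM_at \<mu> \<Theta> p \<theta> s" and th: "\<theta> \<in> \<Theta>"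
  shows "fisher_information \<Theta> P \<theta> = (\<integral>x. (s x)\<^sup>2 * p \<theta> x \<partial>\<mu>)"
proof -
  have "s \<in> borel_measurable \<mu>" using dqm by (simp add: DQM_at_def)
  then show ?thesis
    using fisher_information_eq[of \<Theta> P \<theta> s] integral_dominated_model(1)[OF mod th, of "\<lambda>x. (s x)\<^sup>2"] assms
    by (auto simp: is_score_def)
qed

lemma L1_norm_pdot_le:
  assumes mod: "dominated_model \<mu> \<Theta> P p" and dqm: "DQM_at \<mu> \<Theta> p \<theta> s" and th: "\<theta> \<in> \<Theta>"
  shows "L1_norm \<mu> (\<lambda>x. s x * p \<theta> x) \<le> sqrt (fisher_information \<Theta> P \<theta>)"
proof -
  interpret P: prob_space "P \<theta>" by (rule dominated_modelD(1)[OF mod th])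
  have "L1_norm \<mu> (\<lambda>x. s x * p \<theta> x) = (\<integral>x. \<bar>indicator (space \<mu>) x * (s x * p \<theta> x)\<bar> \<partial>\<mu>)"
    unfolding L1_norm_def by (intro Bochner_Integration.integral_cong) auto
  also have "\<dots> \<le> sqrt (fisher_information \<Theta> P \<theta>) * sqrt (measure (P \<theta>) (space \<mu>))"
    unfolding fisher_information_DQM[OF assms] by (intro DQM_pdot_integrable[OF assms]) auto
  also have "measure (P \<theta>) (space \<mu>) = 1"
    using P.prob_space dominated_modelD(6)[OF mod th] by simp
  finally show ?thesis by simp
qed

section \<open>The score of a privatized model\<close>

lemma private_channelsD:
  assumes "Q \<in> private_channels \<alpha> M N"
  shows "Q \<in> M \<rightarrow>\<^sub>M prob_algebra N" "Q \<in> M \<rightarrow>\<^sub>M subprob_algebra N"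
    "\<And>x. x \<in> space M \<Longrightarrow> prob_space (Q x)" "\<And>x. x \<in> space M \<Longrightarrow> sets (Q x) = sets N"
    "\<And>x. x \<in> space M \<Longrightarrow> space (Q x) = space N"
    "\<And>A x x'. A \<in> sets N \<Longrightarrow> x \<in> space M \<Longrightarrow> x' \<in> space M \<Longrightarrow> measure (Q x) A \<le> exp \<alpha> * measure (Q x') A"
proof -
  show 1: "Q \<in> M \<rightarrow>\<^sub>M prob_algebra N"
    "\<And>A x x'. A \<in> sets N \<Longrightarrow> x \<in> space M \<Longrightarrow> x' \<in> space M \<Longrightarrow> measure (Q x) A \<le> exp \<alpha> * measure (Q x') A"
    using assms by (auto simp: private_channels_def)
  then show "Q \<in> M \<rightarrow>\<^sub>M subprob_algebra N" by (intro measurable_prob_algebraD)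
  show "prob_space (Q x)" and 2: "sets (Q x) = sets N" if "x \<in> space M" for x
    using measurable_space[OF 1(1) that] by (auto simp: space_prob_algebra)
  show "space (Q x) = space N" if "x \<in> space M" for x
    using 2[OF that] by (rule sets_eq_imp_space_eq)
qed

lemma prob_space_bind_kernel:
  assumes "Q \<in> M \<rightarrow>\<^sub>M prob_algebra N" "prob_space \<kappa>" "sets \<kappa> = sets M"
  shows "prob_space (\<kappa> \<bind> Q)" "sets (\<kappa> \<bind> Q) = sets N"
    "A \<in> sets N \<Longrightarrow> measure (\<kappa> \<bind> Q) A = (\<integral>x. measure (Q x) A \<partial>\<kappa>)"
proof -
  have Q: "Q \<in> \<kappa> \<rightarrow>\<^sub>M prob_algebra N" using assms(1,3) measurable_cong_sets by blast
  then have Q': "Q \<in> \<kappa> \<rightarrow>\<^sub>M subprob_algebra N" by (rule measurable_prob_algebraD)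
  interpret prob_space \<kappa> by fact
  show "prob_space (\<kappa> \<bind> Q)"
    using measurable_space[OF Q] by (intro prob_space_bind[OF _ Q'] AE_I2) (auto simp: space_prob_algebra)
  show "sets (\<kappa> \<bind> Q) = sets N"
    using subprob_measurableD(2)[OF Q'] not_empty by (intro sets_bind) auto
  show "A \<in> sets N \<Longrightarrow> measure (\<kappa> \<bind> Q) A = (\<integral>x. measure (Q x) A \<partial>\<kappa>)"
    by (rule measure_bind[OF Q'])
qed

definition bounded_measurable :: "'a measure \<Rightarrow> ('a \<Rightarrow> real) set" where
  "bounded_measurable N = {u \<in> borel_measurable N. \<exists>B. \<forall>z\<in>space N. \<bar>u z\<bar> \<le> B}"

lemma bounded_measurableI:
  assumes "u \<in> borel_measurable N" "\<And>z. z \<in> space N \<Longrightarrow> \<bar>u z\<bar> \<le> B"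
  shows "u \<in> bounded_measurable N"
  using assms by (auto simp: bounded_measurable_def)

lemma kernel_integral_bounded:
  fixes u :: "'b \<Rightarrow> real"
  assumes Q: "Q \<in> M \<rightarrow>\<^sub>M prob_algebra N" and u: "u \<in> borel_measurable N"
    and B: "\<And>z. z \<in> space N \<Longrightarrow> \<bar>u z\<bar> \<le> B"
  shows "(\<lambda>x. \<integral>z. u z \<partial>Q x) \<in> borel_measurable M"
    and "x \<in> space M \<Longrightarrow> integrable (Q x) u"
    and "x \<in> space M \<Longrightarrow> \<bar>\<integral>z. u z \<partial>Q x\<bar> \<le> B"
proof -
  have Q': "Q \<in> M \<rightarrow>\<^sub>M subprob_algebra N" using Q by (rule measurable_prob_algebraD)
  show "(\<lambda>x. \<integral>z. u z \<partial>Q x) \<in> borel_measurable M"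
    by (rule measurable_compose[OF Q' integral_measurable_subprob_algebra[OF u]])
  assume x: "x \<in> space M"
  then interpret prob_space "Q x"
    using measurable_space[OF Q x] by (auto simp: space_prob_algebra)
  have sets: "sets (Q x) = sets N" using subprob_measurableD(2)[OF Q' x] .
  then have sp: "space (Q x) = space N" by (rule sets_eq_imp_space_eq)
  have u': "u \<in> borel_measurable (Q x)" using u measurable_cong_sets[OF sets refl] by blast
  show int: "integrable (Q x) u"
    using B sp u' by (intro integrable_const_bound[of _ B]) auto
  have "\<bar>\<integral>z. u z \<partial>Q x\<bar> \<le> (\<integral>z. \<bar>u z\<bar> \<partial>Q x)"
    using integral_norm_bound[of "Q x" u] by simp
  also have "\<dots> \<le> B"
    using int B sp by (intro integral_le_const) auto
  finally show "\<bar>\<integral>z. u z \<partial>Q x\<bar> \<le> B" .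
qed

text \<open>Both sides average rows of the channel, and any two rows satisfy the inequality.\<close>

lemma private_bind_le:
  assumes Q: "Q \<in> private_channels \<alpha> M N" and A: "A \<in> sets N"
    and \<kappa>: "prob_space \<kappa>" "sets \<kappa> = sets M" and \<kappa>': "prob_space \<kappa>'" "sets \<kappa>' = sets M"
  shows "measure (\<kappa> \<bind> Q) A \<le> exp \<alpha> * measure (\<kappa>' \<bind> Q) A"
proof -
  note QD = private_channelsD[OF Q]
  interpret k: prob_space \<kappa> by fact
  interpret k': prob_space \<kappa>' by fact
  have sp: "space \<kappa> = space M" "space \<kappa>' = space M" using \<kappa>(2) \<kappa>'(2) by (auto dest: sets_eq_imp_space_eq)
  have meas: "(\<lambda>x. measure (Q x) A) \<in> borel_measurable M"
    by (rule measurable_compose[OF QD(2) measurable_measure_subprob_algebra[OF A]])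
  have le1: "measure (Q x) A \<le> 1" if "x \<in> space M" for x
    using QD(3)[OF that] by (rule prob_space.prob_le_1)
  have meas': "(\<lambda>x. measure (Q x) A) \<in> borel_measurable \<kappa>" "(\<lambda>x. measure (Q x) A) \<in> borel_measurable \<kappa>'"
    using meas measurable_cong_sets[OF \<kappa>(2) refl] measurable_cong_sets[OF \<kappa>'(2) refl] by blast+
  have int: "integrable \<kappa> (\<lambda>x. measure (Q x) A)" "integrable \<kappa>' (\<lambda>x. measure (Q x) A)"
    using le1 sp meas'
    by (auto intro!: k.integrable_const_bound[of _ 1] k'.integrable_const_bound[of _ 1])
  have 1: "measure (Q x) A \<le> exp \<alpha> * measure (\<kappa>' \<bind> Q) A" if x: "x \<in> space M" for x
  proof -
    have "measure (Q x) A \<le> (\<integral>x'. exp \<alpha> * measure (Q x') A \<partial>\<kappa>')"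
      using int(2) QD(6)[OF A x] sp by (intro k'.integral_ge_const) auto
    then show ?thesis
      using prob_space_bind_kernel(3)[OF QD(1) \<kappa>' A] by simp
  qed
  show ?thesis
    unfolding prob_space_bind_kernel(3)[OF QD(1) \<kappa> A]
    using int(1) 1 sp by (intro k.integral_le_const) auto
qed

lemma private_le_bind:
  assumes Q: "Q \<in> private_channels \<alpha> M N" and A: "A \<in> sets N"
    and \<kappa>: "prob_space \<kappa>" "sets \<kappa> = sets M" and x: "x \<in> space M"
  shows "measure (Q x) A \<le> exp \<alpha> * measure (\<kappa> \<bind> Q) A"
  using private_bind_le[OF Q A prob_space_return[OF x] _ \<kappa>] bind_return[OF private_channelsD(2)[OF Q] x] by simp

lemma (in finite_measure) AE_abs_le_if_set_integrals:
  fixes v :: "'a \<Rightarrow> real"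
  assumes v: "integrable M v"
    and le: "\<And>A. A \<in> sets M \<Longrightarrow> \<bar>\<integral>x. indicator A x * v x \<partial>M\<bar> \<le> c * measure M A"
  shows "AE x in M. \<bar>v x\<bar> \<le> c"
proof -
  have "AE x in M. v x \<in> {-c..c}"
  proof (rule averaging_theorem[OF v])
    fix A assume A: "A \<in> sets M" "0 < measure M A"
    let ?X = "(1 / measure M A) *\<^sub>R set_lebesgue_integral M A v"
    have "\<bar>?X\<bar> = \<bar>\<integral>x. indicator A x * v x \<partial>M\<bar> / measure M A"
      using A(2) by (simp add: set_lebesgue_integral_def abs_mult)
    also have "\<dots> \<le> c" using le[OF A(1)] A(2) by (simp add: field_simps)
    finally have "\<bar>?X\<bar> \<le> c" .
    then show "?X \<in> {-c..c}" unfolding atLeastAtMost_iff by linarith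
  qed simp
  then show ?thesis by eventually_elim auto
qed

text \<open>Every output distribution \<open>\<kappa> \<bind> Q\<close> of a private channel dominates all rows \<open>Q x\<close>, and with them
  every mixture of rows. Radon-Nikodym is applied to the mixture: on a general output space, the
  kernel itself need not have a jointly measurable density.\<close>

lemma nonneg_push_forward_density:
  fixes w :: "'a \<Rightarrow> real"
  assumes Q: "Q \<in> private_channels \<alpha> M N" and \<kappa>: "prob_space \<kappa>" "sets \<kappa> = sets M"
    and w: "integrable M w" and w0: "\<And>x. x \<in> space M \<Longrightarrow> 0 \<le> w x"
  obtains D where "D \<in> borel_measurable N" "\<And>z. 0 \<le> D z" "integrable (\<kappa> \<bind> Q) D"
    "density M (\<lambda>x. ennreal (w x)) \<bind> Q = density (\<kappa> \<bind> Q) (\<lambda>z. ennreal (D z))"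
    "\<forall>u\<in>bounded_measurable N.
       (\<integral>z. u z * D z \<partial>(\<kappa> \<bind> Q)) = (\<integral>x. (\<integral>z. u z \<partial>Q x) * w x \<partial>M)"
proof -
  note QD = private_channelsD[OF Q]
  let ?\<nu> = "\<kappa> \<bind> Q" and ?M = "density M (\<lambda>x. ennreal (w x))"
  define F where "F = ?M \<bind> Q"
  interpret \<nu>: prob_space ?\<nu> by (rule prob_space_bind_kernel(1)[OF QD(1) \<kappa>])
  note sets_\<nu> = prob_space_bind_kernel(2)[OF QD(1) \<kappa>]
  have [measurable]: "w \<in> borel_measurable M" using w by auto
  have space_ne: "space M \<noteq> {}"
    using prob_space.not_empty[OF \<kappa>(1)] \<kappa>(2) by (simp add: sets_eq_imp_space_eq[OF \<kappa>(2)])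
  have QM: "Q \<in> ?M \<rightarrow>\<^sub>M subprob_algebra N" using QD(2) by simp
  have sets_F: "sets F = sets N"
    unfolding F_def using QD(4) space_ne by (intro sets_bind) auto
  have finM: "finite_measure ?M"
  proof (rule finite_measureI)
    have "emeasure ?M (space ?M) = (\<integral>\<^sup>+x. ennreal (w x) \<partial>M)"
      by (auto simp: emeasure_density intro!: nn_integral_cong)
    also have "\<dots> = ennreal (\<integral>x. w x \<partial>M)" using w w0 by (intro nn_integral_eq_integral) auto
    finally show "emeasure ?M (space ?M) \<noteq> \<infinity>" by simp
  qed
  have intF: "integral\<^sup>L F u = (\<integral>x. (\<integral>z. u z \<partial>Q x) * w x \<partial>M)" "integrable F u"
    if u: "u \<in> borel_measurable N" and B: "\<And>z. z \<in> space N \<Longrightarrow> \<bar>u z\<bar> \<le> B" for u B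
  proof -
    have AE1: "AE x in ?M. emeasure (Q x) (space (Q x)) \<le> ennreal 1"
      using prob_space.emeasure_space_1[OF QD(3)] by (intro AE_I2) simp
    show "integrable F u"
      unfolding F_def by (rule integrable_bind[OF u B QM finM AE1])
    have "integral\<^sup>L F u = (\<integral>x. (\<integral>z. u z \<partial>Q x) \<partial>?M)"
      unfolding F_def by (rule integral_bind[OF u B QM finM AE1])
    also have "\<dots> = (\<integral>x. w x * (\<integral>z. u z \<partial>Q x) \<partial>M)"
      using kernel_integral_bounded(1)[OF QD(1) u B] w0 by (intro integral_real_density) auto
    finally show "integral\<^sup>L F u = (\<integral>x. (\<integral>z. u z \<partial>Q x) * w x \<partial>M)"
      by (simp add: mult.commute)
  qed
  have finF: "finite_measure F"
  proof (rule finite_measureI)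
    have "emeasure F (space F) = emeasure (?M \<bind> Q) (space N)"
      using sets_eq_imp_space_eq[OF sets_F] by (simp add: F_def)
    also have "\<dots> = (\<integral>\<^sup>+x. emeasure (Q x) (space N) \<partial>?M)"
      using space_ne by (intro emeasure_bind[OF _ QM]) auto
    also have "\<dots> = (\<integral>\<^sup>+x. 1 \<partial>?M)"
      using prob_space.emeasure_space_1[OF QD(3)] QD(5) by (intro nn_integral_cong) auto
    also have "\<dots> = emeasure ?M (space ?M)" by simp
    finally show "emeasure F (space F) \<noteq> \<infinity>"
      using finite_measure.emeasure_finite[OF finM, of "space ?M"] by simp
  qed
  have ac: "absolutely_continuous ?\<nu> F"
  proof (unfold absolutely_continuous_def, safe)
    fix A assume "A \<in> null_sets ?\<nu>"
    then have A: "A \<in> sets N" "measure ?\<nu> A = 0" using sets_\<nu> by (auto simp: null_sets_def measure_def)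
    have "measure (Q x) A = 0" if "x \<in> space M" for x
      using private_le_bind[OF Q A(1) \<kappa> that] A(2) measure_nonneg[of "Q x" A] by simp
    then have "emeasure (Q x) A = 0" if "x \<in> space M" for x
      using that finite_measure.emeasure_eq_measure[OF prob_space.finite_measure[OF QD(3)[OF that]]] by simp
    then have "(\<integral>\<^sup>+x. emeasure (Q x) A \<partial>?M) = (\<integral>\<^sup>+x. 0 \<partial>?M)"
      by (intro nn_integral_cong) auto
    then have "emeasure F A = 0"
      unfolding F_def using emeasure_bind[OF _ QM A(1)] space_ne by simp
    then show "A \<in> null_sets F" using A(1) sets_F by (auto simp: null_sets_def)
  qed
  have setsF\<nu>: "sets F = sets ?\<nu>" using sets_F sets_\<nu> by simp
  obtain D where D: "D \<in> borel_measurable ?\<nu>" "AE x in ?\<nu>. RN_deriv ?\<nu> F x = ennreal (D x)" "\<And>x. 0 \<le> D x"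
    by (rule \<nu>.real_RN_deriv[OF finF ac setsF\<nu>]) blast
  have dens: "F = density ?\<nu> (\<lambda>z. ennreal (D z))"
  proof -
    have "density ?\<nu> (RN_deriv ?\<nu> F) = density ?\<nu> (\<lambda>z. ennreal (D z))"
      using D by (intro density_cong) auto
    then show ?thesis by (simp only: \<nu>.density_RN_deriv[OF ac setsF\<nu>])
  qed
  have DN: "D \<in> borel_measurable N" using D(1) measurable_cong_sets[OF sets_\<nu> refl] by blast
  show ?thesis
  proof (rule that[OF DN D(3) _ dens[unfolded F_def]])
    have "integrable F (\<lambda>_. 1::real)" using intF(2)[of "\<lambda>_. 1" 1] by simp
    then show "integrable ?\<nu> D"
      unfolding dens using D by (subst (asm) integrable_real_density) auto
  next
    show "\<forall>u\<in>bounded_measurable N. (\<integral>z. u z * D z \<partial>?\<nu>) = (\<integral>x. (\<integral>z. u z \<partial>Q x) * w x \<partial>M)"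
    proof
    fix u assume "u \<in> bounded_measurable N"
    then obtain B where u: "u \<in> borel_measurable N" and B: "\<And>z. z \<in> space N \<Longrightarrow> \<bar>u z\<bar> \<le> B"
      by (auto simp: bounded_measurable_def)
    have u': "u \<in> borel_measurable ?\<nu>" using u measurable_cong_sets[OF sets_\<nu> refl] by blast
    have "(\<integral>z. u z * D z \<partial>?\<nu>) = integral\<^sup>L F u"
      unfolding dens using D u' by (subst integral_real_density) (auto simp: mult.commute)
    then show "(\<integral>z. u z * D z \<partial>?\<nu>) = (\<integral>x. (\<integral>z. u z \<partial>Q x) * w x \<partial>M)"
      using intF(1)[OF u B] by simp
    qed
  qed
qed

text \<open>A private channel pushes a finite signed measure \<open>w d\<mu>\<close> to one with a bounded density with
  respect to any output distribution \<open>\<kappa> \<bind> Q\<close>, because all rows of \<open>Q\<close> are dominated by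
  \<open>e\<^sup>\<alpha> (\<kappa> \<bind> Q)\<close>.\<close>

lemma push_forward_density:
  fixes w :: "'a \<Rightarrow> real"
  assumes Q: "Q \<in> private_channels \<alpha> M N" and \<kappa>: "prob_space \<kappa>" "sets \<kappa> = sets M"
    and w: "integrable M w"
  obtains g where "g \<in> borel_measurable N" "\<And>z. \<bar>g z\<bar> \<le> exp \<alpha> * L1_norm M w"
    "\<forall>u\<in>bounded_measurable N.
       (\<integral>z. u z * g z \<partial>(\<kappa> \<bind> Q)) = (\<integral>x. (\<integral>z. u z \<partial>Q x) * w x \<partial>M)"
proof -
  note QD = private_channelsD[OF Q]
  let ?\<nu> = "\<kappa> \<bind> Q"
  interpret \<nu>: prob_space ?\<nu> by (rule prob_space_bind_kernel(1)[OF QD(1) \<kappa>])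
  note sets_\<nu> = prob_space_bind_kernel(2)[OF QD(1) \<kappa>]
  note meas_\<nu> = measurable_cong_sets[OF sets_\<nu> refl]
  have ip: "integrable M (\<lambda>x. max 0 (w x))" and im: "integrable M (\<lambda>x. max 0 (- w x))"
    using w by auto
  obtain D1 where D1: "D1 \<in> borel_measurable N" "integrable ?\<nu> D1"
    "\<forall>u\<in>bounded_measurable N.
       (\<integral>z. u z * D1 z \<partial>?\<nu>) = (\<integral>x. (\<integral>z. u z \<partial>Q x) * max 0 (w x) \<partial>M)"
    by (rule nonneg_push_forward_density[OF Q \<kappa> ip max.cobounded1], rule that)
  obtain D2 where D2: "D2 \<in> borel_measurable N" "integrable ?\<nu> D2"
    "\<forall>u\<in>bounded_measurable N.
       (\<integral>z. u z * D2 z \<partial>?\<nu>) = (\<integral>x. (\<integral>z. u z \<partial>Q x) * max 0 (- w x) \<partial>M)"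
    by (rule nonneg_push_forward_density[OF Q \<kappa> im max.cobounded1], rule that)
  define g where "g z = D1 z - D2 z" for z
  define c where "c = exp \<alpha> * L1_norm M w"
  have gm: "g \<in> borel_measurable N" unfolding g_def using D1(1) D2(1) by measurable
  have gi: "integrable ?\<nu> g" unfolding g_def using D1(2) D2(2) by simp
  have eq: "(\<integral>z. u z * g z \<partial>?\<nu>) = (\<integral>x. (\<integral>z. u z \<partial>Q x) * w x \<partial>M)"
    if u: "u \<in> borel_measurable N" and B: "\<And>z. z \<in> space N \<Longrightarrow> \<bar>u z\<bar> \<le> B" for u B
  proof -
    note k = kernel_integral_bounded[OF QD(1) u B]
    have u': "u \<in> borel_measurable ?\<nu>" using u meas_\<nu> by blast
    have B': "\<And>z. z \<in> space ?\<nu> \<Longrightarrow> \<bar>u z\<bar> \<le> B" using B sets_eq_imp_space_eq[OF sets_\<nu>] by simp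
    have "(\<integral>z. u z * g z \<partial>?\<nu>) = (\<integral>z. u z * D1 z \<partial>?\<nu>) - (\<integral>z. u z * D2 z \<partial>?\<nu>)"
      unfolding g_def right_diff_distrib
      by (rule Bochner_Integration.integral_diff[OF integrable_mult_bounded[OF D1(2) u' B'] integrable_mult_bounded[OF D2(2) u' B']])
    also have "\<dots> = (\<integral>x. (\<integral>z. u z \<partial>Q x) * max 0 (w x) \<partial>M) - (\<integral>x. (\<integral>z. u z \<partial>Q x) * max 0 (- w x) \<partial>M)"
      using bspec[OF D1(3) bounded_measurableI[OF u B]] bspec[OF D2(3) bounded_measurableI[OF u B]] by simp
    also have "\<dots> = (\<integral>x. (\<integral>z. u z \<partial>Q x) * max 0 (w x) - (\<integral>z. u z \<partial>Q x) * max 0 (- w x) \<partial>M)"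
      by (rule Bochner_Integration.integral_diff[symmetric, OF integrable_mult_bounded[OF ip k(1,3)] integrable_mult_bounded[OF im k(1,3)]])
    also have "\<dots> = (\<integral>x. (\<integral>z. u z \<partial>Q x) * w x \<partial>M)"
      by (intro Bochner_Integration.integral_cong) (auto simp: max_def)
    finally show ?thesis .
  qed
  have "AE z in ?\<nu>. \<bar>g z\<bar> \<le> c"
  proof (rule \<nu>.AE_abs_le_if_set_integrals[OF gi])
    fix A assume "A \<in> sets ?\<nu>"
    then have A: "A \<in> sets N" using sets_\<nu> by simp
    have "(\<integral>z. indicator A z * g z \<partial>?\<nu>) = (\<integral>x. (\<integral>z. indicator A z \<partial>Q x) * w x \<partial>M)"
      using A by (intro eq[of _ 1]) (auto simp: indicator_def)
    also have "\<dots> = (\<integral>x. measure (Q x) A * w x \<partial>M)"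
      using QD(4,5) A by (intro Bochner_Integration.integral_cong) auto
    also have "\<bar>\<dots>\<bar> \<le> (exp \<alpha> * measure ?\<nu> A) * (\<integral>x. \<bar>w x\<bar> \<partial>M)"
      using private_le_bind[OF Q A \<kappa>] measurable_compose[OF QD(2) measurable_measure_subprob_algebra[OF A]]
      by (intro abs_integral_mult_le[OF w]) auto
    finally show "\<bar>\<integral>z. indicator A z * g z \<partial>?\<nu>\<bar> \<le> c * measure ?\<nu> A"
      by (simp add: c_def L1_norm_def mult_ac)
  qed
  then have AE: "AE z in ?\<nu>. max (- c) (min c (g z)) = g z"
    by eventually_elim (auto simp: max_def min_def)
  have c0: "0 \<le> c" unfolding c_def L1_norm_def by simp
  show ?thesis
  proof (rule that[of "\<lambda>z. max (- c) (min c (g z))"])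
    show "(\<lambda>z. max (- c) (min c (g z))) \<in> borel_measurable N" using gm by measurable
    show "\<bar>max (- c) (min c (g z))\<bar> \<le> exp \<alpha> * L1_norm M w" for z
      using c0 unfolding c_def[symmetric] by (auto simp: max_def min_def)
  next
    show "\<forall>u\<in>bounded_measurable N. (\<integral>z. u z * max (- c) (min c (g z)) \<partial>?\<nu>) = (\<integral>x. (\<integral>z. u z \<partial>Q x) * w x \<partial>M)"
    proof
    fix u assume "u \<in> bounded_measurable N"
    then obtain B where u: "u \<in> borel_measurable N" and B: "\<And>z. z \<in> space N \<Longrightarrow> \<bar>u z\<bar> \<le> B"
      by (auto simp: bounded_measurable_def)
    have [measurable]: "u \<in> borel_measurable ?\<nu>" "g \<in> borel_measurable ?\<nu>" using u gm meas_\<nu> by blast+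
    have "(\<integral>z. u z * max (- c) (min c (g z)) \<partial>?\<nu>) = (\<integral>z. u z * g z \<partial>?\<nu>)"
      using AE by (intro integral_cong_AE) auto
    then show "(\<integral>z. u z * max (- c) (min c (g z)) \<partial>?\<nu>) = (\<integral>x. (\<integral>z. u z \<partial>Q x) * w x \<partial>M)"
      using eq[OF u B] by simp
    qed
  qed
qed

text \<open>This uses \<open>\<surd>f - 1 = (f - 1) / 2 - (\<surd>f - 1)\<^sup>2 / 2\<close> and \<open>\<bar>\<surd>f - 1\<bar> \<le> \<bar>f - 1\<bar>\<close>.\<close>

lemma sqrt_linearization:
  fixes f g h \<delta> G :: real
  assumes "0 \<le> f" "\<bar>f - 1 - h * g\<bar> \<le> \<delta>" "\<bar>g\<bar> \<le> G"
  shows "\<bar>sqrt f - 1 - 1/2 * h * g\<bar> \<le> (\<delta> + (\<bar>h\<bar> * G + \<delta>)\<^sup>2) / 2"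
proof -
  define t where "t = sqrt f - 1"
  have f: "f - 1 = 2 * t + t\<^sup>2"
    using assms(1) by (simp add: t_def power2_eq_square algebra_simps)
  have "\<bar>t\<bar> \<le> \<bar>t\<bar> * (t + 2)"
    using assms(1) mult_left_mono[of 1 "t + 2" "\<bar>t\<bar>"] by (simp add: t_def)
  also have "\<dots> = \<bar>f - 1\<bar>"
  proof -
    have "0 \<le> t + 2" using assms(1) by (simp add: t_def add_nonneg_nonneg)
    moreover have "f - 1 = t * (t + 2)" unfolding f by (simp add: power2_eq_square algebra_simps)
    ultimately show ?thesis by (simp add: abs_mult)
  qed
  also have "\<bar>f - 1\<bar> \<le> \<bar>h\<bar> * G + \<delta>"
  proof -
    have "\<bar>h * g\<bar> \<le> \<bar>h\<bar> * G" using assms(3) by (simp add: abs_mult mult_left_mono)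
    then show ?thesis using assms(2) by linarith
  qed
  finally have "t\<^sup>2 \<le> (\<bar>h\<bar> * G + \<delta>)\<^sup>2"
    by (metis abs_ge_zero power2_abs power_mono)
  moreover have "\<bar>X / 2 - T / 2\<bar> \<le> (\<delta> + S) / 2" if "\<bar>X\<bar> \<le> \<delta>" "T \<le> S" "0 \<le> T" for X T S
    using that abs_triangle_ineq4[of "X / 2" "T / 2"] by simp
  moreover have "sqrt f - 1 - 1/2 * h * g = (f - 1 - h * g) / 2 - t\<^sup>2 / 2"
    unfolding f by (simp add: t_def diff_divide_distrib add_divide_distrib)
  ultimately show ?thesis using assms(2) by simp
qed

text \<open>With \<open>P \<theta> \<bind> Q\<close> as dominating measure the density at \<open>\<theta>\<close> is \<open>1\<close>, and the
  \<open>L\<^sub>1\<close>-expansion of the input densities turns into a uniform expansion of the output densities.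
  The score of the image is therefore the density of the pushed-forward derivative.\<close>

lemma private_image_score:
  assumes mod: "dominated_model \<mu> \<Theta> P p" and dqm: "DQM_at \<mu> \<Theta> p \<theta> s" and th: "\<theta> \<in> \<Theta>"
    and Q: "Q \<in> private_channels \<alpha> \<mu> N"
  obtains g where "g \<in> borel_measurable N" "\<And>z. \<bar>g z\<bar> \<le> exp \<alpha> * L1_norm \<mu> (\<lambda>x. s x * p \<theta> x)"
    "\<forall>u\<in>bounded_measurable N.
       (\<integral>z. u z * g z \<partial>(P \<theta> \<bind> Q)) = (\<integral>x. (\<integral>z. u z \<partial>Q x) * (s x * p \<theta> x) \<partial>\<mu>)"
    "is_score \<Theta> (image_model Q P) \<theta> g"
proof -
  note QD = private_channelsD[OF Q]
  note \<kappa> = dominated_modelD(1,5)[OF mod th]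
  note pdot = DQM_pdot_integrable(1)[OF mod dqm th]
  let ?\<nu> = "P \<theta> \<bind> Q" and ?L = "L1_norm \<mu> (\<lambda>x. s x * p \<theta> x)"
  interpret \<nu>: prob_space ?\<nu> by (rule prob_space_bind_kernel(1)[OF QD(1) \<kappa>])
  note sets_\<nu> = prob_space_bind_kernel(2)[OF QD(1) \<kappa>]
  note meas_\<nu> = measurable_cong_sets[OF sets_\<nu> refl]
  obtain g where g: "g \<in> borel_measurable N" "\<And>z. \<bar>g z\<bar> \<le> exp \<alpha> * ?L"
    "\<forall>u\<in>bounded_measurable N.
       (\<integral>z. u z * g z \<partial>?\<nu>) = (\<integral>x. (\<integral>z. u z \<partial>Q x) * (s x * p \<theta> x) \<partial>\<mu>)"
    by (rule push_forward_density[OF Q \<kappa> pdot], rule that)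
  have "\<forall>\<theta>'\<in>\<Theta>. \<exists>D. D \<in> borel_measurable N \<and> (\<forall>z. 0 \<le> D z) \<and> integrable ?\<nu> D \<and>
      P \<theta>' \<bind> Q = density ?\<nu> (\<lambda>z. ennreal (D z)) \<and>
      (\<forall>u\<in>bounded_measurable N.
        (\<integral>z. u z * D z \<partial>?\<nu>) = (\<integral>x. (\<integral>z. u z \<partial>Q x) * p \<theta>' x \<partial>\<mu>))"
    (is "\<forall>\<theta>'\<in>\<Theta>. ?E \<theta>'")
  proof
    fix \<theta>' assume t: "\<theta>' \<in> \<Theta>"
    obtain D where D: "D \<in> borel_measurable N" "\<And>z. 0 \<le> D z" "integrable ?\<nu> D"
      "density \<mu> (\<lambda>x. ennreal (p \<theta>' x)) \<bind> Q = density ?\<nu> (\<lambda>z. ennreal (D z))"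
      "\<forall>u\<in>bounded_measurable N.
        (\<integral>z. u z * D z \<partial>?\<nu>) = (\<integral>x. (\<integral>z. u z \<partial>Q x) * p \<theta>' x \<partial>\<mu>)"
      by (rule nonneg_push_forward_density[OF Q \<kappa> dominated_modelD(7,3)[OF mod t]], assumption, rule that)
    show "?E \<theta>'"
    proof (intro exI[of _ D] conjI allI D(1,2,3,5))
      show "P \<theta>' \<bind> Q = density ?\<nu> (\<lambda>z. ennreal (D z))"
        by (subst dominated_modelD(4)[OF mod t]) (rule D(4))
    qed
  qed
  then obtain D where D: "\<And>\<theta>'. \<theta>' \<in> \<Theta> \<Longrightarrow> D \<theta>' \<in> borel_measurable N" "\<And>\<theta>' z. \<theta>' \<in> \<Theta> \<Longrightarrow> 0 \<le> D \<theta>' z"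
    "\<And>\<theta>'. \<theta>' \<in> \<Theta> \<Longrightarrow> integrable ?\<nu> (D \<theta>')"
    "\<And>\<theta>'. \<theta>' \<in> \<Theta> \<Longrightarrow> P \<theta>' \<bind> Q = density ?\<nu> (\<lambda>z. ennreal (D \<theta>' z))"
    "\<And>\<theta>'. \<theta>' \<in> \<Theta> \<Longrightarrow> \<forall>u\<in>bounded_measurable N.
        (\<integral>z. u z * D \<theta>' z \<partial>?\<nu>) = (\<integral>x. (\<integral>z. u z \<partial>Q x) * p \<theta>' x \<partial>\<mu>)"
    unfolding bchoice_iff by blast
  \<comment> \<open>The version of the density at \<open>\<theta>\<close> that is \<open>1\<close> everywhere, not only almost everywhere.\<close>
  define q where "q \<theta>' = (if \<theta>' = \<theta> then \<lambda>_. 1 else D \<theta>')" for \<theta>'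
  have dom: "dominated_model ?\<nu> \<Theta> (image_model Q P) q"
    unfolding dominated_model_def
  proof (intro conjI ballI)
    show "sigma_finite_measure ?\<nu>" by unfold_locales
    fix \<theta>' assume t: "\<theta>' \<in> \<Theta>"
    show "prob_space (image_model Q P \<theta>')"
      unfolding image_model_def by (rule prob_space_bind_kernel(1)[OF QD(1) dominated_modelD(1,5)[OF mod t]])
    show "q \<theta>' \<in> borel_measurable ?\<nu>" using D(1)[OF t] meas_\<nu> by (auto simp: q_def)
    show "0 \<le> q \<theta>' z" for z using D(2)[OF t] by (auto simp: q_def)
    show "image_model Q P \<theta>' = density ?\<nu> (\<lambda>z. ennreal (q \<theta>' z))"
      using D(4)[OF t] by (auto simp: q_def image_model_def density_1)
  qed
  define e where "e h = (\<integral>x. \<bar>p (\<theta> + h) x - p \<theta> x - h * (s x * p \<theta> x)\<bar> \<partial>\<mu>)" for h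
  have lim_e: "((\<lambda>h. e h / \<bar>h\<bar>) \<longlongrightarrow> 0) (at 0)"
    unfolding e_def by (rule DQM_imp_L1_differentiable(2)[OF mod dqm th])
  have inter: "\<theta> \<in> interior \<Theta>" using dqm by (simp add: DQM_at_def)
  then obtain r where r: "r > 0" "ball \<theta> r \<subseteq> \<Theta>"
    by (auto simp: mem_interior)
  have ev_in: "\<forall>\<^sub>F h in at 0. h \<noteq> 0 \<and> \<theta> + h \<in> \<Theta>"
    unfolding eventually_at using r by (intro exI[of _ r]) (auto simp: subset_iff dist_norm)
  have expand: "AE z in ?\<nu>. \<bar>D (\<theta> + h) z - 1 - h * g z\<bar> \<le> exp \<alpha> * e h" if h: "\<theta> + h \<in> \<Theta>" for h
  proof (rule \<nu>.AE_abs_le_if_set_integrals)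
    have gi: "integrable ?\<nu> g"
      using g(1,2) meas_\<nu> by (intro \<nu>.integrable_const_bound[of _ "exp \<alpha> * ?L"]) auto
    then show "integrable ?\<nu> (\<lambda>z. D (\<theta> + h) z - 1 - h * g z)"
      using D(3)[OF h] by auto
    fix A assume A': "A \<in> sets ?\<nu>"
    then have A: "A \<in> sets N" using sets_\<nu> by simp
    have ind: "indicator A \<in> bounded_measurable N"
      using A by (intro bounded_measurableI[of _ _ 1]) (auto simp: indicator_def)
    have Qm: "(\<lambda>x. measure (Q x) A) \<in> borel_measurable \<mu>"
      by (rule measurable_compose[OF QD(2) measurable_measure_subprob_algebra[OF A]])
    have Q1: "\<bar>measure (Q x) A\<bar> \<le> 1" if "x \<in> space \<mu>" for x
      using prob_space.prob_le_1[OF QD(3)[OF that]] by simp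
    have Qi: "(\<integral>x. (\<integral>z. indicator A z \<partial>Q x) * w x \<partial>\<mu>) = (\<integral>x. measure (Q x) A * w x \<partial>\<mu>)" for w :: "'a \<Rightarrow> real"
      using QD(4,5) A by (intro Bochner_Integration.integral_cong) auto
    note ints = dominated_modelD(7)[OF mod h] dominated_modelD(7)[OF mod th] pdot
    note Qint = ints[THEN integrable_mult_bounded[OF _ Qm Q1]]
    have one: "(\<integral>z. indicator A z \<partial>?\<nu>) = (\<integral>x. measure (Q x) A * p \<theta> x \<partial>\<mu>)"
    proof -
      have "(\<integral>z. indicator A z \<partial>?\<nu>) = measure ?\<nu> A" using A' by simp
      also have "\<dots> = (\<integral>x. measure (Q x) A \<partial>P \<theta>)" by (rule prob_space_bind_kernel(3)[OF QD(1) \<kappa> A])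
      also have "\<dots> = (\<integral>x. measure (Q x) A * p \<theta> x \<partial>\<mu>)" by (rule integral_dominated_model(1)[OF mod th Qm])
      finally show ?thesis .
    qed
    have i1: "integrable ?\<nu> (\<lambda>z. indicator A z * D (\<theta> + h) z)" "integrable ?\<nu> (\<lambda>z. indicator A z * g z)"
      using integrable_real_mult_indicator[OF A' D(3)[OF h]] integrable_real_mult_indicator[OF A' gi]
      by (simp_all add: mult.commute)
    have i2: "integrable ?\<nu> (indicator A :: _ \<Rightarrow> real)"
      using A' by (auto intro!: integrable_real_indicator simp: less_top[symmetric])
    have "(\<integral>z. indicator A z * (D (\<theta> + h) z - 1 - h * g z) \<partial>?\<nu>)
      = (\<integral>z. indicator A z * D (\<theta> + h) z - indicator A z - h * (indicator A z * g z) \<partial>?\<nu>)"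
      by (intro Bochner_Integration.integral_cong) (auto simp: algebra_simps)
    also have "\<dots> = (\<integral>z. indicator A z * D (\<theta> + h) z \<partial>?\<nu>) - (\<integral>z. indicator A z \<partial>?\<nu>) - h * (\<integral>z. indicator A z * g z \<partial>?\<nu>)"
      using i1 i2 by (simp add: Bochner_Integration.integral_diff)
    also have "\<dots> = (\<integral>x. measure (Q x) A * p (\<theta>+h) x \<partial>\<mu>) - (\<integral>x. measure (Q x) A * p \<theta> x \<partial>\<mu>)
        - h * (\<integral>x. measure (Q x) A * (s x * p \<theta> x) \<partial>\<mu>)"
      unfolding bspec[OF D(5)[OF h] ind] bspec[OF g(3) ind] Qi one ..
    also have "\<dots> = (\<integral>x. measure (Q x) A * p (\<theta>+h) x - measure (Q x) A * p \<theta> x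
        - h * (measure (Q x) A * (s x * p \<theta> x)) \<partial>\<mu>)"
      using Qint by (simp add: Bochner_Integration.integral_diff)
    also have "\<dots> = (\<integral>x. measure (Q x) A * (p (\<theta>+h) x - p \<theta> x - h * (s x * p \<theta> x)) \<partial>\<mu>)"
      by (intro Bochner_Integration.integral_cong) (auto simp: algebra_simps)
    also have "\<bar>\<dots>\<bar> \<le> (exp \<alpha> * measure ?\<nu> A) * e h"
      unfolding e_def using private_le_bind[OF Q A \<kappa>] Qm ints
      by (intro abs_integral_mult_le) auto
    finally show "\<bar>\<integral>z. indicator A z * (D (\<theta> + h) z - 1 - h * g z) \<partial>?\<nu>\<bar> \<le> exp \<alpha> * e h * measure ?\<nu> A"
      by (simp add: mult_ac)
  qed
  define G where "G = exp \<alpha> * ?L"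
  define b where "b h = (exp \<alpha> * (e h / \<bar>h\<bar>) + \<bar>h\<bar> * (G + exp \<alpha> * (e h / \<bar>h\<bar>))\<^sup>2) / 2" for h
  have lim_b: "((\<lambda>h. ennreal ((b h)\<^sup>2)) \<longlongrightarrow> 0) (at 0)"
  proof -
    have "((\<lambda>h. (b h)\<^sup>2) \<longlongrightarrow> ((exp \<alpha> * 0 + \<bar>0\<bar> * (G + exp \<alpha> * 0)\<^sup>2) / 2)\<^sup>2) (at 0)"
      unfolding b_def by (intro tendsto_intros lim_e) auto
    then have "((\<lambda>h. (b h)\<^sup>2) \<longlongrightarrow> 0) (at 0)" by simp
    from tendsto_ennrealI[OF this] show ?thesis by simp
  qed
  have "DQM_at ?\<nu> \<Theta> q \<theta> g"
    unfolding DQM_at_def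
  proof (intro conjI)
    show "\<theta> \<in> interior \<Theta>" by fact
    show "g \<in> borel_measurable ?\<nu>" using g(1) meas_\<nu> by blast
    let ?S = "\<lambda>h z. ennreal ((sqrt (q (\<theta> + h) z) - sqrt (q \<theta> z) - 1/2 * h * g z * sqrt (q \<theta> z))\<^sup>2)"
    let ?R = "\<lambda>h. (\<integral>\<^sup>+z. ?S h z \<partial>?\<nu>)"
    have "\<forall>\<^sub>F h in at 0. ?R h / ennreal (h\<^sup>2) \<le> ennreal ((b h)\<^sup>2)"
      using ev_in
    proof eventually_elim
      case (elim h)
      have e0: "0 \<le> e h" unfolding e_def by simp
      have hb: "(exp \<alpha> * e h + (\<bar>h\<bar> * G + exp \<alpha> * e h)\<^sup>2) / 2 = \<bar>h\<bar> * b h"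
      proof -
        have *: "e h = \<bar>h\<bar> * (e h / \<bar>h\<bar>)" using elim by simp
        define E where "E = e h / \<bar>h\<bar>"
        show ?thesis unfolding b_def E_def[symmetric] unfolding *[folded E_def]
          by (simp add: power2_eq_square algebra_simps)
      qed
      have "AE z in ?\<nu>. ?S h z
          \<le> ennreal (h\<^sup>2 * (b h)\<^sup>2)"
        using expand[OF conjunct2[OF elim]]
      proof eventually_elim
        fix z assume z: "\<bar>D (\<theta> + h) z - 1 - h * g z\<bar> \<le> exp \<alpha> * e h"
        have "\<bar>sqrt (D (\<theta> + h) z) - 1 - 1/2 * h * g z\<bar> \<le> \<bar>h\<bar> * b h"
          unfolding hb[symmetric] using g(2) D(2) elim by (intro sqrt_linearization z) (auto simp: G_def)
        then have "(sqrt (D (\<theta> + h) z) - 1 - 1/2 * h * g z)\<^sup>2 \<le> (\<bar>h\<bar> * b h)\<^sup>2"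
          by (metis abs_ge_zero power2_abs power_mono)
        then show "?S h z
          \<le> ennreal (h\<^sup>2 * (b h)\<^sup>2)"
          using elim by (intro ennreal_leI) (simp add: q_def power_mult_distrib)
      qed
      then have "?R h \<le> (\<integral>\<^sup>+z. ennreal (h\<^sup>2 * (b h)\<^sup>2) \<partial>?\<nu>)"
        by (rule nn_integral_mono_AE)
      also have "\<dots> = ennreal (h\<^sup>2 * (b h)\<^sup>2)" using \<nu>.emeasure_space_1 by simp
      finally have "?R h / ennreal (h\<^sup>2) \<le> ennreal (h\<^sup>2 * (b h)\<^sup>2) / ennreal (h\<^sup>2)"
        by (rule divide_right_mono_ennreal)
      also have "\<dots> = ennreal ((b h)\<^sup>2)" using elim by (simp add: divide_ennreal)
      finally show ?case .
    qed
    then show "((\<lambda>h. ?R h / ennreal (h\<^sup>2)) \<longlongrightarrow> 0) (at 0)"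
      by (intro tendsto_sandwich[OF _ _ tendsto_const lim_b]) auto
  qed
  then have "is_score \<Theta> (image_model Q P) \<theta> g"
    unfolding is_score_def using dom by blast
  from that[OF g this] show ?thesis .
qed

section \<open>The variational form of the Fisher information\<close>

text \<open>The pointwise identity \<open>sup\<^sub>u (2 u g - u\<^sup>2 f) = g\<^sup>2 / f\<close>, integrated over the output space and pulled
  back to the input space: \<open>f\<close> and \<open>f'\<close> stand for \<open>p(\<theta>)\<close> and its derivative \<open>s p(\<theta>)\<close>. For fixed \<open>u\<close> the
  functional is linear in the channel and in the densities, unlike the Fisher information.\<close>

definition score_functional ::
  "'x measure \<Rightarrow> ('x \<Rightarrow> real) \<Rightarrow> ('x \<Rightarrow> real) \<Rightarrow> ('x \<Rightarrow> 'z measure) \<Rightarrow> ('z \<Rightarrow> real) \<Rightarrow> real" where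
  "score_functional \<mu> f f' Q u =
     2 * (\<integral>x. (\<integral>z. u z \<partial>Q x) * f' x \<partial>\<mu>) - (\<integral>x. (\<integral>z. (u z)\<^sup>2 \<partial>Q x) * f x \<partial>\<mu>)"

lemma bounded_measurable_square:
  fixes u :: "'a \<Rightarrow> real"
  assumes u: "u \<in> borel_measurable N" and B: "\<And>z. z \<in> space N \<Longrightarrow> \<bar>u z\<bar> \<le> B"
  shows "(\<lambda>z. (u z)\<^sup>2) \<in> borel_measurable N" "\<And>z. z \<in> space N \<Longrightarrow> \<bar>(u z)\<^sup>2\<bar> \<le> B\<^sup>2"
proof -
  show "(\<lambda>z. (u z)\<^sup>2) \<in> borel_measurable N" using u by (rule borel_measurable_power)
  show "\<bar>(u z)\<^sup>2\<bar> \<le> B\<^sup>2" if "z \<in> space N" for z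
    using power_mono[OF B[OF that] abs_ge_zero, of 2] by simp
qed

text \<open>Both claims are the identity \<open>score_functional u = I - \<integral>(u - g)\<^sup>2\<close>, where \<open>g\<close> is the score of
  the image model.\<close>

lemma
  assumes mod: "dominated_model \<mu> \<Theta> P p" and dqm: "DQM_at \<mu> \<Theta> p \<theta> s" and th: "\<theta> \<in> \<Theta>"
    and Q: "Q \<in> private_channels \<alpha> \<mu> N"
  shows score_functional_le:
      "u \<in> bounded_measurable N \<Longrightarrow>
        score_functional \<mu> (p \<theta>) (\<lambda>x. s x * p \<theta> x) Q u \<le> fisher_information \<Theta> (image_model Q P) \<theta>"
    and score_functional_attained:
      "\<exists>u\<in>borel_measurable N. (\<forall>z. \<bar>u z\<bar> \<le> exp \<alpha> * L1_norm \<mu> (\<lambda>x. s x * p \<theta> x)) \<and>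
        score_functional \<mu> (p \<theta>) (\<lambda>x. s x * p \<theta> x) Q u = fisher_information \<Theta> (image_model Q P) \<theta>"
proof -
  note QD = private_channelsD[OF Q]
  note \<kappa> = dominated_modelD(1,5)[OF mod th]
  let ?\<nu> = "P \<theta> \<bind> Q"
  interpret \<nu>: prob_space ?\<nu> by (rule prob_space_bind_kernel(1)[OF QD(1) \<kappa>])
  note sets_\<nu> = prob_space_bind_kernel(2)[OF QD(1) \<kappa>]
  note meas_\<nu> = measurable_cong_sets[OF sets_\<nu> refl]
  note space_\<nu> = sets_eq_imp_space_eq[OF sets_\<nu>]
  obtain g where g: "g \<in> borel_measurable N" "\<And>z. \<bar>g z\<bar> \<le> exp \<alpha> * L1_norm \<mu> (\<lambda>x. s x * p \<theta> x)"
    "\<forall>u\<in>bounded_measurable N.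
       (\<integral>z. u z * g z \<partial>?\<nu>) = (\<integral>x. (\<integral>z. u z \<partial>Q x) * (s x * p \<theta> x) \<partial>\<mu>)"
    "is_score \<Theta> (image_model Q P) \<theta> g"
    by (rule private_image_score[OF mod dqm th Q], rule that)
  have I: "fisher_information \<Theta> (image_model Q P) \<theta> = (\<integral>z. (g z)\<^sup>2 \<partial>?\<nu>)"
    using fisher_information_eq[OF g(4) th] by (simp add: image_model_def)
  have gbm: "g \<in> bounded_measurable N" using g(1,2) by (rule bounded_measurableI)
  have int: "integrable ?\<nu> v" if "v \<in> bounded_measurable N" for v
  proof -
    from that obtain B where "v \<in> borel_measurable N" "\<forall>z\<in>space N. \<bar>v z\<bar> \<le> B"
      by (auto simp: bounded_measurable_def)
    then show ?thesis
      using meas_\<nu> space_\<nu> by (intro \<nu>.integrable_const_bound[of _ B]) auto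
  qed
  have key: "score_functional \<mu> (p \<theta>) (\<lambda>x. s x * p \<theta> x) Q u = (\<integral>z. (g z)\<^sup>2 \<partial>?\<nu>) - (\<integral>z. (u z - g z)\<^sup>2 \<partial>?\<nu>)"
    if ubm: "u \<in> bounded_measurable N" for u
  proof -
    obtain B where u: "u \<in> borel_measurable N" and B: "\<And>z. z \<in> space N \<Longrightarrow> \<bar>u z\<bar> \<le> B"
      using ubm by (auto simp: bounded_measurable_def)
    note u2 = bounded_measurable_square[OF u B]
    have Q\<theta>: "Q \<in> P \<theta> \<rightarrow>\<^sub>M subprob_algebra N" using QD(2) measurable_cong_sets[OF \<kappa>(2) refl] by blast
    have AE1: "AE x in P \<theta>. emeasure (Q x) (space (Q x)) \<le> ennreal 1"
      using prob_space.emeasure_space_1[OF QD(3)] dominated_modelD(6)[OF mod th] by (intro AE_I2) simp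
    have "(\<integral>z. (u z)\<^sup>2 \<partial>?\<nu>) = (\<integral>x. (\<integral>z. (u z)\<^sup>2 \<partial>Q x) \<partial>P \<theta>)"
      by (rule integral_bind[OF u2 Q\<theta> prob_space.finite_measure[OF \<kappa>(1)] AE1])
    also have "\<dots> = (\<integral>x. (\<integral>z. (u z)\<^sup>2 \<partial>Q x) * p \<theta> x \<partial>\<mu>)"
      by (rule integral_dominated_model(1)[OF mod th kernel_integral_bounded(1)[OF QD(1) u2]])
    finally have 1: "(\<integral>x. (\<integral>z. (u z)\<^sup>2 \<partial>Q x) * p \<theta> x \<partial>\<mu>) = (\<integral>z. (u z)\<^sup>2 \<partial>?\<nu>)" by simp
    have iu2: "integrable ?\<nu> (\<lambda>z. (u z)\<^sup>2)" by (rule int[OF bounded_measurableI[OF u2]])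
    have ig2: "integrable ?\<nu> (\<lambda>z. (g z)\<^sup>2)" by (rule int[OF bounded_measurableI[OF bounded_measurable_square[OF g(1,2)]]])
    have iug: "integrable ?\<nu> (\<lambda>z. u z * g z)"
      using Cauchy_Schwarz_integral(1)[of u ?\<nu> g] iu2 ig2 u g(1) meas_\<nu> by blast
    have "(\<integral>z. (u z - g z)\<^sup>2 \<partial>?\<nu>) = (\<integral>z. (u z)\<^sup>2 + (g z)\<^sup>2 - 2 * (u z * g z) \<partial>?\<nu>)"
      by (intro Bochner_Integration.integral_cong) (auto simp: power2_diff)
    also have "\<dots> = (\<integral>z. (u z)\<^sup>2 \<partial>?\<nu>) + (\<integral>z. (g z)\<^sup>2 \<partial>?\<nu>) - 2 * (\<integral>z. u z * g z \<partial>?\<nu>)"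
      using iu2 ig2 iug by simp
    finally show ?thesis
      unfolding score_functional_def 1 using bspec[OF g(3) ubm] by simp
  qed
  show "score_functional \<mu> (p \<theta>) (\<lambda>x. s x * p \<theta> x) Q u \<le> fisher_information \<Theta> (image_model Q P) \<theta>"
    if "u \<in> bounded_measurable N"
    unfolding key[OF that] I by simp
  show "\<exists>u\<in>borel_measurable N. (\<forall>z. \<bar>u z\<bar> \<le> exp \<alpha> * L1_norm \<mu> (\<lambda>x. s x * p \<theta> x)) \<and>
        score_functional \<mu> (p \<theta>) (\<lambda>x. s x * p \<theta> x) Q u = fisher_information \<Theta> (image_model Q P) \<theta>"
    using key[OF gbm] g(1,2) I by (intro bexI[of _ g]) auto
qed

lemma private_channel_compose:
  assumes Q: "Q \<in> private_channels \<alpha> M N" and T: "T \<in> L \<rightarrow>\<^sub>M M"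
  shows "(\<lambda>x. Q (T x)) \<in> private_channels \<alpha> L N"
  using private_channelsD(1)[OF Q] private_channelsD(6)[OF Q] measurable_space[OF T] T
  by (auto simp: private_channels_def)

lemma score_functional_diff_le:
  assumes Q: "Q \<in> private_channels \<alpha> \<mu> N" and u: "u \<in> borel_measurable N"
    and U: "\<And>z. z \<in> space N \<Longrightarrow> \<bar>u z\<bar> \<le> U" and U0: "0 \<le> U"
    and int: "integrable \<mu> f1" "integrable \<mu> f2" "integrable \<mu> f1'" "integrable \<mu> f2'"
  shows "score_functional \<mu> f1 f1' Q u \<le> score_functional \<mu> f2 f2' Q u
    + 2 * U * L1_norm \<mu> (\<lambda>x. f1' x - f2' x) + U\<^sup>2 * L1_norm \<mu> (\<lambda>x. f1 x - f2 x)"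
proof -
  note QD = private_channelsD[OF Q]
  note k1 = kernel_integral_bounded(1,3)[OF QD(1) u U]
  note k2 = kernel_integral_bounded(1,3)[OF QD(1) bounded_measurable_square[OF u U]]
  have d: "(\<integral>x. w x * a x \<partial>\<mu>) - (\<integral>x. w x * b x \<partial>\<mu>) = (\<integral>x. w x * (a x - b x) \<partial>\<mu>)"
    if "integrable \<mu> a" "integrable \<mu> b" "w \<in> borel_measurable \<mu>" "\<And>x. x \<in> space \<mu> \<Longrightarrow> \<bar>w x\<bar> \<le> W"
    for w a b :: "'a \<Rightarrow> real" and W
    unfolding right_diff_distrib
    by (rule Bochner_Integration.integral_diff[symmetric, OF integrable_mult_bounded[OF that(1,3,4)] integrable_mult_bounded[OF that(2,3,4)]])
  have "\<bar>\<integral>x. (\<integral>z. u z \<partial>Q x) * (f1' x - f2' x) \<partial>\<mu>\<bar> \<le> U * L1_norm \<mu> (\<lambda>x. f1' x - f2' x)"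
    unfolding L1_norm_def using int k1 by (intro abs_integral_mult_le) auto
  moreover have "\<bar>\<integral>x. (\<integral>z. (u z)\<^sup>2 \<partial>Q x) * (f1 x - f2 x) \<partial>\<mu>\<bar> \<le> U\<^sup>2 * L1_norm \<mu> (\<lambda>x. f1 x - f2 x)"
    unfolding L1_norm_def using int k2 by (intro abs_integral_mult_le) auto
  ultimately show ?thesis
    using d[OF int(3,4) k1] d[OF int(1,2) k2] unfolding score_functional_def
    by linarith
qed

lemma regular_modelD:
  assumes "regular_model \<mu> \<Theta> P p s"
  shows "dominated_model \<mu> \<Theta> P p" "\<theta> \<in> \<Theta> \<Longrightarrow> DQM_at \<mu> \<Theta> p \<theta> (s \<theta>)"
  using assms by (auto simp: regular_model_def)

lemma fisher_information_nonneg: "0 \<le> fisher_information \<Theta> P \<theta>"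
  by (simp add: fisher_information_def)

lemma L1_norm_nonneg: "0 \<le> L1_norm \<mu> f"
  by (simp add: L1_norm_def)

lemma sqrt_le_max_1: "sqrt x \<le> max x 1" if "0 \<le> x"
proof (cases "x \<le> 1")
  case False
  then have "x * 1 \<le> x * x" by (intro mult_left_mono) auto
  then have "x \<le> x\<^sup>2" by (simp add: power2_eq_square)
  then have "sqrt x \<le> x" using that by (intro real_le_lsqrt) auto
  then show ?thesis by simp
qed (simp add: max_def)

lemma phi_commute: "phi \<alpha> \<mu> \<Theta> P p s \<theta> \<theta>' = phi \<alpha> \<mu> \<Theta> P p s \<theta>' \<theta>"
proof -
  have "L1_norm \<mu> (\<lambda>x. a x - b x) = L1_norm \<mu> (\<lambda>x. b x - a x)" for a b
    by (simp add: L1_norm_def abs_minus_commute)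
  from this[of "\<lambda>x. s \<theta> x * p \<theta> x" "\<lambda>x. s \<theta>' x * p \<theta>' x"] this[of "p \<theta>" "p \<theta>'"]
  show ?thesis unfolding phi_def by (simp add: max.commute)
qed

text \<open>The test function that is optimal at \<open>\<theta>\<close> is admissible at \<open>\<theta>'\<close>. It is bounded by
  \<open>e\<^sup>\<alpha> \<surd>I\<close> for every private channel, where \<open>I\<close> is the information of \<open>P\<close> at \<open>\<theta>\<close>, so that the
  estimate is uniform over the channels.\<close>

lemma fisher_information_continuity:
  assumes reg: "regular_model \<mu> \<Theta> P p s" and \<alpha>: "0 < \<alpha>" and th: "\<theta> \<in> \<Theta>" "\<theta>' \<in> \<Theta>"
    and Q: "Q \<in> private_channels \<alpha> \<mu> N"
  shows "fisher_information \<Theta> (image_model Q P) \<theta>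
    \<le> fisher_information \<Theta> (image_model Q P) \<theta>' + phi \<alpha> \<mu> \<Theta> P p s \<theta> \<theta>'"
proof -
  note mod = regular_modelD(1)[OF reg] and dqm = regular_modelD(2)[OF reg]
  let ?d = "\<lambda>\<theta> x. s \<theta> x * p \<theta> x"
  obtain u where u: "u \<in> borel_measurable N" "\<forall>z. \<bar>u z\<bar> \<le> exp \<alpha> * L1_norm \<mu> (?d \<theta>)"
    "score_functional \<mu> (p \<theta>) (?d \<theta>) Q u = fisher_information \<Theta> (image_model Q P) \<theta>"
    using score_functional_attained[OF mod dqm[OF th(1)] th(1) Q] by blast
  define I where "I = fisher_information \<Theta> P \<theta>"
  define m where "m = max (max I (fisher_information \<Theta> P \<theta>')) 1"
  define U where "U = exp \<alpha> * sqrt I"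
  have I0: "0 \<le> I" unfolding I_def by (rule fisher_information_nonneg)
  have U0: "0 \<le> U" unfolding U_def using I0 by simp
  have "exp \<alpha> * L1_norm \<mu> (?d \<theta>) \<le> U"
    unfolding U_def I_def using L1_norm_pdot_le[OF mod dqm[OF th(1)] th(1)] by (intro mult_left_mono) auto
  with u(2) have uU: "\<And>z. \<bar>u z\<bar> \<le> U" by (meson order_trans)
  have ea: "exp \<alpha> \<le> exp (2 * \<alpha>)" using \<alpha> by simp
  have U1: "U \<le> exp (2 * \<alpha>) * m"
    unfolding U_def using ea sqrt_le_max_1[OF I0] I0 by (intro mult_mono) (auto simp: m_def)
  have U2: "U\<^sup>2 \<le> exp (2 * \<alpha>) * m"
  proof -
    have "U\<^sup>2 = exp (2 * \<alpha>) * I" using I0 by (simp add: U_def power_mult_distrib exp_double)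
    also have "\<dots> \<le> exp (2 * \<alpha>) * m" by (intro mult_left_mono) (auto simp: m_def)
    finally show ?thesis .
  qed
  let ?A = "L1_norm \<mu> (\<lambda>x. ?d \<theta> x - ?d \<theta>' x)" and ?B = "L1_norm \<mu> (\<lambda>x. p \<theta> x - p \<theta>' x)"
  have "fisher_information \<Theta> (image_model Q P) \<theta>
    \<le> score_functional \<mu> (p \<theta>') (?d \<theta>') Q u + 2 * U * ?A + U\<^sup>2 * ?B"
    unfolding u(3)[symmetric]
    using dominated_modelD(7)[OF mod] DQM_pdot_integrable(1)[OF mod dqm] th
    by (intro score_functional_diff_le[OF Q u(1) uU U0]) auto
  also have "score_functional \<mu> (p \<theta>') (?d \<theta>') Q u \<le> fisher_information \<Theta> (image_model Q P) \<theta>'"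
    using bounded_measurableI[OF u(1) uU] by (rule score_functional_le[OF mod dqm[OF th(2)] th(2) Q])
  also have "2 * U * ?A \<le> exp (2 * \<alpha>) * m * (2 * ?A)"
    using mult_right_mono[OF U1, of "2 * ?A"] L1_norm_nonneg[of \<mu>] by simp
  also have "U\<^sup>2 * ?B \<le> exp (2 * \<alpha>) * m * (3 * ?B)"
    using U2 L1_norm_nonneg[of \<mu> "\<lambda>x. p \<theta> x - p \<theta>' x"] by (intro mult_mono) (auto simp: m_def)
  finally show ?thesis
    unfolding phi_def m_def I_def by (simp add: distrib_left)
qed

text \<open>An injection of the \<open>k\<close> output symbols into the type \<open>'z\<close> carries the optimal test function
  along. Hence finite channels compete in the supremum over channels with outputs in \<open>'z\<close>.\<close>

lemma finite_output_relabel: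
  fixes Q :: "'x \<Rightarrow> nat measure"
  assumes mod: "dominated_model \<mu> \<Theta> P p" and dqm: "DQM_at \<mu> \<Theta> p \<theta> s" and th: "\<theta> \<in> \<Theta>"
    and Q: "Q \<in> private_channels \<alpha> \<mu> (fin k)"
  obtains N :: "'z::infinite measure" and Q' where "Q' \<in> private_channels \<alpha> \<mu> N"
    "fisher_information \<Theta> (image_model Q P) \<theta> \<le> fisher_information \<Theta> (image_model Q' P) \<theta>"
proof -
  note QD = private_channelsD[OF Q]
  obtain S :: "'z set" where S: "finite S" "card S = k"
    using infinite_arbitrarily_large[OF infinite_UNIV] by blast
  then obtain e where e: "bij_betw e {1..k} S"
    using finite_same_card_bij[of "{1..k}" S] by auto
  then have inj: "inj_on e {1..k}" and img: "e ` {1..k} = S" by (auto simp: bij_betw_def)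
  define N where "N = count_space S"
  define Q' where "Q' x = distr (Q x) N e" for x
  have em: "e \<in> fin k \<rightarrow>\<^sub>M N" using img by (auto simp: N_def)
  have eQ: "e \<in> Q x \<rightarrow>\<^sub>M N" if "x \<in> space \<mu>" for x
    using em measurable_cong_sets[OF QD(4)[OF that] refl] by blast
  have Q': "Q' \<in> private_channels \<alpha> \<mu> N"
    unfolding private_channels_def
  proof (intro CollectI conjI ballI)
    show "Q' \<in> \<mu> \<rightarrow>\<^sub>M prob_algebra N"
      unfolding Q'_def by (rule measurable_compose[OF QD(1) measurable_distr_prob_space[OF em]])
    fix A x x' assume A: "A \<in> sets N" and x: "x \<in> space \<mu>" "x' \<in> space \<mu>"
    have "measure (Q' y) A = measure (Q y) (e -` A \<inter> {1..k})" if y: "y \<in> space \<mu>" for y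
      unfolding Q'_def using measure_distr[OF eQ[OF y] A] QD(5)[OF y] by simp
    then show "measure (Q' x) A \<le> exp \<alpha> * measure (Q' x') A"
      using x QD(6)[of "e -` A \<inter> {1..k}" x x'] by simp
  qed
  obtain u where u: "u \<in> borel_measurable (fin k)" "\<forall>z. \<bar>u z\<bar> \<le> exp \<alpha> * L1_norm \<mu> (\<lambda>x. s x * p \<theta> x)"
    "score_functional \<mu> (p \<theta>) (\<lambda>x. s x * p \<theta> x) Q u = fisher_information \<Theta> (image_model Q P) \<theta>"
    using score_functional_attained[OF mod dqm th Q] by blast
  define v where "v z = u (inv_into {1..k} e z)" for z
  have vint: "(\<integral>z. f (v z) \<partial>Q' x) = (\<integral>z. f (u z) \<partial>Q x)" if x: "x \<in> space \<mu>" for f :: "real \<Rightarrow> real" and x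
  proof -
    have "(\<integral>z. f (v z) \<partial>Q' x) = (\<integral>z. f (v (e z)) \<partial>Q x)"
      unfolding Q'_def by (rule integral_distr[OF eQ[OF x]]) (simp add: N_def)
    also have "\<dots> = (\<integral>z. f (u z) \<partial>Q x)"
      using QD(5)[OF x] inv_into_f_f[OF inj] by (intro Bochner_Integration.integral_cong) (auto simp: v_def)
    finally show ?thesis .
  qed
  have "score_functional \<mu> (p \<theta>) (\<lambda>x. s x * p \<theta> x) Q u = score_functional \<mu> (p \<theta>) (\<lambda>x. s x * p \<theta> x) Q' v"
    unfolding score_functional_def using vint[of _ "\<lambda>t. t"] vint[of _ "\<lambda>t. t\<^sup>2"]
    by (intro arg_cong2[where f="(-)"] arg_cong2[where f="(*)"] refl Bochner_Integration.integral_cong) auto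
  also have "\<dots> \<le> fisher_information \<Theta> (image_model Q' P) \<theta>"
    using u(2) by (intro score_functional_le[OF mod dqm th Q'] bounded_measurableI) (auto simp: N_def v_def)
  finally show ?thesis using that[OF Q'] u(3) by simp
qed

lemma image_information_bdd_above:
  assumes mod: "dominated_model \<mu> \<Theta> P p" and dqm: "DQM_at \<mu> \<Theta> p \<theta> s" and th: "\<theta> \<in> \<Theta>"
  shows "bdd_above {fisher_information \<Theta> (image_model Q P) \<theta> | (N::'z measure) Q. Q \<in> private_channels \<alpha> \<mu> N}"
proof (rule bdd_aboveI)
  fix I assume "I \<in> {fisher_information \<Theta> (image_model Q P) \<theta> | (N::'z measure) Q. Q \<in> private_channels \<alpha> \<mu> N}"
  then obtain N :: "'z measure" and Q where Q: "Q \<in> private_channels \<alpha> \<mu> N"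
    and I: "I = fisher_information \<Theta> (image_model Q P) \<theta>" by blast
  let ?U = "exp \<alpha> * L1_norm \<mu> (\<lambda>x. s x * p \<theta> x)"
  obtain u where u: "u \<in> borel_measurable N" "\<forall>z. \<bar>u z\<bar> \<le> ?U"
    "score_functional \<mu> (p \<theta>) (\<lambda>x. s x * p \<theta> x) Q u = I"
    unfolding I using score_functional_attained[OF mod dqm th Q] by blast
  have "score_functional \<mu> (p \<theta>) (\<lambda>x. s x * p \<theta> x) Q u \<le> score_functional \<mu> (\<lambda>_. 0) (\<lambda>_. 0) Q u
    + 2 * ?U * L1_norm \<mu> (\<lambda>x. s x * p \<theta> x - 0) + ?U\<^sup>2 * L1_norm \<mu> (\<lambda>x. p \<theta> x - 0)"
    using dominated_modelD(7)[OF mod th] DQM_pdot_integrable(1)[OF mod dqm th] u(2) L1_norm_nonneg[of \<mu>]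
    by (intro score_functional_diff_le[OF Q u(1)]) auto
  then show "I \<le> 2 * ?U * L1_norm \<mu> (\<lambda>x. s x * p \<theta> x) + ?U\<^sup>2 * L1_norm \<mu> (p \<theta>)"
    unfolding u(3) by (simp add: score_functional_def)
qed

section \<open>Reduction of the output space\<close>

lemma linear_dependence:
  fixes a :: "'i \<Rightarrow> 'j \<Rightarrow> real"
  assumes "finite J" "finite S" "card J < card S"
  obtains l where "\<exists>i\<in>S. l i \<noteq> 0" "\<And>j. j \<in> J \<Longrightarrow> (\<Sum>i\<in>S. l i * a i j) = 0"
proof -
  have "\<exists>l. (\<exists>i\<in>S. l i \<noteq> 0) \<and> (\<forall>j\<in>J. (\<Sum>i\<in>S. l i * a i j) = 0)"
    using assms
  proof (induction J arbitrary: S a rule: finite_induct)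
    case empty
    then have "S \<noteq> {}" by auto
    then show ?case by (intro exI[of _ "\<lambda>_. 1"]) auto
  next
    case (insert j J)
    show ?case
    proof (cases "\<forall>i\<in>S. a i j = 0")
      case True
      obtain l where "\<exists>i\<in>S. l i \<noteq> 0" "\<forall>j\<in>J. (\<Sum>i\<in>S. l i * a i j) = 0"
        using insert.IH[of S a] insert.prems insert.hyps by auto
      with True show ?thesis by (intro exI[of _ l]) auto
    next
      case False
      then obtain i0 where i0: "i0 \<in> S" "a i0 j \<noteq> 0" by blast
      define S' where "S' = S - {i0}"
      have S: "S = insert i0 S'" "i0 \<notin> S'" "finite S'" using i0 insert.prems by (auto simp: S'_def)
      have "card J < card S'" using insert.prems insert.hyps S by simp
      then obtain l where l: "\<exists>i\<in>S'. l i \<noteq> 0"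
        "\<forall>j'\<in>J. (\<Sum>i\<in>S'. l i * (a i j' - a i j / a i0 j * a i0 j')) = 0"
        using insert.IH[of S' "\<lambda>i j'. a i j' - a i j / a i0 j * a i0 j'"] S(3) by auto
      define l' where "l' i = (if i = i0 then - (\<Sum>i\<in>S'. l i * a i j) / a i0 j else l i)" for i
      have sum: "(\<Sum>i\<in>S. l' i * a i j') = (\<Sum>i\<in>S'. l i * (a i j' - a i j / a i0 j * a i0 j'))" for j'
      proof -
        have "(\<Sum>i\<in>S'. l' i * a i j') = (\<Sum>i\<in>S'. l i * a i j')"
          using S(2) by (intro sum.cong) (auto simp: l'_def)
        then have "(\<Sum>i\<in>S. l' i * a i j') = l' i0 * a i0 j' + (\<Sum>i\<in>S'. l i * a i j')"
          using S by simp
        also have "l' i0 * a i0 j' = - (\<Sum>i\<in>S'. l i * (a i j / a i0 j * a i0 j'))"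
          by (simp add: l'_def sum_distrib_right sum_divide_distrib sum_negf[symmetric] mult.assoc)
        finally show ?thesis by (simp add: right_diff_distrib sum_subtractf)
      qed
      have "(\<Sum>i\<in>S. l' i * a i j) = 0" unfolding sum using i0(2) by simp
      moreover have "\<exists>i\<in>S. l' i \<noteq> 0" using l(1) S by (auto simp: l'_def)
      ultimately show ?thesis using l(2) sum by (intro exI[of _ l']) auto
    qed
  qed
  then show ?thesis using that by blast
qed

text \<open>This is the existence of a basic optimal solution of a linear program: as long as there are
  more positive rows than columns, some linear relation between the rows leaves all column sums
  fixed, and moving along it in the direction in which the objective does not decrease removes a
  row.\<close>

lemma basic_solution:
  fixes a :: "'i \<Rightarrow> 'j \<Rightarrow> real" and h :: "'i \<Rightarrow> real"
  assumes J: "finite J" "J \<noteq> {}" and S: "finite S"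
    and pos: "\<And>i j. i \<in> S \<Longrightarrow> j \<in> J \<Longrightarrow> 0 < a i j"
  shows "\<exists>w. (\<forall>i. 0 \<le> w i) \<and> card {i\<in>S. w i \<noteq> 0} \<le> card J \<and>
     (\<forall>j\<in>J. (\<Sum>i\<in>S. w i * a i j) = (\<Sum>i\<in>S. a i j)) \<and> (\<Sum>i\<in>S. h i) \<le> (\<Sum>i\<in>S. w i * h i)"
  using S pos
proof (induction "card S" arbitrary: S a h rule: less_induct)
  case less
  show ?case
  proof (cases "card S \<le> card J")
    case True
    then show ?thesis by (intro exI[of _ "\<lambda>_. 1"]) auto
  next
    case False
    then obtain l0 where l0: "\<exists>i\<in>S. l0 i \<noteq> 0" "\<And>j. j \<in> J \<Longrightarrow> (\<Sum>i\<in>S. l0 i * a i j) = 0"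
      using linear_dependence[OF J(1) less.prems(1), of a] by (auto simp: not_le)
    \<comment> \<open>One of the two directions along the relation does not decrease the objective.\<close>
    define \<sigma> :: real where "\<sigma> = (if 0 \<le> (\<Sum>i\<in>S. l0 i * h i) then 1 else - 1)"
    define l where "l i = \<sigma> * l0 i" for i
    have suml: "(\<Sum>i\<in>S. l i * f i) = \<sigma> * (\<Sum>i\<in>S. l0 i * f i)" for f
      by (simp add: l_def sum_distrib_left mult.assoc)
    have l: "\<exists>i\<in>S. l i \<noteq> 0" "\<And>j. j \<in> J \<Longrightarrow> (\<Sum>i\<in>S. l i * a i j) = 0" "0 \<le> (\<Sum>i\<in>S. l i * h i)"
      unfolding suml using l0 by (auto simp: l_def \<sigma>_def)
    define Neg where "Neg = {i\<in>S. l i < 0}"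
    have "Neg \<noteq> {}"
    proof
      assume "Neg = {}"
      then have nn: "\<forall>i\<in>S. 0 \<le> l i" by (auto simp: Neg_def not_less)
      obtain j where j: "j \<in> J" using J(2) by blast
      have "\<forall>i\<in>S. l i * a i j = 0"
        using l(2)[OF j] nn less.prems(2)[OF _ j]
        by (subst sum_nonneg_eq_0_iff[OF less.prems(1), symmetric]) (auto simp: less_imp_le)
      then show False using l(1) less.prems(2)[OF _ j] by force
    qed
    have finN: "finite Neg" using less.prems(1) by (simp add: Neg_def)
    \<comment> \<open>The largest step that keeps all weights nonnegative; it makes the weight of \<open>i1\<close> vanish.\<close>
    define t where "t = Min ((\<lambda>i. - 1 / l i) ` Neg)"
    have "t \<in> (\<lambda>i. - 1 / l i) ` Neg"
      unfolding t_def using finN \<open>Neg \<noteq> {}\<close> by (intro Min_in) auto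
    then obtain i1 where i1: "i1 \<in> Neg" "t = - 1 / l i1" by auto
    have tle: "t \<le> - 1 / l i" if "i \<in> Neg" for i
      unfolding t_def using finN that by (intro Min_le) auto
    have t0: "0 < t" using i1 by (simp add: Neg_def divide_neg_neg)
    define c where "c i = 1 + t * l i" for i
    have c0: "0 \<le> c i" if "i \<in> S" for i
    proof (cases "i \<in> Neg")
      case True
      then have "l i < 0" by (simp add: Neg_def)
      then show ?thesis using tle[OF True] by (simp add: c_def field_simps)
    next
      case False
      then have "0 \<le> l i" using that by (simp add: Neg_def)
      then show ?thesis using t0 by (simp add: c_def)
    qed
    have ci1: "c i1 = 0" using i1 by (auto simp: c_def Neg_def)
    define S' where "S' = {i\<in>S. c i \<noteq> 0}"
    have S': "S' \<subset> S" "finite S'" using ci1 i1 less.prems(1) by (auto simp: S'_def Neg_def)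
    have "card S' < card S" using S' less.prems(1) by (intro psubset_card_mono)
    from less.hyps[OF this S'(2), of "\<lambda>i j. c i * a i j" "\<lambda>i. c i * h i"]
    obtain w where w: "\<forall>i. 0 \<le> w i" "card {i\<in>S'. w i \<noteq> 0} \<le> card J"
      "\<forall>j\<in>J. (\<Sum>i\<in>S'. w i * (c i * a i j)) = (\<Sum>i\<in>S'. c i * a i j)"
      "(\<Sum>i\<in>S'. c i * h i) \<le> (\<Sum>i\<in>S'. w i * (c i * h i))"
      using c0 less.prems(2) by (force simp: S'_def less_le)
    define w' where "w' i = (if i \<in> S' then w i * c i else 0)" for i
    have ext: "(\<Sum>i\<in>S'. w i * (c i * f i)) = (\<Sum>i\<in>S. w' i * f i)" for f
      using less.prems(1) S'(1)
      by (intro sum.mono_neutral_cong_left) (auto simp: w'_def mult.assoc)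
    have extc: "(\<Sum>i\<in>S'. c i * f i) = (\<Sum>i\<in>S. f i) + t * (\<Sum>i\<in>S. l i * f i)" for f
    proof -
      have "(\<Sum>i\<in>S'. c i * f i) = (\<Sum>i\<in>S. c i * f i)"
        using less.prems(1) S'(1) by (intro sum.mono_neutral_left) (auto simp: S'_def)
      also have "\<dots> = (\<Sum>i\<in>S. f i) + t * (\<Sum>i\<in>S. l i * f i)"
        by (simp add: c_def distrib_right sum.distrib sum_distrib_left mult.assoc)
      finally show ?thesis .
    qed
    have "{i\<in>S. w' i \<noteq> 0} \<subseteq> {i\<in>S'. w i \<noteq> 0}" by (auto simp: w'_def)
    then have "card {i\<in>S. w' i \<noteq> 0} \<le> card J"
      using w(2) S'(2) by (intro order_trans[OF card_mono w(2)]) auto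
    moreover have "\<forall>i. 0 \<le> w' i" using w(1) c0 S'(1) by (auto simp: w'_def)
    moreover have "\<forall>j\<in>J. (\<Sum>i\<in>S. w' i * a i j) = (\<Sum>i\<in>S. a i j)"
      using w(3) l(2) unfolding ext extc by simp
    moreover have "(\<Sum>i\<in>S. h i) \<le> (\<Sum>i\<in>S. w' i * h i)"
    proof -
      have "0 \<le> t * (\<Sum>i\<in>S. l i * h i)" using t0 l(3) by simp
      then show ?thesis using w(4) unfolding ext extc by linarith
    qed
    ultimately show ?thesis by blast
  qed
qed

text \<open>For a function with finitely many values the score functional is a sum of contributions,
  one for each value, and each is linear in the corresponding row \<open>c v\<close>.\<close>

lemma score_functional_finite_sum:
  fixes c :: "real \<Rightarrow> nat \<Rightarrow> real"
  assumes T: "T \<in> \<mu> \<rightarrow>\<^sub>M fin k" and int: "integrable \<mu> f" "integrable \<mu> f'"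
    and u1: "\<And>x. x \<in> space \<mu> \<Longrightarrow> (\<integral>z. u z \<partial>Q x) = (\<Sum>v\<in>S. v * c v (T x))"
    and u2: "\<And>x. x \<in> space \<mu> \<Longrightarrow> (\<integral>z. (u z)\<^sup>2 \<partial>Q x) = (\<Sum>v\<in>S. v\<^sup>2 * c v (T x))"
  shows "score_functional \<mu> f f' Q u =
    (\<Sum>v\<in>S. 2 * v * (\<integral>x. c v (T x) * f' x \<partial>\<mu>) - v\<^sup>2 * (\<integral>x. c v (T x) * f x \<partial>\<mu>))"
proof -
  have ic: "integrable \<mu> (\<lambda>x. c v (T x) * g x)" if "integrable \<mu> g" for v g
  proof (rule integrable_mult_bounded[OF that])
    show "(\<lambda>x. c v (T x)) \<in> borel_measurable \<mu>"
      by (rule measurable_compose[OF T]) simp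
    show "\<bar>c v (T x)\<bar> \<le> Max ((\<lambda>j. \<bar>c v j\<bar>) ` {1..k})" if "x \<in> space \<mu>" for x
      using measurable_space[OF T that] by (intro Max_ge) auto
  qed
  have 1: "(\<integral>x. (\<Sum>v\<in>S. r v * c v (T x)) * g x \<partial>\<mu>) = (\<Sum>v\<in>S. r v * (\<integral>x. c v (T x) * g x \<partial>\<mu>))"
    if "integrable \<mu> g" for r g
  proof -
    have "(\<integral>x. (\<Sum>v\<in>S. r v * c v (T x)) * g x \<partial>\<mu>) = (\<integral>x. (\<Sum>v\<in>S. r v * (c v (T x) * g x)) \<partial>\<mu>)"
      by (simp add: sum_distrib_right mult.assoc)
    also have "\<dots> = (\<Sum>v\<in>S. (\<integral>x. r v * (c v (T x) * g x) \<partial>\<mu>))"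
      using ic[OF that] by (intro Bochner_Integration.integral_sum) auto
    finally show ?thesis by simp
  qed
  have "(\<integral>x. (\<integral>z. u z \<partial>Q x) * f' x \<partial>\<mu>) = (\<integral>x. (\<Sum>v\<in>S. v * c v (T x)) * f' x \<partial>\<mu>)"
    using u1 by (intro Bochner_Integration.integral_cong) auto
  moreover have "(\<integral>x. (\<integral>z. (u z)\<^sup>2 \<partial>Q x) * f x \<partial>\<mu>) = (\<integral>x. (\<Sum>v\<in>S. v\<^sup>2 * c v (T x)) * f x \<partial>\<mu>)"
    using u2 by (intro Bochner_Integration.integral_cong) auto
  ultimately show ?thesis
    unfolding score_functional_def using 1[OF int(1)] 1[OF int(2)]
    by (simp add: sum_subtractf sum_distrib_left mult.assoc)
qed

lemma score_functional_perturb: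
  assumes Q: "Q \<in> private_channels \<alpha> \<mu> N" and u: "u \<in> borel_measurable N" "u' \<in> borel_measurable N"
    and U: "\<And>z. z \<in> space N \<Longrightarrow> \<bar>u z\<bar> \<le> U" "\<And>z. z \<in> space N \<Longrightarrow> \<bar>u' z\<bar> \<le> U"
    and \<eta>: "\<And>z. z \<in> space N \<Longrightarrow> \<bar>u z - u' z\<bar> \<le> \<eta>"
    and int: "integrable \<mu> f" "integrable \<mu> f'"
  shows "score_functional \<mu> f f' Q u \<le> score_functional \<mu> f f' Q u' + 2 * \<eta> * L1_norm \<mu> f' + 2 * U * \<eta> * L1_norm \<mu> f"
proof -
  note QD = private_channelsD[OF Q]
  have d: "\<bar>(\<integral>x. (\<integral>z. a z \<partial>Q x) * g x \<partial>\<mu>) - (\<integral>x. (\<integral>z. b z \<partial>Q x) * g x \<partial>\<mu>)\<bar> \<le> D * L1_norm \<mu> g"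
    if g: "integrable \<mu> g" and a: "a \<in> borel_measurable N" "\<And>z. z \<in> space N \<Longrightarrow> \<bar>a z\<bar> \<le> B"
      and b: "b \<in> borel_measurable N" "\<And>z. z \<in> space N \<Longrightarrow> \<bar>b z\<bar> \<le> B"
      and D: "\<And>z. z \<in> space N \<Longrightarrow> \<bar>a z - b z\<bar> \<le> D" for a b g B D
  proof -
    note ka = kernel_integral_bounded[OF QD(1) a] and kb = kernel_integral_bounded[OF QD(1) b]
    have ab: "(\<lambda>z. a z - b z) \<in> borel_measurable N" using a(1) b(1) by measurable
    note kab = kernel_integral_bounded[OF QD(1) ab D]
    have "(\<integral>x. (\<integral>z. a z \<partial>Q x) * g x \<partial>\<mu>) - (\<integral>x. (\<integral>z. b z \<partial>Q x) * g x \<partial>\<mu>)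
      = (\<integral>x. (\<integral>z. a z \<partial>Q x) * g x - (\<integral>z. b z \<partial>Q x) * g x \<partial>\<mu>)"
      by (rule Bochner_Integration.integral_diff[symmetric, OF integrable_mult_bounded[OF g ka(1,3)] integrable_mult_bounded[OF g kb(1,3)]])
    also have "\<dots> = (\<integral>x. (\<integral>z. a z - b z \<partial>Q x) * g x \<partial>\<mu>)"
      using ka(2) kb(2) by (intro Bochner_Integration.integral_cong) (auto simp: left_diff_distrib)
    also have "\<bar>\<dots>\<bar> \<le> D * L1_norm \<mu> g"
      unfolding L1_norm_def by (rule abs_integral_mult_le[OF g kab(1,3)])
    finally show ?thesis .
  qed
  have sq: "\<bar>(u z)\<^sup>2 - (u' z)\<^sup>2\<bar> \<le> 2 * U * \<eta>" if "z \<in> space N" for z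
  proof -
    have "\<bar>(u z)\<^sup>2 - (u' z)\<^sup>2\<bar> = \<bar>u z + u' z\<bar> * \<bar>u z - u' z\<bar>"
      by (simp add: abs_mult[symmetric] power2_eq_square algebra_simps)
    also have "\<dots> \<le> (2 * U) * \<eta>"
      using U[OF that] \<eta>[OF that] by (intro mult_mono) auto
    finally show ?thesis .
  qed
  show ?thesis
    using d[OF int(2) u(1) U(1) u(2) U(2) \<eta>]
      d[OF int(1) bounded_measurable_square[OF u(1) U(1)] bounded_measurable_square[OF u(2) U(2)] sq]
    unfolding score_functional_def by linarith
qed

lemma finite_valued_approximation:
  fixes u :: "'a \<Rightarrow> real"
  assumes u: "u \<in> borel_measurable N" and U: "\<And>z. \<bar>u z\<bar> \<le> U" and \<eta>: "0 < \<eta>"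
  obtains u' where "u' \<in> borel_measurable N" "\<And>z. \<bar>u' z\<bar> \<le> U" "\<And>z. \<bar>u z - u' z\<bar> \<le> \<eta>" "finite (range u')"
proof
  \<comment> \<open>Rounding down to a multiple of \<open>\<eta>\<close> does not exceed \<open>U\<close>; the maximum restores the bound \<open>- U\<close>.\<close>
  define u' where "u' z = max (- U) (\<eta> * of_int \<lfloor>u z / \<eta>\<rfloor>)" for z
  show "u' \<in> borel_measurable N" unfolding u'_def using u by measurable
  have fl: "\<eta> * of_int \<lfloor>u z / \<eta>\<rfloor> \<le> u z" "u z \<le> \<eta> * of_int \<lfloor>u z / \<eta>\<rfloor> + \<eta>" for z
  proof -
    show "\<eta> * of_int \<lfloor>u z / \<eta>\<rfloor> \<le> u z"
      using floor_divide_lower[OF \<eta>, of "u z"] by (simp add: mult.commute)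
    show "u z \<le> \<eta> * of_int \<lfloor>u z / \<eta>\<rfloor> + \<eta>"
      using floor_divide_upper[OF \<eta>, of "u z"] by (simp add: algebra_simps)
  qed
  show "\<bar>u' z\<bar> \<le> U" for z
    using U[of z] fl(1)[of z] unfolding u'_def by (auto simp: max_def)
  show "\<bar>u z - u' z\<bar> \<le> \<eta>" for z
    using U[of z] fl[of z] unfolding u'_def by (auto simp: max_def)
  have "range u' \<subseteq> (\<lambda>i::int. max (- U) (\<eta> * of_int i)) ` {\<lfloor>- U / \<eta>\<rfloor>..\<lfloor>U / \<eta>\<rfloor>}"
  proof
    fix v assume "v \<in> range u'"
    then obtain z where v: "v = u' z" by blast
    have "- U / \<eta> \<le> u z / \<eta>" "u z / \<eta> \<le> U / \<eta>"
      using U[of z] \<eta> by (intro divide_right_mono; simp)+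
    then have "\<lfloor>u z / \<eta>\<rfloor> \<in> {\<lfloor>- U / \<eta>\<rfloor>..\<lfloor>U / \<eta>\<rfloor>}" by (auto intro: floor_mono)
    then show "v \<in> (\<lambda>i::int. max (- U) (\<eta> * of_int i)) ` {\<lfloor>- U / \<eta>\<rfloor>..\<lfloor>U / \<eta>\<rfloor>}"
      unfolding v u'_def by blast
  qed
  then show "finite (range u')" by (rule finite_subset) auto
qed

lemma (in prob_space) integral_finite_valued:
  fixes u :: "'a \<Rightarrow> real" and f :: "real \<Rightarrow> real"
  assumes u: "u \<in> borel_measurable M" and V: "finite V" "u ` space M \<subseteq> V"
  shows "(\<integral>z. f (u z) \<partial>M) = (\<Sum>v\<in>V. f v * measure M {z \<in> space M. u z = v})"
proof -
  have meas: "{z \<in> space M. u z = v} \<in> sets M" for v using u by measurable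
  have "(\<integral>z. f (u z) \<partial>M) = (\<integral>z. (\<Sum>v\<in>V. f v * indicator {z \<in> space M. u z = v} z) \<partial>M)"
  proof (intro Bochner_Integration.integral_cong refl)
    fix z assume z: "z \<in> space M"
    then have "(\<Sum>v\<in>V. f v * indicator {z \<in> space M. u z = v} z) = (\<Sum>v\<in>V. if v = u z then f v else 0)"
      by (intro sum.cong) (auto simp: indicator_def)
    then show "f (u z) = (\<Sum>v\<in>V. f v * indicator {z \<in> space M. u z = v} z)"
      using V z by auto
  qed
  also have "\<dots> = (\<Sum>v\<in>V. (\<integral>z. f v * indicator {z \<in> space M. u z = v} z \<partial>M))"
    using meas by (intro Bochner_Integration.integral_sum integrable_mult_right integrable_real_indicator) (auto simp: less_top[symmetric])
  finally show ?thesis using meas by simp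
qed

text \<open>After rounding the optimal test function to finitely many values, an output symbol can be
  identified with its value \<open>v\<close>, and the channel with a matrix of rows \<open>q v\<close>. The privacy constraint
  is invariant under scaling of a row, the remaining constraint fixes the \<open>k\<close> column sums, and
  with \<open>v\<close> attached to its row the objective is linear in the row. So a basic solution with at
  most \<open>k\<close> rows is at least as good.\<close>

lemma output_reduction:
  assumes mod: "dominated_model \<mu> \<Theta> P p" and dqm: "DQM_at \<mu> \<Theta> p \<theta> s" and th: "\<theta> \<in> \<Theta>"
    and Q: "Q \<in> private_channels \<alpha> (fin k) N" and k: "1 \<le> k" and T: "T \<in> \<mu> \<rightarrow>\<^sub>M fin k" and \<delta>: "0 < \<delta>"
  obtains A where "A \<in> private_matrices \<alpha> k k"
    "fisher_information \<Theta> (image_model (\<lambda>x. Q (T x)) P) \<theta>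
      \<le> fisher_information \<Theta> (image_model (\<lambda>x. matrix_channel k A (T x)) P) \<theta> + \<delta>"
proof -
  let ?d = "\<lambda>x. s x * p \<theta> x"
  note ints = dominated_modelD(7)[OF mod th] DQM_pdot_integrable(1)[OF mod dqm th]
  note QD = private_channelsD[OF Q]
  have QT: "(\<lambda>x. Q (T x)) \<in> private_channels \<alpha> \<mu> N" by (rule private_channel_compose[OF Q T])
  define U where "U = exp \<alpha> * L1_norm \<mu> ?d"
  have U0: "0 \<le> U" unfolding U_def using L1_norm_nonneg[of \<mu> ?d] by simp
  obtain u0 where u0: "u0 \<in> borel_measurable N" "\<And>z. \<bar>u0 z\<bar> \<le> U"
    "score_functional \<mu> (p \<theta>) ?d (\<lambda>x. Q (T x)) u0 = fisher_information \<Theta> (image_model (\<lambda>x. Q (T x)) P) \<theta>"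
    using score_functional_attained[OF mod dqm th QT] unfolding U_def by blast
  define c where "c = 2 * L1_norm \<mu> ?d + 2 * U * L1_norm \<mu> (p \<theta>) + 1"
  have c: "0 < c" unfolding c_def using L1_norm_nonneg[of \<mu> ?d] L1_norm_nonneg[of \<mu> "p \<theta>"] U0
    by (intro add_nonneg_pos add_nonneg_nonneg mult_nonneg_nonneg) auto
  define \<eta> where "\<eta> = \<delta> / c"
  have \<eta>: "0 < \<eta>" unfolding \<eta>_def using c \<delta> by simp
  obtain u where u: "u \<in> borel_measurable N" "\<And>z. \<bar>u z\<bar> \<le> U" "\<And>z. \<bar>u0 z - u z\<bar> \<le> \<eta>" "finite (range u)"
    by (rule finite_valued_approximation[OF u0(1,2) \<eta>], rule that)
  have "2 * \<eta> * L1_norm \<mu> ?d + 2 * U * \<eta> * L1_norm \<mu> (p \<theta>) = \<eta> * (c - 1)"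
    by (simp add: c_def algebra_simps)
  also have "\<dots> \<le> \<delta>" using \<eta> c by (simp add: \<eta>_def field_simps)
  finally have "2 * \<eta> * L1_norm \<mu> ?d + 2 * U * \<eta> * L1_norm \<mu> (p \<theta>) \<le> \<delta>" .
  with score_functional_perturb[OF QT u0(1) u(1) u0(2) u(2,3) ints]
  have step1: "fisher_information \<Theta> (image_model (\<lambda>x. Q (T x)) P) \<theta> \<le> score_functional \<mu> (p \<theta>) ?d (\<lambda>x. Q (T x)) u + \<delta>"
    unfolding u0(3) by linarith
  define q where "q v j = measure (Q j) {z \<in> space N. u z = v}" for v j
  have lev: "{z \<in> space N. u z = v} \<in> sets N" for v using u(1) by measurable
  have qp: "q v j \<le> exp \<alpha> * q v j'" if "j \<in> {1..k}" "j' \<in> {1..k}" for v j j'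
    unfolding q_def using that QD(6)[OF lev] by simp
  have q0: "0 \<le> q v j" for v j by (simp add: q_def)
  \<comment> \<open>By privacy a row is either positive in all columns or zero. The zero rows are dropped.\<close>
  define V where "V = {v \<in> range u. 0 < q v 1}"
  have finV: "finite V" unfolding V_def using u(4) by simp
  have k1: "1 \<in> {1..k}" using k by simp
  have qV: "0 < q v j" if "v \<in> V" "j \<in> {1..k}" for v j
  proof -
    have "0 < exp \<alpha> * q v j" using that qp[OF k1 that(2), of v] by (simp add: V_def)
    then show ?thesis by (simp add: zero_less_mult_iff)
  qed
  have qnV: "q v j = 0" if "v \<in> range u - V" "j \<in> {1..k}" for v j
  proof -
    have "q v 1 = 0" using that q0[of v 1] by (auto simp: V_def)
    then show ?thesis using qp[OF that(2) k1, of v] q0[of v j] by simp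
  qed
  have intQ: "(\<integral>z. f (u z) \<partial>Q j) = (\<Sum>v\<in>V. f v * q v j)" if j: "j \<in> {1..k}" for f :: "real \<Rightarrow> real" and j
  proof -
    have j': "j \<in> space (fin k)" using j by simp
    interpret Qj: prob_space "Q j" by (rule QD(3)[OF j'])
    have um: "u \<in> borel_measurable (Q j)"
      using u(1) measurable_cong_sets[OF QD(4)[OF j'] refl] by blast
    have "(\<integral>z. f (u z) \<partial>Q j) = (\<Sum>v\<in>range u. f v * q v j)"
      unfolding q_def QD(5)[OF j', symmetric] using u(4) by (intro Qj.integral_finite_valued um) auto
    also have "\<dots> = (\<Sum>v\<in>V. f v * q v j)"
      using u(4) qnV j by (intro sum.mono_neutral_right) (auto simp: V_def)
    finally show ?thesis .
  qed
  have qsum: "(\<Sum>v\<in>V. q v j) = 1" if j: "j \<in> {1..k}" for j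
    using intQ[OF j, of "\<lambda>_. 1"] prob_space.prob_space[OF QD(3), of j] j by simp
  define h where "h v = 2 * v * (\<integral>x. q v (T x) * ?d x \<partial>\<mu>) - v\<^sup>2 * (\<integral>x. q v (T x) * p \<theta> x \<partial>\<mu>)" for v
  have Tx: "T x \<in> {1..k}" if "x \<in> space \<mu>" for x using measurable_space[OF T that] by simp
  have JQ: "score_functional \<mu> (p \<theta>) ?d (\<lambda>x. Q (T x)) u = (\<Sum>v\<in>V. h v)"
    unfolding h_def using intQ[OF Tx, where f="\<lambda>t. t"] intQ[OF Tx, where f="\<lambda>t. t\<^sup>2"]
    by (intro score_functional_finite_sum[OF T ints]) auto
  obtain w where w: "\<forall>v. 0 \<le> w v" "card {v\<in>V. w v \<noteq> 0} \<le> card {1..k}"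
     "\<forall>j\<in>{1..k}. (\<Sum>v\<in>V. w v * q v j) = (\<Sum>v\<in>V. q v j)" "(\<Sum>v\<in>V. h v) \<le> (\<Sum>v\<in>V. w v * h v)"
    using basic_solution[of "{1..k}" V q h] finV qV k by auto
  define S where "S = {v\<in>V. w v \<noteq> 0}"
  have finS: "finite S" unfolding S_def using finV by simp
  obtain e where e: "inj_on e S" "e ` S \<subseteq> {1..k}"
    using card_le_inj[OF finS, of "{1..k}"] w(2) unfolding S_def by auto
  define r where "r = inv_into S e"
  have re: "r (e v) = v" if "v \<in> S" for v unfolding r_def using inv_into_f_f[OF e(1) that] .
  \<comment> \<open>Row \<open>i\<close> carries the value \<open>r i\<close>; indices outside \<open>e ` S\<close> belong to symbols that never occur.\<close>
  define A where "A i j = (if i \<in> e ` S then w (r i) * q (r i) j else 0)" for i j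
  have sumA: "(\<Sum>i=1..k. f (r i) * A i j) = (\<Sum>v\<in>V. f v * (w v * q v j))" for f :: "real \<Rightarrow> real" and j
  proof -
    have "(\<Sum>i=1..k. f (r i) * A i j) = (\<Sum>i\<in>e ` S. f (r i) * (w (r i) * q (r i) j))"
      using e(2) by (intro sum.mono_neutral_cong_right) (auto simp: A_def)
    also have "\<dots> = (\<Sum>v\<in>S. f v * (w v * q v j))"
      unfolding sum.reindex[OF e(1)] using re by (intro sum.cong) auto
    also have "\<dots> = (\<Sum>v\<in>V. f v * (w v * q v j))"
      using finV by (intro sum.mono_neutral_left) (auto simp: S_def)
    finally show ?thesis .
  qed
  have A: "A \<in> private_matrices \<alpha> k k"
    unfolding private_matrices_def
  proof (intro CollectI conjI ballI)
    show "0 \<le> A i j" for i j using w(1) q0 by (simp add: A_def)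
    show "(\<Sum>i=1..k. A i j) = 1" if j: "j \<in> {1..k}" for j
      using sumA[of "\<lambda>_. 1" j] w(3) qsum[OF j] j by simp
    fix i j j' assume j: "j \<in> {1..k}" "j' \<in> {1..k}"
    have le: "A i j \<le> exp \<alpha> * A i j'" if "j \<in> {1..k}" "j' \<in> {1..k}" for j j'
      using mult_left_mono[OF qp[OF that], of "w (r i)" "r i"] w(1) by (simp add: A_def mult_ac)
    show "A i j \<le> exp \<alpha> * A i j'" by (rule le[OF j])
    show "exp (- \<alpha>) * A i j' \<le> A i j" using le[OF j(2,1)] by (simp add: exp_minus field_simps)
  qed
  have AT: "(\<lambda>x. matrix_channel k A (T x)) \<in> private_channels \<alpha> \<mu> (fin k)"
    by (rule private_channel_compose[OF matrix_channel_private[OF A] T])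
  have intA: "(\<integral>i. f (r i) \<partial>matrix_channel k A j) = (\<Sum>v\<in>V. f v * (w v * q v j))" for f :: "real \<Rightarrow> real" and j
  proof -
    have "(\<integral>i. f (r i) \<partial>matrix_channel k A j) = (\<Sum>i=1..k. f (r i) * A i j)"
      unfolding matrix_channel_def using w(1) q0
      by (subst lebesgue_integral_point_measure_finite) (auto simp: A_def mult.commute)
    then show ?thesis using sumA by simp
  qed
  have "score_functional \<mu> (p \<theta>) ?d (\<lambda>x. matrix_channel k A (T x)) r
    = (\<Sum>v\<in>V. 2 * v * (\<integral>x. w v * q v (T x) * ?d x \<partial>\<mu>) - v\<^sup>2 * (\<integral>x. w v * q v (T x) * p \<theta> x \<partial>\<mu>))"
    using intA[where f="\<lambda>t. t"] intA[where f="\<lambda>t. t\<^sup>2"]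
    by (intro score_functional_finite_sum[OF T ints, where c="\<lambda>v j. w v * q v j"]) auto
  also have "\<dots> = (\<Sum>v\<in>V. w v * h v)"
  proof -
    have "(\<integral>x. w v * q v (T x) * g x \<partial>\<mu>) = w v * (\<integral>x. q v (T x) * g x \<partial>\<mu>)" for v g
      by (simp add: mult.assoc)
    note scale = this
    show ?thesis unfolding scale h_def by (intro sum.cong refl) (simp only: right_diff_distrib mult.left_commute)
  qed
  finally have JA: "score_functional \<mu> (p \<theta>) ?d (\<lambda>x. matrix_channel k A (T x)) r = (\<Sum>v\<in>V. w v * h v)" .
  have "\<bar>r i\<bar> \<le> Max ((\<lambda>i. \<bar>r i\<bar>) ` {1..k})" if "i \<in> {1..k}" for i
    using that by (intro Max_ge) auto
  then have "r \<in> bounded_measurable (fin k)"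
    by (intro bounded_measurableI[of _ _ "Max ((\<lambda>i. \<bar>r i\<bar>) ` {1..k})"]) simp_all
  then have "(\<Sum>v\<in>V. w v * h v) \<le> fisher_information \<Theta> (image_model (\<lambda>x. matrix_channel k A (T x)) P) \<theta>"
    using score_functional_le[OF mod dqm th AT] JA by metis
  then show ?thesis using that[OF A] step1 JQ w(4) by linarith
qed

section \<open>Quantization of the input space\<close>

lemma integral_uniform_measure:
  assumes "A \<in> sets M" "0 < emeasure M A" "emeasure M A < \<infinity>" and [measurable]: "w \<in> borel_measurable M"
  shows "(\<integral>x. w x \<partial>uniform_measure M A) = (\<integral>x. indicator A x * w x \<partial>M) / measure M A"
proof -
  have m: "emeasure M A = ennreal (measure M A)" "0 < measure M A"
    using assms(2,3) emeasure_eq_ennreal_measure[of M A] by (auto simp: measure_def enn2real_positive_iff)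
  have "uniform_measure M A = density M (\<lambda>x. ennreal (indicator A x / measure M A))"
    unfolding uniform_measure_def m(1)
  proof (intro density_cong AE_I2)
    have "1 / ennreal (measure M A) = ennreal (1 / measure M A)"
      using divide_ennreal[of 1 "measure M A"] m(2) by simp
    then show "indicator A x / ennreal (measure M A) = ennreal (indicator A x / measure M A)" for x
      by (cases "x \<in> A") auto
  qed (use assms(1) in auto)
  then have "(\<integral>x. w x \<partial>uniform_measure M A) = (\<integral>x. indicator A x / measure M A * w x \<partial>M)"
    using assms(1) by (simp only:) (intro integral_real_density; auto)
  then show ?thesis by simp
qed

text \<open>Outside the good cells any input distribution serves, since these cells only enter through their
  total probability; the choice is a point mass.\<close>

definition cell_sampler :: "'x measure \<Rightarrow> 'x set \<Rightarrow> 'x measure" where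
  "cell_sampler \<mu> A = (if 0 < emeasure \<mu> A \<and> emeasure \<mu> A < \<infinity> then uniform_measure \<mu> A
     else return \<mu> (SOME x. x \<in> space \<mu>))"

lemma cell_sampler_prob:
  assumes "space \<mu> \<noteq> {}"
  shows "prob_space (cell_sampler \<mu> A)" "sets (cell_sampler \<mu> A) = sets \<mu>"
proof -
  have "(SOME x. x \<in> space \<mu>) \<in> space \<mu>" using assms by (simp add: some_in_eq)
  then show "prob_space (cell_sampler \<mu> A)"
    by (auto simp: cell_sampler_def intro!: prob_space_uniform_measure prob_space_return)
  show "sets (cell_sampler \<mu> A) = sets \<mu>" by (simp add: cell_sampler_def)
qed

text \<open>On the good cells, replacing \<open>w\<close> by its cell averages has the same effect on \<open>\<integral>w f\<close> as replacing
  \<open>f\<close> by its cell averages. Hence only the oscillation of \<open>f\<close> matters.\<close>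

lemma cell_average_error:
  fixes \<mu> :: "'x measure" and T :: "nat \<Rightarrow> 'x \<Rightarrow> real \<Rightarrow> nat" and k :: "nat \<Rightarrow> real \<Rightarrow> nat"
    and m :: nat and \<theta> :: real
  defines "K \<equiv> good_region \<mu> T k m \<theta>"
  assumes ne: "space \<mu> \<noteq> {}" and T: "(\<lambda>x. T m x \<theta>) \<in> \<mu> \<rightarrow>\<^sub>M fin (k m \<theta>)"
    and f: "integrable \<mu> f" and w: "w \<in> borel_measurable \<mu>" and W: "\<And>x. x \<in> space \<mu> \<Longrightarrow> \<bar>w x\<bar> \<le> W"
  shows "\<bar>(\<integral>x. w x * f x \<partial>\<mu>) - (\<integral>x. (\<integral>y. w y \<partial>cell_sampler \<mu> (cell \<mu> T m \<theta> (T m x \<theta>))) * f x \<partial>\<mu>)\<bar>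
    \<le> W * L1_norm \<mu> (\<lambda>x. (f x - cell_average \<mu> T k m \<theta> f x) * indicator K x)
      + 2 * W * (\<integral>x. \<bar>indicator (space \<mu> - K) x * f x\<bar> \<partial>\<mu>)"
proof -
  let ?J = "good_cells \<mu> T k m \<theta>" and ?B = "cell \<mu> T m \<theta>"
  define a where "a j = (\<integral>y. w y \<partial>cell_sampler \<mu> (?B j))" for j
  have finJ: "finite ?J" by (simp add: good_cells_def)
  have B: "?B j \<in> sets \<mu>" for j
  proof -
    have "(\<lambda>x. T m x \<theta>) -` ({j} \<inter> {1..k m \<theta>}) \<inter> space \<mu> \<in> sets \<mu>"
      by (rule measurable_sets[OF T]) auto
    moreover have "(\<lambda>x. T m x \<theta>) -` ({j} \<inter> {1..k m \<theta>}) \<inter> space \<mu> = ?B j \<or> ?B j = {}"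
      using measurable_space[OF T] by (auto simp: cell_def)
    ultimately show ?thesis by auto
  qed
  have K: "K \<in> sets \<mu>" unfolding K_def good_region_def using finJ B by (intro sets.finite_UN) auto
  have indK: "indicator K x = (\<Sum>j\<in>?J. indicator (?B j) x :: real)" for x
    unfolding K_def good_region_def using finJ
    by (intro indicator_UN_disjoint) (auto simp: disjoint_family_on_def cell_def)
  have W0: "0 \<le> W"
  proof -
    obtain x where "x \<in> space \<mu>" using ne by blast
    from W[OF this] show ?thesis by linarith
  qed
  have aW: "\<bar>a j\<bar> \<le> W" for j
  proof -
    interpret prob_space "cell_sampler \<mu> (?B j)" by (rule cell_sampler_prob(1)[OF ne])
    note sets = cell_sampler_prob(2)[OF ne, of "?B j"]
    have wm: "w \<in> borel_measurable (cell_sampler \<mu> (?B j))" using w measurable_cong_sets[OF sets refl] by blast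
    have sp: "space (cell_sampler \<mu> (?B j)) = space \<mu>" using sets by (rule sets_eq_imp_space_eq)
    have int: "integrable (cell_sampler \<mu> (?B j)) w"
      using W sp wm by (intro integrable_const_bound[of _ W]) auto
    have "\<bar>a j\<bar> \<le> (\<integral>y. \<bar>w y\<bar> \<partial>cell_sampler \<mu> (?B j))"
      unfolding a_def using integral_norm_bound[of "cell_sampler \<mu> (?B j)" w] by simp
    also have "\<dots> \<le> W" using int W sp by (intro integral_le_const) auto
    finally show ?thesis .
  qed
  define aT where "aT x = a (T m x \<theta>)" for x
  have aTm: "aT \<in> borel_measurable \<mu>" unfolding aT_def by (rule measurable_compose[OF T]) simp
  have indm: "(indicator A :: 'x \<Rightarrow> real) \<in> borel_measurable \<mu>" if "A \<in> sets \<mu>" for A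
    using that by simp
  have If: "integrable \<mu> (\<lambda>x. indicator A x * f x)" if "A \<in> sets \<mu>" for A
    using integrable_real_mult_indicator[OF that f] by (simp add: mult.commute)
  have wf: "integrable \<mu> (\<lambda>x. w x * (indicator A x * f x))" if "A \<in> sets \<mu>" for A
    by (rule integrable_mult_bounded[OF If[OF that] w W])
  have af: "integrable \<mu> (\<lambda>x. aT x * (indicator A x * f x))" if "A \<in> sets \<mu>" for A
    by (rule integrable_mult_bounded[OF If[OF that] aTm, of W]) (use aW in \<open>simp add: aT_def\<close>)
  define c where "c j = (LINT y:?B j|\<mu>. f y) / measure \<mu> (?B j)" for j
  have avg: "cell_average \<mu> T k m \<theta> f x = (\<Sum>j\<in>?J. c j * indicator (?B j) x)" for x
    by (simp add: cell_average_def c_def)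
  have avgK: "cell_average \<mu> T k m \<theta> f x * indicator K x = cell_average \<mu> T k m \<theta> f x" for x
  proof (cases "x \<in> K")
    case False
    then have "\<forall>j\<in>?J. x \<notin> ?B j" by (auto simp: K_def good_region_def)
    then have "cell_average \<mu> T k m \<theta> f x = 0" unfolding avg by (intro sum.neutral) auto
    then show ?thesis by simp
  qed simp
  have finB: "emeasure \<mu> (?B j) < \<infinity>" "0 < emeasure \<mu> (?B j)" if "j \<in> ?J" for j
    using that by (auto simp: good_cells_def)
  have iB: "integrable \<mu> (indicator (?B j) :: 'x \<Rightarrow> real)" if "j \<in> ?J" for j
    by (rule integrable_real_indicator[OF B finB(1)[OF that]])
  have avg_int: "integrable \<mu> (cell_average \<mu> T k m \<theta> f)"
    unfolding avg[abs_def] using iB by (intro Bochner_Integration.integrable_sum integrable_mult_right) auto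
  have aj: "a j = (\<integral>x. w x * indicator (?B j) x \<partial>\<mu>) / measure \<mu> (?B j)" if "j \<in> ?J" for j
    unfolding a_def cell_sampler_def using finB[OF that] integral_uniform_measure[OF B finB(2)[OF that] finB(1)[OF that] w]
    by (simp add: mult.commute)
  have eq: "(\<integral>x. aT x * (indicator K x * f x) \<partial>\<mu>) = (\<integral>x. w x * cell_average \<mu> T k m \<theta> f x \<partial>\<mu>)"
  proof -
    have "(\<integral>x. aT x * (indicator K x * f x) \<partial>\<mu>) = (\<integral>x. (\<Sum>j\<in>?J. a j * (indicator (?B j) x * f x)) \<partial>\<mu>)"
    proof (intro Bochner_Integration.integral_cong refl)
      fix x
      have "aT x * indicator (?B j) x = a j * indicator (?B j) x" for j
        by (auto simp: aT_def cell_def indicator_def)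
      then have "aT x * (indicator (?B j) x * f x) = a j * (indicator (?B j) x * f x)" for j
        by (metis mult.assoc)
      then show "aT x * (indicator K x * f x) = (\<Sum>j\<in>?J. a j * (indicator (?B j) x * f x))"
        unfolding indK sum_distrib_right sum_distrib_left by (rule sum.cong[OF refl])
    qed
    also have "\<dots> = (\<Sum>j\<in>?J. a j * (\<integral>x. indicator (?B j) x * f x \<partial>\<mu>))"
      using If[OF B] by (subst Bochner_Integration.integral_sum) auto
    also have "\<dots> = (\<Sum>j\<in>?J. c j * (\<integral>x. w x * indicator (?B j) x \<partial>\<mu>))"
      by (intro sum.cong refl) (simp add: aj c_def set_lebesgue_integral_def)
    also have "\<dots> = (\<integral>x. (\<Sum>j\<in>?J. c j * (w x * indicator (?B j) x)) \<partial>\<mu>)"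
      using integrable_mult_bounded[OF iB w W] by (subst Bochner_Integration.integral_sum) auto
    also have "\<dots> = (\<integral>x. w x * cell_average \<mu> T k m \<theta> f x \<partial>\<mu>)"
      unfolding avg by (simp add: sum_distrib_left mult_ac)
    finally show ?thesis .
  qed
  have wavg: "integrable \<mu> (\<lambda>x. w x * cell_average \<mu> T k m \<theta> f x)"
    by (rule integrable_mult_bounded[OF avg_int w W])
  have Kc: "space \<mu> - K \<in> sets \<mu>" using K by auto
  have split: "(\<integral>x. v x * f x \<partial>\<mu>) = (\<integral>x. v x * (indicator K x * f x) \<partial>\<mu>) + (\<integral>x. v x * (indicator (space \<mu> - K) x * f x) \<partial>\<mu>)"
    if "\<And>A. A \<in> sets \<mu> \<Longrightarrow> integrable \<mu> (\<lambda>x. v x * (indicator A x * f x))" for v :: "'x \<Rightarrow> real"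
    unfolding Bochner_Integration.integral_add[OF that[OF K] that[OF Kc], symmetric]
    by (intro Bochner_Integration.integral_cong) (auto simp: indicator_def)
  have "(\<integral>x. w x * (indicator K x * f x) \<partial>\<mu>) - (\<integral>x. w x * cell_average \<mu> T k m \<theta> f x \<partial>\<mu>)
    = (\<integral>x. w x * ((f x - cell_average \<mu> T k m \<theta> f x) * indicator K x) \<partial>\<mu>)"
    unfolding Bochner_Integration.integral_diff[OF wf[OF K] wavg, symmetric]
  proof (intro Bochner_Integration.integral_cong refl)
    fix x
    have "(f x - cell_average \<mu> T k m \<theta> f x) * indicator K x = indicator K x * f x - cell_average \<mu> T k m \<theta> f x"
      unfolding left_diff_distrib avgK by simp
    then show "w x * (indicator K x * f x) - w x * cell_average \<mu> T k m \<theta> f x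
        = w x * ((f x - cell_average \<mu> T k m \<theta> f x) * indicator K x)"
      by (simp only: right_diff_distrib)
  qed
  also have "\<bar>\<dots>\<bar> \<le> W * L1_norm \<mu> (\<lambda>x. (f x - cell_average \<mu> T k m \<theta> f x) * indicator K x)"
    unfolding L1_norm_def using f avg_int K W w
    by (intro abs_integral_mult_le integrable_real_mult_indicator Bochner_Integration.integrable_diff)
  finally have 1: "\<bar>(\<integral>x. w x * (indicator K x * f x) \<partial>\<mu>) - (\<integral>x. aT x * (indicator K x * f x) \<partial>\<mu>)\<bar>
     \<le> W * L1_norm \<mu> (\<lambda>x. (f x - cell_average \<mu> T k m \<theta> f x) * indicator K x)"
    unfolding eq .
  have 2: "\<bar>\<integral>x. w x * (indicator (space \<mu> - K) x * f x) \<partial>\<mu>\<bar> \<le> W * (\<integral>x. \<bar>indicator (space \<mu> - K) x * f x\<bar> \<partial>\<mu>)"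
    by (rule abs_integral_mult_le[OF If[OF Kc] w W])
  have 3: "\<bar>\<integral>x. aT x * (indicator (space \<mu> - K) x * f x) \<partial>\<mu>\<bar> \<le> W * (\<integral>x. \<bar>indicator (space \<mu> - K) x * f x\<bar> \<partial>\<mu>)"
    by (rule abs_integral_mult_le[OF If[OF Kc] aTm]) (use aW in \<open>simp add: aT_def\<close>)
  show ?thesis
    using 1 2 3 split[OF wf] split[OF af] unfolding aT_def a_def by linarith
qed

text \<open>The quantized channel, given the cell of \<open>x\<close>, draws a new input uniformly from this cell and
  applies \<open>Q\<close> to it. It is private as a mixture of rows of \<open>Q\<close>, and the optimal test function of
  \<open>Q\<close> shows that it loses at most a multiple of the quantization error.\<close>

lemma input_quantization:
  fixes T :: "nat \<Rightarrow> 'x \<Rightarrow> real \<Rightarrow> nat" and k :: "nat \<Rightarrow> real \<Rightarrow> nat"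
  assumes reg: "regular_model \<mu> \<Theta> P p s" and th: "\<theta> \<in> \<Theta>"
    and T: "(\<lambda>x. T m x \<theta>) \<in> \<mu> \<rightarrow>\<^sub>M fin (k m \<theta>)" and Q: "Q \<in> private_channels \<alpha> \<mu> N"
  obtains Q' where "Q' \<in> private_channels \<alpha> (fin (k m \<theta>)) N"
    "fisher_information \<Theta> (image_model Q P) \<theta> \<le> fisher_information \<Theta> (image_model (\<lambda>x. Q' (T m x \<theta>)) P) \<theta>
      + (4 * exp \<alpha> + 2 * exp (2 * \<alpha>)) * max 1 (fisher_information \<Theta> P \<theta>) * quantization_error \<mu> P p s T k m \<theta>"
proof -
  note mod = regular_modelD(1)[OF reg] and dqm = regular_modelD(2)[OF reg th]
  let ?d = "\<lambda>x. s \<theta> x * p \<theta> x" and ?B = "cell \<mu> T m \<theta>"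
  note ints = dominated_modelD(7)[OF mod th] DQM_pdot_integrable(1)[OF mod dqm th]
  note QD = private_channelsD[OF Q]
  interpret P: prob_space "P \<theta>" by (rule dominated_modelD(1)[OF mod th])
  have ne: "space \<mu> \<noteq> {}" using P.not_empty dominated_modelD(6)[OF mod th] by simp
  note cs = cell_sampler_prob[OF ne]
  define Q' where "Q' j = cell_sampler \<mu> (?B j) \<bind> Q" for j
  have Q': "Q' \<in> private_channels \<alpha> (fin (k m \<theta>)) N"
    unfolding private_channels_def
  proof (intro CollectI conjI ballI)
    show "Q' \<in> fin (k m \<theta>) \<rightarrow>\<^sub>M prob_algebra N"
      unfolding Q'_def using prob_space_bind_kernel(1,2)[OF QD(1) cs] by (auto simp: space_prob_algebra)
    fix A j j' assume "A \<in> sets N"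
    then show "measure (Q' j) A \<le> exp \<alpha> * measure (Q' j') A"
      unfolding Q'_def by (rule private_bind_le[OF Q _ cs cs])
  qed
  have Q'T: "(\<lambda>x. Q' (T m x \<theta>)) \<in> private_channels \<alpha> \<mu> N" by (rule private_channel_compose[OF Q' T])
  define I where "I = fisher_information \<Theta> P \<theta>"
  have I0: "0 \<le> I" unfolding I_def by (rule fisher_information_nonneg)
  define U where "U = exp \<alpha> * sqrt I"
  have U0: "0 \<le> U" unfolding U_def using I0 by simp
  obtain u where u: "u \<in> borel_measurable N" "\<forall>z. \<bar>u z\<bar> \<le> exp \<alpha> * L1_norm \<mu> ?d"
    "score_functional \<mu> (p \<theta>) ?d Q u = fisher_information \<Theta> (image_model Q P) \<theta>"
    using score_functional_attained[OF mod dqm th Q] by blast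
  have "exp \<alpha> * L1_norm \<mu> ?d \<le> U"
    unfolding U_def I_def using L1_norm_pdot_le[OF mod dqm th] by (intro mult_left_mono) auto
  with u(2) have uU: "\<And>z. \<bar>u z\<bar> \<le> U" by (meson order_trans)
  have Q'int: "(\<integral>z. v z \<partial>Q' j) = (\<integral>y. (\<integral>z. v z \<partial>Q y) \<partial>cell_sampler \<mu> (?B j))"
    if v: "v \<in> borel_measurable N" "\<And>z. z \<in> space N \<Longrightarrow> \<bar>v z\<bar> \<le> V" for v :: "_ \<Rightarrow> real" and V j
  proof -
    have Qc: "Q \<in> cell_sampler \<mu> (?B j) \<rightarrow>\<^sub>M subprob_algebra N"
      using QD(2) measurable_cong_sets[OF cs(2) refl] by blast
    have AE1: "AE x in cell_sampler \<mu> (?B j). emeasure (Q x) (space (Q x)) \<le> ennreal 1"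
      using prob_space.emeasure_space_1[OF QD(3)] sets_eq_imp_space_eq[OF cs(2)] by (intro AE_I2) simp
    show ?thesis unfolding Q'_def
      by (rule integral_bind[OF v Qc prob_space.finite_measure[OF cs(1)] AE1])
  qed
  define K where "K = good_region \<mu> T k m \<theta>"
  let ?err = "\<lambda>f. L1_norm \<mu> (\<lambda>x. (f x - cell_average \<mu> T k m \<theta> f x) * indicator K x)"
  let ?out = "\<lambda>f. \<integral>x. \<bar>indicator (space \<mu> - K) x * f x\<bar> \<partial>\<mu>"
  have err: "\<bar>(\<integral>x. (\<integral>z. v z \<partial>Q x) * f x \<partial>\<mu>) - (\<integral>x. (\<integral>z. v z \<partial>Q' (T m x \<theta>)) * f x \<partial>\<mu>)\<bar> \<le> V * ?err f + 2 * V * ?out f"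
    if v: "v \<in> borel_measurable N" "\<And>z. z \<in> space N \<Longrightarrow> \<bar>v z\<bar> \<le> V" and f: "integrable \<mu> f" for v V f
  proof -
    have i: "(\<integral>z. v z \<partial>Q' j) = (\<integral>y. (\<integral>z. v z \<partial>Q y) \<partial>cell_sampler \<mu> (?B j))" for j
      by (rule Q'int[OF v])
    show ?thesis
      unfolding i K_def
      by (rule cell_average_error[where T=T and k=k and m=m and \<theta>=\<theta>, OF ne T f kernel_integral_bounded(1,3)[OF QD(1) v]])
  qed
  define r where "r = sqrt (measure (P \<theta>) (space \<mu> - K))"
  have r0: "0 \<le> r" and r1: "r \<le> 1" unfolding r_def by simp_all
  have Kc: "space \<mu> - K \<in> sets \<mu>"
  proof -
    have "?B j \<in> sets \<mu>" if "j \<in> good_cells \<mu> T k m \<theta>" for j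
      using that emeasure_neq_0_sets[of \<mu> "?B j"] by (auto simp: good_cells_def)
    then have "K \<in> sets \<mu>" unfolding K_def good_region_def
      by (intro sets.finite_UN) (auto simp: good_cells_def)
    then show ?thesis by auto
  qed
  have out_d: "?out ?d \<le> sqrt I * r"
    unfolding r_def I_def fisher_information_DQM[OF mod dqm th] by (rule DQM_pdot_integrable(2)[OF mod dqm th Kc])
  have out_p: "?out (p \<theta>) \<le> r"
  proof -
    have "?out (p \<theta>) = (\<integral>x. indicator (space \<mu> - K) x * p \<theta> x \<partial>\<mu>)"
      using dominated_modelD(3)[OF mod th] by (intro Bochner_Integration.integral_cong) (auto simp: indicator_def)
    also have "\<dots> = (\<integral>x. indicator (space \<mu> - K) x \<partial>P \<theta>)"
      using Kc by (intro integral_dominated_model(1)[OF mod th, symmetric]) simp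
    also have "\<dots> = measure (P \<theta>) (space \<mu> - K)"
      using Kc dominated_modelD(5)[OF mod th] by simp
    also have "\<dots> = r * r" unfolding r_def by simp
    also have "\<dots> \<le> 1 * r" using r0 r1 by (intro mult_right_mono) auto
    finally show ?thesis by simp
  qed
  define E1 where "E1 = ?err (p \<theta>)"
  define E2 where "E2 = ?err ?d"
  have E0: "0 \<le> E1" "0 \<le> E2" unfolding E1_def E2_def by (rule L1_norm_nonneg)+
  have qe: "quantization_error \<mu> P p s T k m \<theta> = E1 + E2 + r"
    unfolding quantization_error_def E1_def E2_def r_def K_def Let_def ..
  have i1: "U * ?out ?d \<le> exp \<alpha> * I * r"
  proof -
    have "U * ?out ?d \<le> U * (sqrt I * r)" using out_d U0 by (rule mult_left_mono)
    also have "\<dots> = exp \<alpha> * (sqrt I * sqrt I) * r" by (simp add: U_def)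
    finally show ?thesis using I0 by simp
  qed
  have U2: "U\<^sup>2 = exp (2 * \<alpha>) * I" using I0 by (simp add: U_def power_mult_distrib exp_double)
  have i2: "U\<^sup>2 * ?out (p \<theta>) \<le> exp (2 * \<alpha>) * I * r"
    unfolding U2 using out_p I0 by (intro mult_left_mono) auto
  let ?C = "4 * exp \<alpha> + 2 * exp (2 * \<alpha>)" and ?M = "max 1 I"
  have sI: "sqrt I \<le> ?M" using sqrt_le_max_1[OF I0] by (simp add: max.commute)
  have "2 * (U * E2 + 2 * U * ?out ?d) + (U\<^sup>2 * E1 + 2 * U\<^sup>2 * ?out (p \<theta>))
     \<le> 2 * exp \<alpha> * sqrt I * E2 + 4 * (exp \<alpha> * I * r) + (exp (2 * \<alpha>) * I * E1 + 2 * (exp (2 * \<alpha>) * I * r))"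
    using i1 i2 by (simp add: U_def[symmetric] U2[symmetric] mult.assoc)
  also have "\<dots> = (2 * exp \<alpha>) * sqrt I * E2 + (exp (2 * \<alpha>)) * I * E1 + ?C * I * r"
    by (simp add: algebra_simps)
  also have "\<dots> \<le> ?C * ?M * E2 + ?C * ?M * E1 + ?C * ?M * r"
    using sI I0 E0 r0 by (intro add_mono mult_mono) auto
  also have "\<dots> = ?C * ?M * (E1 + E2 + r)" by (simp add: distrib_left)
  finally have fin: "2 * (U * E2 + 2 * U * ?out ?d) + (U\<^sup>2 * E1 + 2 * U\<^sup>2 * ?out (p \<theta>)) \<le> ?C * ?M * quantization_error \<mu> P p s T k m \<theta>"
    unfolding qe .
  have sq_err: "\<bar>(\<integral>x. (\<integral>z. (u z)\<^sup>2 \<partial>Q x) * p \<theta> x \<partial>\<mu>) - (\<integral>x. (\<integral>z. (u z)\<^sup>2 \<partial>Q' (T m x \<theta>)) * p \<theta> x \<partial>\<mu>)\<bar>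
      \<le> U\<^sup>2 * ?err (p \<theta>) + 2 * U\<^sup>2 * ?out (p \<theta>)"
    by (rule err[OF _ _ ints(1)]) (use bounded_measurable_square[OF u(1) uU] in auto)
  have "score_functional \<mu> (p \<theta>) ?d Q u \<le> score_functional \<mu> (p \<theta>) ?d (\<lambda>x. Q' (T m x \<theta>)) u
     + (2 * (U * E2 + 2 * U * ?out ?d) + (U\<^sup>2 * E1 + 2 * U\<^sup>2 * ?out (p \<theta>)))"
  proof -
    have arith: "2 * a1 - b1 \<le> 2 * a2 - b2 + (2 * X + Y)"
      if "\<bar>a1 - a2\<bar> \<le> X" "\<bar>b1 - b2\<bar> \<le> Y" for a1 a2 b1 b2 X Y :: real
      using that by linarith
    show ?thesis
      unfolding score_functional_def E1_def E2_def by (rule arith[OF err[OF u(1) uU ints(2)] sq_err])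
  qed
  also have "score_functional \<mu> (p \<theta>) ?d (\<lambda>x. Q' (T m x \<theta>)) u \<le> fisher_information \<Theta> (image_model (\<lambda>x. Q' (T m x \<theta>)) P) \<theta>"
    using bounded_measurableI[OF u(1) uU] by (rule score_functional_le[OF mod dqm th Q'T])
  finally show ?thesis using that[OF Q'] fin u(3) unfolding I_def by linarith
qed

section \<open>The information gap\<close>

lemma quantizer_section_measurable:
  assumes T: "(\<lambda>(x, \<theta>). T m x \<theta>) \<in> (\<mu> \<Otimes>\<^sub>M borel_on \<Theta>) \<rightarrow>\<^sub>M pnat" and th: "\<theta> \<in> \<Theta>"
    and k: "\<And>x. x \<in> space \<mu> \<Longrightarrow> T m x \<theta> \<in> {1..k}"
  shows "(\<lambda>x. T m x \<theta>) \<in> \<mu> \<rightarrow>\<^sub>M fin k"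
proof -
  have "\<theta> \<in> space (borel_on \<Theta>)" using th by (simp add: space_restrict_space)
  then have "(\<lambda>x. (x, \<theta>)) \<in> \<mu> \<rightarrow>\<^sub>M \<mu> \<Otimes>\<^sub>M borel_on \<Theta>" by measurable
  from measurable_compose[OF this T] have *: "(\<lambda>x. T m x \<theta>) \<in> \<mu> \<rightarrow>\<^sub>M pnat" by simp
  have "(\<lambda>x. T m x \<theta>) -` {a} \<inter> space \<mu> \<in> sets \<mu>" if "a \<in> {1..k}" for a
    using measurable_sets[OF *, of "{a}"] that by simp
  then show ?thesis
    using k by (subst measurable_count_space_eq_countable) auto
qed

text \<open>Quantizing the input of an arbitrary private channel costs the quantization error, and
  reducing its outputs to \<open>k\<close> symbols costs an arbitrarily small \<open>\<delta>\<close>. The result is a competitor of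
  the maximizer.\<close>

lemma maximizer_near_optimal:
  assumes reg: "regular_model \<mu> \<Theta> P p s" and th: "\<theta> \<in> \<Theta>" and k: "1 \<le> k n \<theta>"
    and T: "(\<lambda>x. T n x \<theta>) \<in> \<mu> \<rightarrow>\<^sub>M fin (k n \<theta>)"
    and R: "\<And>R'. R' \<in> private_channels \<alpha> (fin (k n \<theta>)) (fin (k n \<theta>)) \<Longrightarrow>
       fisher_information \<Theta> (image_model (\<lambda>x. R' (T n x \<theta>)) P) \<theta> \<le> fisher_information \<Theta> (image_model (\<lambda>x. R (T n x \<theta>)) P) \<theta>"
    and Q: "Q \<in> private_channels \<alpha> \<mu> N"
  shows "fisher_information \<Theta> (image_model Q P) \<theta> \<le> fisher_information \<Theta> (image_model (\<lambda>x. R (T n x \<theta>)) P) \<theta>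
    + (4 * exp \<alpha> + 2 * exp (2 * \<alpha>)) * max 1 (fisher_information \<Theta> P \<theta>) * quantization_error \<mu> P p s T k n \<theta>"
proof (rule field_le_epsilon)
  fix \<delta> :: real assume \<delta>: "0 < \<delta>"
  note mod = regular_modelD(1)[OF reg] and dqm = regular_modelD(2)[OF reg th]
  obtain Q' where Q': "Q' \<in> private_channels \<alpha> (fin (k n \<theta>)) N"
    "fisher_information \<Theta> (image_model Q P) \<theta> \<le> fisher_information \<Theta> (image_model (\<lambda>x. Q' (T n x \<theta>)) P) \<theta>
      + (4 * exp \<alpha> + 2 * exp (2 * \<alpha>)) * max 1 (fisher_information \<Theta> P \<theta>) * quantization_error \<mu> P p s T k n \<theta>"
    by (rule input_quantization[where T=T and k=k and m=n and \<theta>=\<theta>, OF reg th T Q], rule that)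
  obtain A where A: "A \<in> private_matrices \<alpha> (k n \<theta>) (k n \<theta>)"
    "fisher_information \<Theta> (image_model (\<lambda>x. Q' (T n x \<theta>)) P) \<theta>
      \<le> fisher_information \<Theta> (image_model (\<lambda>x. matrix_channel (k n \<theta>) A (T n x \<theta>)) P) \<theta> + \<delta>"
    by (rule output_reduction[OF mod dqm th Q'(1) k T \<delta>], rule that)
  show "fisher_information \<Theta> (image_model Q P) \<theta> \<le> fisher_information \<Theta> (image_model (\<lambda>x. R (T n x \<theta>)) P) \<theta>
    + (4 * exp \<alpha> + 2 * exp (2 * \<alpha>)) * max 1 (fisher_information \<Theta> P \<theta>) * quantization_error \<mu> P p s T k n \<theta> + \<delta>"
    using Q'(2) A(2) R[OF matrix_channel_private[OF A(1)]] by linarith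
qed

text \<open>The information of a channel is moved from \<open>\<theta>\<close> to the estimate \<open>\<tau>\<close>, compared there with the
  maximizer, and moved back to \<open>\<theta>\<close> and on to \<open>\<theta>\<^sub>n\<close>. These moves account for the three terms \<open>phi\<close>
  in the upper bound.\<close>

lemma information_gap:
  fixes n :: nat and \<tau> :: real
  assumes \<alpha>: "0 < \<alpha>" and reg: "regular_model \<mu> \<Theta> P p s" and cq: "consistent_quantizer \<mu> \<Theta> P p s T k"
    and n: "1 \<le> n" and mm: "measurable_maximizer \<alpha> \<Theta> P (T n) (k n) Q"
    and \<tau>: "\<tau> \<in> \<Theta>" and th: "\<theta> \<in> \<Theta>" "\<theta>\<^sub>n \<in> \<Theta>"
  defines "info \<equiv> \<lambda>\<theta>'. fisher_information \<Theta> (image_model (\<lambda>x. kernel_at Q (k n \<tau>) \<tau> (T n x \<tau>)) P) \<theta>'"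
    and "opt \<equiv> optimal_private_information TYPE('z::infinite) \<alpha> \<mu> \<Theta> P \<theta>"
  shows "info \<theta> \<le> opt" and "info \<theta>\<^sub>n \<le> opt + phi \<alpha> \<mu> \<Theta> P p s \<theta> \<theta>\<^sub>n"
    and "opt \<le> info \<theta>\<^sub>n + upper_bound (4 * exp \<alpha> + 2 * exp (2 * \<alpha>)) \<alpha> \<mu> \<Theta> P p s T k n \<theta> \<tau> \<theta>\<^sub>n"
proof -
  note mod = regular_modelD(1)[OF reg] and dqm = regular_modelD(2)[OF reg]
  have km: "k n \<in> borel_on \<Theta> \<rightarrow>\<^sub>M pnat" using cq n by (auto simp: consistent_quantizer_def)
  have k: "1 \<le> k n \<tau>" using measurable_space[OF km, of \<tau>] \<tau> by (simp add: space_restrict_space)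
  have T: "(\<lambda>x. T n x \<tau>) \<in> \<mu> \<rightarrow>\<^sub>M fin (k n \<tau>)"
    using cq n \<tau> by (intro quantizer_section_measurable[of T n \<mu> \<Theta>]) (auto simp: consistent_quantizer_def)
  define R where "R = kernel_at Q (k n \<tau>) \<tau>"
  have R: "R \<in> private_channels \<alpha> (fin (k n \<tau>)) (fin (k n \<tau>))"
    "\<And>R'. R' \<in> private_channels \<alpha> (fin (k n \<tau>)) (fin (k n \<tau>)) \<Longrightarrow>
       fisher_information \<Theta> (image_model (\<lambda>x. R' (T n x \<tau>)) P) \<tau> \<le> fisher_information \<Theta> (image_model (\<lambda>x. R (T n x \<tau>)) P) \<tau>"
    using mm \<tau> unfolding measurable_maximizer_def R_def by blast+
  have RT: "(\<lambda>x. R (T n x \<tau>)) \<in> private_channels \<alpha> \<mu> (fin (k n \<tau>))" by (rule private_channel_compose[OF R(1) T])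
  have info: "info = fisher_information \<Theta> (image_model (\<lambda>x. R (T n x \<tau>)) P)"
    unfolding info_def R_def ..
  let ?S = "{fisher_information \<Theta> (image_model Q P) \<theta> | (N::'z measure) Q. Q \<in> private_channels \<alpha> \<mu> N}"
  have opt: "opt = Sup ?S" unfolding opt_def optimal_private_information_def ..
  obtain N :: "'z measure" and Q' where Q': "Q' \<in> private_channels \<alpha> \<mu> N"
    "fisher_information \<Theta> (image_model (\<lambda>x. R (T n x \<tau>)) P) \<theta> \<le> fisher_information \<Theta> (image_model Q' P) \<theta>"
    by (rule finite_output_relabel[OF mod dqm[OF th(1)] th(1) RT], rule that)
  have mem: "fisher_information \<Theta> (image_model Q' P) \<theta> \<in> ?S" using Q'(1) by blast
  show 1: "info \<theta> \<le> opt"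
    unfolding opt info
    using Q'(2) cSup_upper[OF mem image_information_bdd_above[OF mod dqm[OF th(1)] th(1)]] by linarith
  have cont: "info t \<le> info t' + phi \<alpha> \<mu> \<Theta> P p s t t'" if "t \<in> \<Theta>" "t' \<in> \<Theta>" for t t'
    unfolding info by (rule fisher_information_continuity[OF reg \<alpha> that RT])
  show "info \<theta>\<^sub>n \<le> opt + phi \<alpha> \<mu> \<Theta> P p s \<theta> \<theta>\<^sub>n"
    using cont[OF th(2,1)] 1 phi_commute[of \<alpha> \<mu> \<Theta> P p s \<theta> \<theta>\<^sub>n] by linarith
  show "opt \<le> info \<theta>\<^sub>n + upper_bound (4 * exp \<alpha> + 2 * exp (2 * \<alpha>)) \<alpha> \<mu> \<Theta> P p s T k n \<theta> \<tau> \<theta>\<^sub>n"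
    unfolding opt
  proof (rule cSup_least)
    show "?S \<noteq> {}" using mem by blast
    fix I assume "I \<in> ?S"
    then obtain N :: "'z measure" and Q1 where Q1: "Q1 \<in> private_channels \<alpha> \<mu> N"
      and I: "I = fisher_information \<Theta> (image_model Q1 P) \<theta>" by blast
    have "I \<le> fisher_information \<Theta> (image_model Q1 P) \<tau> + phi \<alpha> \<mu> \<Theta> P p s \<theta> \<tau>"
      unfolding I by (rule fisher_information_continuity[OF reg \<alpha> th(1) \<tau> Q1])
    moreover have "fisher_information \<Theta> (image_model Q1 P) \<tau> \<le> info \<tau> +
        (4 * exp \<alpha> + 2 * exp (2 * \<alpha>)) * max 1 (fisher_information \<Theta> P \<tau>) * quantization_error \<mu> P p s T k n \<tau>"
      unfolding info by (rule maximizer_near_optimal[where T=T and k=k, OF reg \<tau> k T R(2) Q1])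
    ultimately show "I \<le> info \<theta>\<^sub>n + upper_bound (4 * exp \<alpha> + 2 * exp (2 * \<alpha>)) \<alpha> \<mu> \<Theta> P p s T k n \<theta> \<tau> \<theta>\<^sub>n"
      unfolding upper_bound_def
      using cont[OF \<tau> th(1)] cont[OF th] phi_commute[of \<alpha> \<mu> \<Theta> P p s \<theta> \<tau>] by linarith
  qed
qed

section \<open>Measurability of the upper bound\<close>

lemma L1_norm_measurable:
  assumes "sigma_finite_measure \<mu>" "(\<lambda>(\<theta>, x). g \<theta> x) \<in> borel_measurable (B \<Otimes>\<^sub>M \<mu>)"
  shows "(\<lambda>\<theta>. L1_norm \<mu> (g \<theta>)) \<in> borel_measurable B"
proof -
  interpret sigma_finite_measure \<mu> by fact
  have "(\<lambda>(\<theta>, x). \<bar>g \<theta> x\<bar>) \<in> borel_measurable (B \<Otimes>\<^sub>M \<mu>)"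
    using borel_measurable_abs[OF assms(2)] by (simp add: split_beta')
  then show ?thesis unfolding L1_norm_def by (rule borel_measurable_lebesgue_integral)
qed

lemma regular_model_jointly_measurable:
  assumes "regular_model \<mu> \<Theta> P p s"
  shows "(\<lambda>(\<theta>, x). p \<theta> x) \<in> borel_measurable (borel_on \<Theta> \<Otimes>\<^sub>M \<mu>)"
    "(\<lambda>(\<theta>, x). s \<theta> x) \<in> borel_measurable (borel_on \<Theta> \<Otimes>\<^sub>M \<mu>)"
proof -
  have swap: "(\<lambda>(\<theta>, x). f x \<theta>) \<in> borel_measurable (borel_on \<Theta> \<Otimes>\<^sub>M \<mu>)"
    if "(\<lambda>(x, \<theta>). f x \<theta>) \<in> borel_measurable (\<mu> \<Otimes>\<^sub>M borel_on \<Theta>)" for f :: "'a \<Rightarrow> real \<Rightarrow> real"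
    using measurable_pair_swap[OF that] by (simp add: split_beta')
  show "(\<lambda>(\<theta>, x). p \<theta> x) \<in> borel_measurable (borel_on \<Theta> \<Otimes>\<^sub>M \<mu>)"
    "(\<lambda>(\<theta>, x). s \<theta> x) \<in> borel_measurable (borel_on \<Theta> \<Otimes>\<^sub>M \<mu>)"
    using assms by (auto simp: regular_model_def intro!: swap)
qed

lemma fisher_information_measurable:
  assumes reg: "regular_model \<mu> \<Theta> P p s"
  shows "fisher_information \<Theta> P \<in> borel_measurable (borel_on \<Theta>)"
proof -
  note mod = regular_modelD(1)[OF reg] and dqm = regular_modelD(2)[OF reg]
  note [measurable] = regular_model_jointly_measurable[OF reg]
  interpret sigma_finite_measure \<mu> using mod by (simp add: dominated_model_def)
  have "(\<lambda>\<theta>. \<integral>x. (s \<theta> x)\<^sup>2 * p \<theta> x \<partial>\<mu>) \<in> borel_measurable (borel_on \<Theta>)"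
    by (rule borel_measurable_lebesgue_integral) measurable
  then show ?thesis
    using fisher_information_DQM[OF mod dqm]
    by (subst measurable_cong[where g="\<lambda>\<theta>. \<integral>x. (s \<theta> x)\<^sup>2 * p \<theta> x \<partial>\<mu>"]) (auto simp: space_restrict_space)
qed

lemma phi_measurable:
  assumes reg: "regular_model \<mu> \<Theta> P p s" and th: "\<theta> \<in> \<Theta>"
  shows "(\<lambda>\<tau>. phi \<alpha> \<mu> \<Theta> P p s \<theta> \<tau>) \<in> borel_measurable (borel_on \<Theta>)"
proof -
  note mod = regular_modelD(1)[OF reg] and dqm = regular_modelD(2)[OF reg]
  note [measurable] = regular_model_jointly_measurable[OF reg] fisher_information_measurable[OF reg]
    dominated_modelD(2)[OF mod th]
  have [measurable]: "s \<theta> \<in> borel_measurable \<mu>" using dqm[OF th] by (simp add: DQM_at_def)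
  have sf: "sigma_finite_measure \<mu>" using mod by (simp add: dominated_model_def)
  have [measurable]: "(\<lambda>\<tau>. L1_norm \<mu> (\<lambda>x. s \<theta> x * p \<theta> x - s \<tau> x * p \<tau> x)) \<in> borel_measurable (borel_on \<Theta>)"
    "(\<lambda>\<tau>. L1_norm \<mu> (\<lambda>x. p \<theta> x - p \<tau> x)) \<in> borel_measurable (borel_on \<Theta>)"
    by (rule L1_norm_measurable[OF sf]; measurable)+
  show ?thesis unfolding phi_def by measurable
qed

text \<open>The set of good cells varies with the parameter; for a fixed bound on the number of cells
  everything is a finite sum of parameter integrals.\<close>

lemma quantization_error_measurable_const:
  fixes K :: nat
  assumes reg: "regular_model \<mu> \<Theta> P p s" and T: "(\<lambda>(x, \<theta>). T n x \<theta>) \<in> (\<mu> \<Otimes>\<^sub>M borel_on \<Theta>) \<rightarrow>\<^sub>M pnat"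
  shows "(\<lambda>\<tau>. quantization_error \<mu> P p s T (\<lambda>_ _. K) n \<tau>) \<in> borel_measurable (borel_on \<Theta>)"
proof -
  note mod = regular_modelD(1)[OF reg]
  note [measurable] = regular_model_jointly_measurable[OF reg]
  have sf: "sigma_finite_measure \<mu>" using mod by (simp add: dominated_model_def)
  interpret sigma_finite_measure \<mu> by fact
  let ?B = "borel_on \<Theta>"
  have Tj: "(\<lambda>(\<tau>, x). T n x \<tau>) \<in> ?B \<Otimes>\<^sub>M \<mu> \<rightarrow>\<^sub>M count_space UNIV"
  proof -
    have "(\<lambda>(\<tau>, x). T n x \<tau>) \<in> ?B \<Otimes>\<^sub>M \<mu> \<rightarrow>\<^sub>M pnat"
      using measurable_pair_swap[OF T] by (simp add: split_beta')
    from measurable_compose[OF this, of "\<lambda>j. j" "count_space UNIV"] show ?thesis by simp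
  qed
  define c :: "nat \<Rightarrow> real \<Rightarrow> 'a \<Rightarrow> real" where "c l \<tau> x = indicator {l} (T n x \<tau>)" for l \<tau> x
  have [measurable]: "(\<lambda>(\<tau>, x). c l \<tau> x) \<in> borel_measurable (?B \<Otimes>\<^sub>M \<mu>)" for l
    using measurable_compose[OF Tj, of "indicator {l}" "borel :: real measure"] by (simp add: c_def split_beta')
  define e where "e l \<tau> = (\<integral>\<^sup>+x. ennreal (c l \<tau> x) \<partial>\<mu>)" for l \<tau>
  have [measurable]: "e l \<in> borel_measurable ?B" for l
    unfolding e_def by (rule borel_measurable_nn_integral) measurable
  define g where "g l \<tau> = (if 0 < e l \<tau> \<and> e l \<tau> < \<infinity> then 1 else (0::real))" for l \<tau>
  have [measurable]: "g l \<in> borel_measurable ?B" for l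
    unfolding g_def by measurable
  define G where "G f l \<tau> = (\<integral>x. c l \<tau> x * f \<tau> x \<partial>\<mu>)" for f :: "real \<Rightarrow> 'a \<Rightarrow> real" and l \<tau>
  have Gm: "G f l \<in> borel_measurable ?B" if [measurable]: "(\<lambda>(\<tau>, x). f \<tau> x) \<in> borel_measurable (?B \<Otimes>\<^sub>M \<mu>)" for f l
    unfolding G_def by (rule borel_measurable_lebesgue_integral) measurable
  define av where "av f \<tau> x = (\<Sum>l\<in>{1..K}. g l \<tau> * (G f l \<tau> / enn2real (e l \<tau>) * c l \<tau> x))" for f \<tau> x
  define inK where "inK \<tau> x = (\<Sum>l\<in>{1..K}. g l \<tau> * c l \<tau> x)" for \<tau> x
  have avm: "(\<lambda>(\<tau>, x). av f \<tau> x) \<in> borel_measurable (?B \<Otimes>\<^sub>M \<mu>)" if "(\<lambda>(\<tau>, x). f \<tau> x) \<in> borel_measurable (?B \<Otimes>\<^sub>M \<mu>)" for f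
  proof -
    note [measurable] = Gm[OF that]
    show ?thesis unfolding av_def by measurable
  qed
  have [measurable]: "(\<lambda>(\<tau>, x). inK \<tau> x) \<in> borel_measurable (?B \<Otimes>\<^sub>M \<mu>)"
    unfolding inK_def by measurable
  define E where "E \<tau> = L1_norm \<mu> (\<lambda>x. (p \<tau> x - av p \<tau> x) * inK \<tau> x)
     + L1_norm \<mu> (\<lambda>x. (s \<tau> x * p \<tau> x - av (\<lambda>\<tau> x. s \<tau> x * p \<tau> x) \<tau> x) * inK \<tau> x)
     + sqrt (\<integral>x. (1 - inK \<tau> x) * p \<tau> x \<partial>\<mu>)" for \<tau>
  have Em: "E \<in> borel_measurable ?B"
  proof -
    have pm: "(\<lambda>(\<tau>, x). p \<tau> x) \<in> borel_measurable (?B \<Otimes>\<^sub>M \<mu>)" "(\<lambda>(\<tau>, x). s \<tau> x * p \<tau> x) \<in> borel_measurable (?B \<Otimes>\<^sub>M \<mu>)"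
      by measurable
    note [measurable] = avm[OF pm(1)] avm[OF pm(2)]
    have [measurable]: "(\<lambda>\<tau>. L1_norm \<mu> (\<lambda>x. (p \<tau> x - av p \<tau> x) * inK \<tau> x)) \<in> borel_measurable ?B"
      "(\<lambda>\<tau>. L1_norm \<mu> (\<lambda>x. (s \<tau> x * p \<tau> x - av (\<lambda>\<tau> x. s \<tau> x * p \<tau> x) \<tau> x) * inK \<tau> x)) \<in> borel_measurable ?B"
      by (rule L1_norm_measurable[OF sf]; measurable)+
    have [measurable]: "(\<lambda>\<tau>. \<integral>x. (1 - inK \<tau> x) * p \<tau> x \<partial>\<mu>) \<in> borel_measurable ?B"
      by (rule borel_measurable_lebesgue_integral) measurable
    show ?thesis unfolding E_def by measurable
  qed
  have "quantization_error \<mu> P p s T (\<lambda>_ _. K) n \<tau> = E \<tau>" if \<tau>: "\<tau> \<in> \<Theta>" for \<tau>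
  proof -
    let ?J = "good_cells \<mu> T (\<lambda>_ _. K) n \<tau>" and ?R = "good_region \<mu> T (\<lambda>_ _. K) n \<tau>"
    have Tm: "(\<lambda>x. T n x \<tau>) \<in> \<mu> \<rightarrow>\<^sub>M count_space UNIV"
    proof -
      have "\<tau> \<in> space ?B" using \<tau> by (simp add: space_restrict_space)
      then have "(\<lambda>x. (\<tau>, x)) \<in> \<mu> \<rightarrow>\<^sub>M ?B \<Otimes>\<^sub>M \<mu>" by measurable
      from measurable_compose[OF this Tj] show ?thesis by simp
    qed
    have cm: "cell \<mu> T n \<tau> l \<in> sets \<mu>" for l
      unfolding cell_def using measurable_sets[OF Tm, of "{l}"] by (simp add: vimage_def Int_def conj_commute)
    have ind: "c l \<tau> x = indicator (cell \<mu> T n \<tau> l) x" if "x \<in> space \<mu>" for x l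
      using that by (auto simp: c_def cell_def indicator_def)
    have em: "emeasure \<mu> (cell \<mu> T n \<tau> l) = e l \<tau>" for l
    proof -
      have "e l \<tau> = (\<integral>\<^sup>+x. indicator (cell \<mu> T n \<tau> l) x \<partial>\<mu>)"
        unfolding e_def by (intro nn_integral_cong) (simp add: ind ennreal_indicator)
      then show ?thesis using cm by simp
    qed
    have J: "?J = {l\<in>{1..K}. 0 < e l \<tau> \<and> e l \<tau> < \<infinity>}"
      by (simp add: good_cells_def em)
    have gsum: "(\<Sum>l\<in>{1..K}. g l \<tau> * r l) = (\<Sum>l\<in>?J. r l)" for r
      unfolding J by (subst sum.inter_filter) (auto intro!: sum.cong simp: g_def)
    have avg: "cell_average \<mu> T (\<lambda>_ _. K) n \<tau> (f \<tau>) x = av f \<tau> x" if x: "x \<in> space \<mu>" for f x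
    proof -
      have "(LINT y:cell \<mu> T n \<tau> l|\<mu>. f \<tau> y) = G f l \<tau>" for l
        unfolding G_def set_lebesgue_integral_def by (intro Bochner_Integration.integral_cong) (auto simp: ind)
      then show ?thesis
        unfolding av_def gsum cell_average_def by (simp add: measure_def em ind[OF x])
    qed
    have inR: "indicator ?R x = inK \<tau> x" if x: "x \<in> space \<mu>" for x
      unfolding inK_def gsum good_region_def ind[OF x]
      by (intro indicator_UN_disjoint) (auto simp: disjoint_family_on_def cell_def J)
    have Rm: "?R \<in> sets \<mu>" unfolding good_region_def using cm by (intro sets.finite_UN) (auto simp: J)
    have L: "L1_norm \<mu> f = L1_norm \<mu> g" if "\<And>x. x \<in> space \<mu> \<Longrightarrow> f x = g x" for f g
      unfolding L1_norm_def using that by (intro Bochner_Integration.integral_cong) auto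
    have "measure (P \<tau>) (space \<mu> - ?R) = (\<integral>x. indicator (space \<mu> - ?R) x \<partial>P \<tau>)"
      using Rm dominated_modelD(5)[OF mod \<tau>] by simp
    also have "\<dots> = (\<integral>x. indicator (space \<mu> - ?R) x * p \<tau> x \<partial>\<mu>)"
      using Rm by (intro integral_dominated_model(1)[OF mod \<tau>]) simp
    also have "\<dots> = (\<integral>x. (1 - inK \<tau> x) * p \<tau> x \<partial>\<mu>)"
      using inR by (intro Bochner_Integration.integral_cong) (auto simp: indicator_def inR[symmetric])
    finally have out: "measure (P \<tau>) (space \<mu> - ?R) = (\<integral>x. (1 - inK \<tau> x) * p \<tau> x \<partial>\<mu>)" .
    show ?thesis
      unfolding quantization_error_def Let_def E_def out
      using avg[of _ p] avg[of _ "\<lambda>\<tau> x. s \<tau> x * p \<tau> x"] inR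
      by (intro arg_cong2[where f="(+)"] L refl) auto
  qed
  then show ?thesis
    by (subst measurable_cong[where g=E]) (auto simp: space_restrict_space intro: Em)
qed

lemma quantization_error_measurable:
  assumes reg: "regular_model \<mu> \<Theta> P p s" and cq: "consistent_quantizer \<mu> \<Theta> P p s T k" and n: "1 \<le> n"
  shows "(\<lambda>\<tau>. quantization_error \<mu> P p s T k n \<tau>) \<in> borel_measurable (borel_on \<Theta>)"
proof -
  have T: "(\<lambda>(x, \<theta>). T n x \<theta>) \<in> (\<mu> \<Otimes>\<^sub>M borel_on \<Theta>) \<rightarrow>\<^sub>M pnat" and km: "k n \<in> borel_on \<Theta> \<rightarrow>\<^sub>M pnat"
    using cq n by (auto simp: consistent_quantizer_def)
  have km': "k n \<in> borel_on \<Theta> \<rightarrow>\<^sub>M count_space UNIV"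
    using measurable_compose[OF km, of "\<lambda>j. j" "count_space UNIV"] by simp
  have "(\<lambda>\<tau>. quantization_error \<mu> P p s T (\<lambda>_ _. k n \<tau>) n \<tau>) \<in> borel_measurable (borel_on \<Theta>)"
    by (rule measurable_compose_countable[OF quantization_error_measurable_const[where n=n and T=T, OF reg T] km'])
  moreover have "quantization_error \<mu> P p s T (\<lambda>_ _. k n \<tau>) n \<tau> = quantization_error \<mu> P p s T k n \<tau>" for \<tau>
    by (simp add: quantization_error_def cell_average_def good_region_def good_cells_def)
  ultimately show ?thesis by simp
qed

lemma upper_bound_measurable:
  assumes reg: "regular_model \<mu> \<Theta> P p s" and cq: "consistent_quantizer \<mu> \<Theta> P p s T k" and n: "1 \<le> n"
    and th: "\<theta> \<in> \<Theta>"
  shows "(\<lambda>\<tau>. upper_bound C \<alpha> \<mu> \<Theta> P p s T k n \<theta> \<tau> \<theta>') \<in> borel_measurable (borel_on \<Theta>)"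
proof -
  note [measurable] = phi_measurable[OF reg th] fisher_information_measurable[OF reg] quantization_error_measurable[OF reg cq n]
  show ?thesis unfolding upper_bound_def by measurable
qed

section \<open>Convergence of the upper bound\<close>

lemma L1_norm_density_tendsto:
  assumes mod: "dominated_model \<mu> \<Theta> P p" and dqm: "DQM_at \<mu> \<Theta> p \<theta> s" and th: "\<theta> \<in> \<Theta>"
    and \<tau>: "\<And>n. \<tau> n \<in> \<Theta>" "\<tau> \<longlonglongrightarrow> \<theta>"
  shows "(\<lambda>n. L1_norm \<mu> (\<lambda>x. p \<theta> x - p (\<tau> n) x)) \<longlonglongrightarrow> 0"
proof -
  let ?d = "\<lambda>x. s x * p \<theta> x"
  define e where "e h = (\<integral>x. \<bar>p (\<theta> + h) x - p \<theta> x - h * (s x * p \<theta> x)\<bar> \<partial>\<mu>)" for h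
  have "((\<lambda>h. e h / \<bar>h\<bar>) \<longlongrightarrow> 0) (at 0)"
    unfolding e_def by (rule DQM_imp_L1_differentiable(2)[OF mod dqm th])
  then have "((\<lambda>h. \<bar>h\<bar> * (e h / \<bar>h\<bar>) + \<bar>h\<bar> * L1_norm \<mu> ?d) \<longlongrightarrow> \<bar>0\<bar> * 0 + \<bar>0\<bar> * L1_norm \<mu> ?d) (at 0)"
    by (intro tendsto_intros)
  then have lim: "((\<lambda>h. \<bar>h\<bar> * (e h / \<bar>h\<bar>) + \<bar>h\<bar> * L1_norm \<mu> ?d) \<longlongrightarrow> 0) (at 0)" by simp
  \<comment> \<open>At \<open>h = 0\<close> the quotient is \<open>0\<close> by the convention for division, so that the bound takes
    its limit as value there.\<close>
  then have "((\<lambda>h. \<bar>h\<bar> * (e h / \<bar>h\<bar>) + \<bar>h\<bar> * L1_norm \<mu> ?d) \<longlongrightarrow> 0) (nhds 0)"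
    by (simp add: tendsto_nhds_iff)
  moreover have "(\<lambda>n. \<tau> n - \<theta>) \<longlonglongrightarrow> 0" using \<tau>(2) by (simp add: LIM_zero)
  ultimately have lim': "(\<lambda>n. \<bar>\<tau> n - \<theta>\<bar> * (e (\<tau> n - \<theta>) / \<bar>\<tau> n - \<theta>\<bar>) + \<bar>\<tau> n - \<theta>\<bar> * L1_norm \<mu> ?d) \<longlonglongrightarrow> 0"
    by (rule filterlim_compose)
  have bound: "L1_norm \<mu> (\<lambda>x. p \<theta> x - p (\<tau> n) x) \<le> \<bar>\<tau> n - \<theta>\<bar> * (e (\<tau> n - \<theta>) / \<bar>\<tau> n - \<theta>\<bar>) + \<bar>\<tau> n - \<theta>\<bar> * L1_norm \<mu> ?d" for n
  proof (cases "\<tau> n = \<theta>")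
    case True
    then show ?thesis by (simp add: L1_norm_def)
  next
    case False
    define h where "h = \<tau> n - \<theta>"
    have h: "\<tau> n = \<theta> + h" "h \<noteq> 0" using False by (auto simp: h_def)
    note ints = dominated_modelD(7)[OF mod th] dominated_modelD(7)[OF mod \<tau>(1)[of n]] DQM_pdot_integrable(1)[OF mod dqm th]
    have "L1_norm \<mu> (\<lambda>x. p \<theta> x - p (\<tau> n) x) \<le> (\<integral>x. \<bar>p (\<theta> + h) x - p \<theta> x - h * ?d x\<bar> + \<bar>h\<bar> * \<bar>?d x\<bar> \<partial>\<mu>)"
      unfolding L1_norm_def
    proof (rule integral_mono)
      fix x
      have "\<bar>a - b\<bar> \<le> \<bar>b - a - h * c\<bar> + \<bar>h\<bar> * \<bar>c\<bar>" for a b c :: real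
        unfolding abs_mult[symmetric] by linarith
      then show "\<bar>p \<theta> x - p (\<tau> n) x\<bar> \<le> \<bar>p (\<theta> + h) x - p \<theta> x - h * ?d x\<bar> + \<bar>h\<bar> * \<bar>?d x\<bar>"
        unfolding h(1) .
    qed (use ints in \<open>auto simp: h(1)[symmetric]\<close>)
    also have "\<dots> = e h + \<bar>h\<bar> * L1_norm \<mu> ?d"
      unfolding e_def L1_norm_def using ints by (subst Bochner_Integration.integral_add) (auto simp: h(1)[symmetric])
    finally show ?thesis using h(2) unfolding h_def[symmetric] by simp
  qed
  show ?thesis
    by (rule tendsto_sandwich[OF _ _ tendsto_const lim']; intro always_eventually allI L1_norm_nonneg bound)
qed

text \<open>The derivative \<open>s p\<close> is the product of \<open>s \<surd>p\<close>, which is continuous in \<open>L\<^sub>2\<close> by regularity, and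
  \<open>\<surd>p\<close>, which inherits continuity in \<open>L\<^sub>2\<close> from that of \<open>p\<close> in \<open>L\<^sub>1\<close> by
  \<open>(\<surd>a - \<surd>b)\<^sup>2 \<le> \<bar>a - b\<bar>\<close>.\<close>

lemma L1_norm_pdot_tendsto:
  assumes reg: "regular_model \<mu> \<Theta> P p s" and th: "\<theta> \<in> \<Theta>"
    and \<tau>: "\<And>n. \<tau> n \<in> \<Theta>" "\<tau> \<longlonglongrightarrow> \<theta>"
  shows "(\<lambda>n. L1_norm \<mu> (\<lambda>x. s \<theta> x * p \<theta> x - s (\<tau> n) x * p (\<tau> n) x)) \<longlonglongrightarrow> 0"
    and "\<exists>B. eventually (\<lambda>n. fisher_information \<Theta> P (\<tau> n) \<le> B) sequentially"
proof -
  note mod = regular_modelD(1)[OF reg] and dqm = regular_modelD(2)[OF reg]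
  define a where "a t x = s t x * sqrt (p t x)" for t x
  have pm: "p t \<in> borel_measurable \<mu>" "s t \<in> borel_measurable \<mu>" if "t \<in> \<Theta>" for t
    using dominated_modelD(2)[OF mod that] dqm[OF that] by (auto simp: DQM_at_def)
  have am: "a t \<in> borel_measurable \<mu>" if "t \<in> \<Theta>" for t
    unfolding a_def using pm[OF that] by measurable
  have p0: "0 \<le> p t x" if "t \<in> \<Theta>" "x \<in> space \<mu>" for t x using dominated_modelD(3)[OF mod that] .
  have a2: "integrable \<mu> (\<lambda>x. (a t x)\<^sup>2)" "(\<integral>x. (a t x)\<^sup>2 \<partial>\<mu>) = fisher_information \<Theta> P t" if t: "t \<in> \<Theta>" for t
  proof -
    have eq: "(a t x)\<^sup>2 = (s t x)\<^sup>2 * p t x" if "x \<in> space \<mu>" for x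
      using p0[OF t that] by (simp add: a_def power_mult_distrib)
    show "integrable \<mu> (\<lambda>x. (a t x)\<^sup>2)"
      using DQM_imp_L1_differentiable(1)[OF mod dqm[OF t] t] eq
      by (subst Bochner_Integration.integrable_cong[OF refl, of _ _ "\<lambda>x. (s t x)\<^sup>2 * p t x"]) auto
    show "(\<integral>x. (a t x)\<^sup>2 \<partial>\<mu>) = fisher_information \<Theta> P t"
      unfolding fisher_information_DQM[OF mod dqm[OF t] t] using eq by (intro Bochner_Integration.integral_cong) auto
  qed
  define b where "b t x = sqrt (p t x)" for t x
  have bm: "b t \<in> borel_measurable \<mu>" if "t \<in> \<Theta>" for t
    unfolding b_def using pm[OF that] by measurable
  have b2: "integrable \<mu> (\<lambda>x. (b t x)\<^sup>2)" "(\<integral>x. (b t x)\<^sup>2 \<partial>\<mu>) = 1" if t: "t \<in> \<Theta>" for t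
  proof -
    have eq: "(b t x)\<^sup>2 = p t x" if "x \<in> space \<mu>" for x using p0[OF t that] by (simp add: b_def)
    show "integrable \<mu> (\<lambda>x. (b t x)\<^sup>2)"
      using dominated_modelD(7)[OF mod t] eq by (subst Bochner_Integration.integrable_cong[OF refl, of _ _ "p t"]) auto
    show "(\<integral>x. (b t x)\<^sup>2 \<partial>\<mu>) = 1"
      using dominated_modelD(8)[OF mod t] eq by (subst Bochner_Integration.integral_cong[OF refl, of _ _ "p t"]) auto
  qed
  have d2: "integrable \<mu> (\<lambda>x. (f x - g x)\<^sup>2)" if "integrable \<mu> (\<lambda>x. (f x)\<^sup>2)" "integrable \<mu> (\<lambda>x. (g x)\<^sup>2)"
    "f \<in> borel_measurable \<mu>" "g \<in> borel_measurable \<mu>" for f g :: "'a \<Rightarrow> real"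
  proof -
    have "integrable \<mu> (\<lambda>x. (f x)\<^sup>2 + (g x)\<^sup>2 - 2 * (f x * g x))"
      using that Cauchy_Schwarz_integral(1)[OF that(3,4,1,2)] by auto
    then show ?thesis by (simp add: power2_diff mult.assoc)
  qed
  define D where "D t = (\<integral>x. (a t x - a \<theta> x)\<^sup>2 \<partial>\<mu>)" for t
  have ad2: "integrable \<mu> (\<lambda>x. (a t x - a \<theta> x)\<^sup>2)" if "t \<in> \<Theta>" for t
    by (rule d2[OF a2(1)[OF that] a2(1)[OF th] am[OF that] am[OF th]])
  have D0: "0 \<le> D t" for t by (simp add: D_def)
  have Dlim: "(\<lambda>n. D (\<tau> n)) \<longlonglongrightarrow> 0"
  proof -
    have C3: "((\<lambda>t. \<integral>\<^sup>+x. ennreal ((a t x - a \<theta> x)\<^sup>2) \<partial>\<mu>) \<longlongrightarrow> 0) (at \<theta> within \<Theta>)"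
      using reg th unfolding regular_model_def a_def by blast
    have nn: "(\<integral>\<^sup>+x. ennreal ((a t x - a \<theta> x)\<^sup>2) \<partial>\<mu>) = ennreal (D t)" if "t \<in> \<Theta>" for t
      unfolding D_def using ad2[OF that] by (intro nn_integral_eq_integral) auto
    have ft: "((\<lambda>t. \<integral>\<^sup>+x. ennreal ((a t x - a \<theta> x)\<^sup>2) \<partial>\<mu>) \<longlongrightarrow> (\<integral>\<^sup>+x. ennreal ((a \<theta> x - a \<theta> x)\<^sup>2) \<partial>\<mu>)) (at \<theta> within \<Theta>)"
      using C3 by simp
    have "(\<lambda>n. \<integral>\<^sup>+x. ennreal ((a (\<tau> n) x - a \<theta> x)\<^sup>2) \<partial>\<mu>) \<longlonglongrightarrow> (\<integral>\<^sup>+x. ennreal ((a \<theta> x - a \<theta> x)\<^sup>2) \<partial>\<mu>)"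
      by (rule continuous_within_tendsto_compose'[OF _ \<tau>]) (use ft in \<open>simp add: continuous_within\<close>)
    then have "(\<lambda>n. ennreal (D (\<tau> n))) \<longlonglongrightarrow> ennreal 0"
      using nn[OF \<tau>(1)] by simp
    from tendsto_enn2real[OF this] show ?thesis using D0 by simp
  qed
  define I where "I = fisher_information \<Theta> P \<theta>"
  have I0: "0 \<le> I" unfolding I_def by (rule fisher_information_nonneg)
  have Ibound: "fisher_information \<Theta> P t \<le> 2 * D t + 2 * I" if t: "t \<in> \<Theta>" for t
  proof -
    have "fisher_information \<Theta> P t \<le> (\<integral>x. 2 * (a t x - a \<theta> x)\<^sup>2 + 2 * (a \<theta> x)\<^sup>2 \<partial>\<mu>)"
      unfolding a2(2)[OF t, symmetric]
    proof (rule integral_mono)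
      fix x
      have "0 \<le> (a t x - 2 * a \<theta> x)\<^sup>2" by simp
      then show "(a t x)\<^sup>2 \<le> 2 * (a t x - a \<theta> x)\<^sup>2 + 2 * (a \<theta> x)\<^sup>2"
        by (simp add: power2_eq_square algebra_simps)
    qed (use a2(1)[OF t] a2(1)[OF th] ad2[OF t] in auto)
    also have "\<dots> = 2 * D t + 2 * I"
      unfolding D_def I_def a2(2)[OF th, symmetric] using a2(1)[OF th] ad2[OF t] by simp
    finally show ?thesis .
  qed
  have "eventually (\<lambda>n. D (\<tau> n) < 1) sequentially" using Dlim by (rule order_tendstoD) simp
  then have "eventually (\<lambda>n. fisher_information \<Theta> P (\<tau> n) \<le> 2 + 2 * I) sequentially"
  proof eventually_elim
    case (elim n)
    then show ?case using Ibound[OF \<tau>(1)[of n]] by simp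
  qed
  then show "\<exists>B. eventually (\<lambda>n. fisher_information \<Theta> P (\<tau> n) \<le> B) sequentially" by blast
  define L where "L t = L1_norm \<mu> (\<lambda>x. p \<theta> x - p t x)" for t
  have Llim: "(\<lambda>n. L (\<tau> n)) \<longlonglongrightarrow> 0"
    unfolding L_def by (rule L1_norm_density_tendsto[OF mod dqm[OF th] th \<tau>])
  have bound: "L1_norm \<mu> (\<lambda>x. s \<theta> x * p \<theta> x - s t x * p t x) \<le> sqrt (D t) + sqrt I * sqrt (L t)" if t: "t \<in> \<Theta>" for t
  proof -
    note bd2 = d2[OF b2(1)[OF t] b2(1)[OF th] bm[OF t] bm[OF th]]
    have adm: "(\<lambda>x. a t x - a \<theta> x) \<in> borel_measurable \<mu>" "(\<lambda>x. b t x - b \<theta> x) \<in> borel_measurable \<mu>"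
      using am[OF t] am[OF th] bm[OF t] bm[OF th] by measurable
    note cs1 = Cauchy_Schwarz_integral[OF adm(1) bm[OF t] ad2[OF t] b2(1)[OF t]]
    note cs2 = Cauchy_Schwarz_integral[OF am[OF th] adm(2) a2(1)[OF th] bd2]
    have "(\<integral>x. (b t x - b \<theta> x)\<^sup>2 \<partial>\<mu>) \<le> L t"
      unfolding L_def L1_norm_def
    proof (rule integral_mono[OF bd2])
      show "integrable \<mu> (\<lambda>x. \<bar>p \<theta> x - p t x\<bar>)"
        using dominated_modelD(7)[OF mod th] dominated_modelD(7)[OF mod t] by auto
      fix x assume x: "x \<in> space \<mu>"
      have nn: "0 \<le> b t x" "0 \<le> b \<theta> x" using p0[OF t x] p0[OF th x] by (auto simp: b_def)
      have "(b t x - b \<theta> x)\<^sup>2 = \<bar>b t x - b \<theta> x\<bar> * \<bar>b t x - b \<theta> x\<bar>" by (simp add: power2_eq_square)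
      also have "\<dots> \<le> \<bar>b t x - b \<theta> x\<bar> * (b t x + b \<theta> x)"
        using nn by (intro mult_left_mono) auto
      also have "\<dots> = \<bar>(b t x - b \<theta> x) * (b t x + b \<theta> x)\<bar>" using nn by (simp add: abs_mult)
      also have "(b t x - b \<theta> x) * (b t x + b \<theta> x) = p t x - p \<theta> x"
        using p0[OF t x] p0[OF th x] by (simp add: b_def algebra_simps)
      finally show "(b t x - b \<theta> x)\<^sup>2 \<le> \<bar>p \<theta> x - p t x\<bar>" by (simp add: abs_minus_commute)
    qed
    then have sL: "sqrt (\<integral>x. (b t x - b \<theta> x)\<^sup>2 \<partial>\<mu>) \<le> sqrt (L t)" by simp
    have "L1_norm \<mu> (\<lambda>x. s \<theta> x * p \<theta> x - s t x * p t x) \<le> (\<integral>x. \<bar>(a t x - a \<theta> x) * b t x\<bar> + \<bar>a \<theta> x * (b t x - b \<theta> x)\<bar> \<partial>\<mu>)"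
      unfolding L1_norm_def
    proof (rule integral_mono)
      show "integrable \<mu> (\<lambda>x. \<bar>s \<theta> x * p \<theta> x - s t x * p t x\<bar>)"
        using DQM_pdot_integrable(1)[OF mod dqm[OF th] th] DQM_pdot_integrable(1)[OF mod dqm[OF t] t] by auto
      show "integrable \<mu> (\<lambda>x. \<bar>(a t x - a \<theta> x) * b t x\<bar> + \<bar>a \<theta> x * (b t x - b \<theta> x)\<bar>)"
        by (intro Bochner_Integration.integrable_add integrable_abs cs1(1) cs2(1))
      fix x assume x: "x \<in> space \<mu>"
      have eq: "s u x * p u x = a u x * b u x" if "u \<in> \<Theta>" for u
        using p0[OF that x] by (simp add: a_def b_def)
      have "a \<theta> x * b \<theta> x - a t x * b t x = - ((a t x - a \<theta> x) * b t x) - a \<theta> x * (b t x - b \<theta> x)"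
        by (simp add: algebra_simps)
      then show "\<bar>s \<theta> x * p \<theta> x - s t x * p t x\<bar> \<le> \<bar>(a t x - a \<theta> x) * b t x\<bar> + \<bar>a \<theta> x * (b t x - b \<theta> x)\<bar>"
        unfolding eq[OF t] eq[OF th] by linarith
    qed
    also have "\<dots> = (\<integral>x. \<bar>(a t x - a \<theta> x) * b t x\<bar> \<partial>\<mu>) + (\<integral>x. \<bar>a \<theta> x * (b t x - b \<theta> x)\<bar> \<partial>\<mu>)"
      by (intro Bochner_Integration.integral_add integrable_abs cs1(1) cs2(1))
    also have "\<dots> \<le> sqrt (D t) * sqrt 1 + sqrt I * sqrt (L t)"
    proof (rule add_mono)
      show "(\<integral>x. \<bar>(a t x - a \<theta> x) * b t x\<bar> \<partial>\<mu>) \<le> sqrt (D t) * sqrt 1"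
        using cs1(2) unfolding b2(2)[OF t] D_def .
      have "(\<integral>x. \<bar>a \<theta> x * (b t x - b \<theta> x)\<bar> \<partial>\<mu>) \<le> sqrt I * sqrt (\<integral>x. (b t x - b \<theta> x)\<^sup>2 \<partial>\<mu>)"
        using cs2(2) unfolding a2(2)[OF th] I_def .
      also have "\<dots> \<le> sqrt I * sqrt (L t)" using sL I0 by (intro mult_left_mono) auto
      finally show "(\<integral>x. \<bar>a \<theta> x * (b t x - b \<theta> x)\<bar> \<partial>\<mu>) \<le> sqrt I * sqrt (L t)" .
    qed
    finally show ?thesis by simp
  qed
  have "(\<lambda>n. sqrt (D (\<tau> n)) + sqrt I * sqrt (L (\<tau> n))) \<longlonglongrightarrow> sqrt 0 + sqrt I * sqrt 0"
    by (intro tendsto_intros Dlim Llim)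
  then have lim: "(\<lambda>n. sqrt (D (\<tau> n)) + sqrt I * sqrt (L (\<tau> n))) \<longlonglongrightarrow> 0" by simp
  show "(\<lambda>n. L1_norm \<mu> (\<lambda>x. s \<theta> x * p \<theta> x - s (\<tau> n) x * p (\<tau> n) x)) \<longlonglongrightarrow> 0"
    by (rule tendsto_sandwich[OF _ _ tendsto_const lim]; intro always_eventually allI L1_norm_nonneg bound[OF \<tau>(1)])
qed

lemma tendsto_0_bounded_mult:
  fixes f g :: "nat \<Rightarrow> real"
  assumes "\<forall>\<^sub>F n in sequentially. \<bar>g n\<bar> \<le> B" "f \<longlonglongrightarrow> 0"
  shows "(\<lambda>n. g n * f n) \<longlonglongrightarrow> 0"
proof (rule Lim_null_comparison)
  show "\<forall>\<^sub>F n in sequentially. norm (g n * f n) \<le> B * \<bar>f n\<bar>"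
    using assms(1) by eventually_elim (simp add: abs_mult mult_right_mono)
  show "(\<lambda>n. B * \<bar>f n\<bar>) \<longlonglongrightarrow> 0"
    using tendsto_mult_left[OF tendsto_rabs_zero[OF assms(2)], of B] by simp
qed

lemma phi_tendsto:
  assumes reg: "regular_model \<mu> \<Theta> P p s" and th: "\<theta> \<in> \<Theta>"
    and \<tau>: "\<And>n. \<tau> n \<in> \<Theta>" "\<tau> \<longlonglongrightarrow> \<theta>"
  shows "(\<lambda>n. phi \<alpha> \<mu> \<Theta> P p s \<theta> (\<tau> n)) \<longlonglongrightarrow> 0"
proof -
  note mod = regular_modelD(1)[OF reg] and dqm = regular_modelD(2)[OF reg]
  obtain B where B: "eventually (\<lambda>n. fisher_information \<Theta> P (\<tau> n) \<le> B) sequentially"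
    using L1_norm_pdot_tendsto(2)[OF reg th \<tau>] by blast
  let ?g = "\<lambda>n. exp (2 * \<alpha>) * max (max (fisher_information \<Theta> P \<theta>) (fisher_information \<Theta> P (\<tau> n))) 1"
  have g: "eventually (\<lambda>n. \<bar>?g n\<bar> \<le> exp (2 * \<alpha>) * max (max (fisher_information \<Theta> P \<theta>) B) 1) sequentially"
    using B by eventually_elim (auto simp: abs_mult)
  have "(\<lambda>n. 2 * L1_norm \<mu> (\<lambda>x. s \<theta> x * p \<theta> x - s (\<tau> n) x * p (\<tau> n) x)
       + 3 * L1_norm \<mu> (\<lambda>x. p \<theta> x - p (\<tau> n) x)) \<longlonglongrightarrow> 2 * 0 + 3 * 0"
    by (intro tendsto_intros L1_norm_pdot_tendsto(1)[OF reg th \<tau>] L1_norm_density_tendsto[OF mod dqm[OF th] th \<tau>])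
  then show ?thesis
    unfolding phi_def by (intro tendsto_0_bounded_mult[OF g]) simp
qed

lemma upper_bound_tendsto:
  assumes reg: "regular_model \<mu> \<Theta> P p s" and cq: "consistent_quantizer \<mu> \<Theta> P p s T k" and th: "\<theta> \<in> \<Theta>"
    and \<tau>: "\<And>n. \<tau> n \<in> \<Theta>" "\<tau> \<longlonglongrightarrow> \<theta>" and \<tau>': "\<And>n. \<tau>' n \<in> \<Theta>" "\<tau>' \<longlonglongrightarrow> \<theta>"
  shows "(\<lambda>n. upper_bound C \<alpha> \<mu> \<Theta> P p s T k n \<theta> (\<tau> n) (\<tau>' n)) \<longlonglongrightarrow> 0"
proof -
  have qe: "(\<lambda>n. quantization_error \<mu> P p s T k n (\<tau> n)) \<longlonglongrightarrow> 0"
    using cq \<tau> th unfolding consistent_quantizer_def by blast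
  obtain B where B: "eventually (\<lambda>n. fisher_information \<Theta> P (\<tau> n) \<le> B) sequentially"
    using L1_norm_pdot_tendsto(2)[OF reg th \<tau>] by blast
  have "eventually (\<lambda>n. \<bar>C * max 1 (fisher_information \<Theta> P (\<tau> n))\<bar> \<le> \<bar>C\<bar> * max 1 B) sequentially"
    using B by eventually_elim (auto simp: abs_mult intro!: mult_left_mono)
  from tendsto_0_bounded_mult[OF this qe]
  have "(\<lambda>n. 2 * phi \<alpha> \<mu> \<Theta> P p s \<theta> (\<tau> n) + phi \<alpha> \<mu> \<Theta> P p s \<theta> (\<tau>' n)
      + C * max 1 (fisher_information \<Theta> P (\<tau> n)) * quantization_error \<mu> P p s T k n (\<tau> n)) \<longlonglongrightarrow> 2 * 0 + 0 + 0"
    by (intro tendsto_intros phi_tendsto[OF reg th \<tau>] phi_tendsto[OF reg th \<tau>'])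
  then show ?thesis unfolding upper_bound_def by simp
qed

text \<open>Counterexamples with indices tending to infinity and parameters tending to \<open>\<theta>\<close> could be interleaved with \<open>\<theta>\<close>
  into a single sequence that tends to \<open>\<theta>\<close>.\<close>

lemma locally_uniform_if_sequential:
  fixes F :: "nat \<Rightarrow> real \<Rightarrow> real"
  assumes th: "\<theta> \<in> \<Theta>" and \<epsilon>: "0 < \<epsilon>"
    and seq: "\<And>\<tau>. (\<And>n. \<tau> n \<in> \<Theta>) \<Longrightarrow> \<tau> \<longlonglongrightarrow> \<theta> \<Longrightarrow> (\<lambda>n. F n (\<tau> n)) \<longlonglongrightarrow> 0"
  obtains \<delta> N where "0 < \<delta>" "\<And>n t. N \<le> n \<Longrightarrow> t \<in> \<Theta> \<Longrightarrow> \<bar>t - \<theta>\<bar> \<le> \<delta> \<Longrightarrow> \<bar>F n t\<bar> \<le> \<epsilon>"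
proof (rule ccontr)
  assume neg: "\<not> thesis"
  define bad where "bad i n \<longleftrightarrow> (\<exists>t\<in>\<Theta>. \<bar>t - \<theta>\<bar> \<le> 1 / real (Suc i) \<and> \<epsilon> < \<bar>F n t\<bar>)" for i n
  have bad: "\<exists>n\<ge>N. bad i n" for i N
  proof (rule ccontr)
    assume "\<not> (\<exists>n\<ge>N. bad i n)"
    then have "\<And>n t. N \<le> n \<Longrightarrow> t \<in> \<Theta> \<Longrightarrow> \<bar>t - \<theta>\<bar> \<le> 1 / real (Suc i) \<Longrightarrow> \<bar>F n t\<bar> \<le> \<epsilon>"
      unfolding bad_def by (meson not_le)
    from that[of "1 / real (Suc i)" N, OF _ this] neg show False by simp
  qed
  have "\<exists>r. \<forall>i. bad i (r i) \<and> r i < r (Suc i)"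
  proof (rule dependent_nat_choice)
    show "\<exists>n. bad 0 n" using bad[of 0 0] by blast
    show "\<exists>m. bad (Suc i) m \<and> n < m" for n i using bad[of "Suc n" "Suc i"] by (auto simp: Suc_le_eq)
  qed
  then obtain r where r: "\<And>i. bad i (r i)" "\<And>i. r i < r (Suc i)" by blast
  have mono: "strict_mono r" using r(2) by (rule strict_mono_Suc_iff[THEN iffD2, rule_format])
  obtain t where t: "\<And>i. t i \<in> \<Theta>" "\<And>i. \<bar>t i - \<theta>\<bar> \<le> 1 / real (Suc i)" "\<And>i. \<epsilon> < \<bar>F (r i) (t i)\<bar>"
    using r(1) unfolding bad_def by metis
  define \<tau> where "\<tau> n = (if n \<in> range r then t (inv r n) else \<theta>)" for n
  have inj: "inj r" using mono by (rule strict_mono_imp_inj_on)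
  have \<tau>r: "\<tau> (r i) = t i" for i by (simp add: \<tau>_def inv_f_f[OF inj])
  have "\<tau> \<longlonglongrightarrow> \<theta>"
  proof (rule LIMSEQ_I)
    fix e :: real assume "0 < e"
    then obtain i0 where i0: "1 / real (Suc i0) < e" using nat_approx_posE by blast
    show "\<exists>no. \<forall>n\<ge>no. norm (\<tau> n - \<theta>) < e"
    proof (intro exI allI impI)
      fix n assume n: "r i0 \<le> n"
      show "norm (\<tau> n - \<theta>) < e"
      proof (cases "n \<in> range r")
        case True
        then obtain i where i: "n = r i" by blast
        then have "i0 \<le> i" using n strict_mono_less_eq[OF mono] by simp
        then have "1 / real (Suc i) \<le> 1 / real (Suc i0)" by (intro divide_left_mono) auto
        then show ?thesis using t(2)[of i] i0 unfolding i \<tau>r by simp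
      qed (use \<open>0 < e\<close> in \<open>simp add: \<tau>_def\<close>)
    qed
  qed
  moreover have "\<tau> n \<in> \<Theta>" for n using t(1) th by (simp add: \<tau>_def)
  ultimately have "(\<lambda>n. F n (\<tau> n)) \<longlonglongrightarrow> 0" by (intro seq)
  from LIMSEQ_subseq_LIMSEQ[OF this mono] have "(\<lambda>i. F (r i) (t i)) \<longlonglongrightarrow> 0"
    by (simp add: comp_def \<tau>r)
  from LIMSEQ_D[OF this \<epsilon>] obtain i where "\<bar>F (r i) (t i)\<bar> < \<epsilon>" by auto
  then show False using t(3)[of i] by simp
qed

lemma upper_bound_tendsto_in_prob:
  fixes Z\<^sub>0 :: "'y measure"
  assumes reg: "regular_model \<mu> \<Theta> P p s" and cq: "consistent_quantizer \<mu> \<Theta> P p s T k"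
    and Q0: "Q\<^sub>0 \<in> private_channels \<alpha> \<mu> Z\<^sub>0"
    and est: "\<And>n. 1 \<le> n \<Longrightarrow> est n \<in> sample_space Z\<^sub>0 n \<rightarrow>\<^sub>M borel_on \<Theta>"
    and th: "\<theta> \<in> \<Theta>" and \<theta>n: "\<And>n. \<theta>\<^sub>n n \<in> \<Theta>" "\<theta>\<^sub>n \<longlonglongrightarrow> \<theta>"
    and cons: "tendsto_in_prob (\<lambda>n. sample_space (P \<theta> \<bind> Q\<^sub>0) n) est \<theta>"
  shows "tendsto_in_prob (\<lambda>n. sample_space (P \<theta> \<bind> Q\<^sub>0) n)
     (\<lambda>n z. upper_bound C \<alpha> \<mu> \<Theta> P p s T k n \<theta> (est n z) (\<theta>\<^sub>n n)) 0"
proof -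
  note mod = regular_modelD(1)[OF reg]
  let ?M = "\<lambda>n. sample_space (P \<theta> \<bind> Q\<^sub>0) n"
  let ?F = "\<lambda>n t. upper_bound C \<alpha> \<mu> \<Theta> P p s T k n \<theta> t (\<theta>\<^sub>n n)"
  note B = prob_space_bind_kernel[OF private_channelsD(1)[OF Q0] dominated_modelD(1,5)[OF mod th]]
  have sets: "sets (?M n) = sets (sample_space Z\<^sub>0 n)" for n
    by (rule sets_PiM_cong) (auto simp: B(2))
  have prob: "prob_space (?M n)" for n
    by (rule prob_space_PiM) (rule B(1))
  have meas: "(\<lambda>z. ?F n (est n z)) \<in> borel_measurable (?M n)" if n: "1 \<le> n" for n
    using measurable_compose[OF est[OF n] upper_bound_measurable[OF reg cq n th]]
      measurable_cong_sets[OF sets refl] by blast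
  have "(\<lambda>n. measure (?M n) {w \<in> space (?M n). \<epsilon> < \<bar>?F n (est n w) - 0\<bar>}) \<longlonglongrightarrow> 0" if \<epsilon>: "0 < \<epsilon>" for \<epsilon>
  proof -
    have seq: "(\<lambda>n. ?F n (\<tau> n)) \<longlonglongrightarrow> 0" if "\<And>n. \<tau> n \<in> \<Theta>" "\<tau> \<longlonglongrightarrow> \<theta>" for \<tau>
      by (rule upper_bound_tendsto[OF reg cq th that \<theta>n])
    obtain \<delta> N where \<delta>: "0 < \<delta>" "\<And>n t. N \<le> n \<Longrightarrow> t \<in> \<Theta> \<Longrightarrow> \<bar>t - \<theta>\<bar> \<le> \<delta> \<Longrightarrow> \<bar>?F n t\<bar> \<le> \<epsilon>"
      by (rule locally_uniform_if_sequential[where F="?F", OF th \<epsilon> seq]) blast+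
    have lim: "(\<lambda>n. measure (?M n) {w \<in> space (?M n). \<delta> < \<bar>est n w - \<theta>\<bar>}) \<longlonglongrightarrow> 0"
      using cons \<delta>(1) by (simp add: tendsto_in_prob_def)
    have "\<forall>\<^sub>F n in sequentially. measure (?M n) {w \<in> space (?M n). \<epsilon> < \<bar>?F n (est n w) - 0\<bar>}
       \<le> measure (?M n) {w \<in> space (?M n). \<delta> < \<bar>est n w - \<theta>\<bar>}"
      using eventually_ge_at_top[of "max N 1"]
    proof eventually_elim
      case (elim n)
      then have n: "N \<le> n" "1 \<le> n" by auto
      interpret prob_space "?M n" by (rule prob)
      have [measurable]: "est n \<in> borel_measurable (?M n)"
        using cons n(2) by (simp add: tendsto_in_prob_def)
      show ?case
      proof (rule finite_measure_mono)
        show "{w \<in> space (?M n). \<epsilon> < \<bar>?F n (est n w) - 0\<bar>} \<subseteq> {w \<in> space (?M n). \<delta> < \<bar>est n w - \<theta>\<bar>}"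
        proof safe
          fix w assume w: "w \<in> space (?M n)" "\<epsilon> < \<bar>?F n (est n w) - 0\<bar>"
          have "w \<in> space (sample_space Z\<^sub>0 n)" using w(1) sets_eq_imp_space_eq[OF sets] by blast
          then have "est n w \<in> \<Theta>" using measurable_space[OF est[OF n(2)]] by (simp add: space_restrict_space)
          then show "\<delta> < \<bar>est n w - \<theta>\<bar>" using \<delta>(2)[OF n(1)] w(2) by (metis diff_zero not_le)
        qed
        show "{w \<in> space (?M n). \<delta> < \<bar>est n w - \<theta>\<bar>} \<in> events" by measurable
      qed
    qed
    then show ?thesis
      by (intro tendsto_sandwich[OF _ _ tendsto_const lim]) auto
  qed
  then show ?thesis unfolding tendsto_in_prob_def using meas by blast
qed

theorem theorem4p11:
  fixes \<alpha> :: real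
  assumes "0 < \<alpha>"
  shows "\<exists>C>0.
    \<forall>(\<mu> :: 'x measure) (\<Theta> :: real set) P p s T k (Z\<^sub>0 :: 'y measure) Q\<^sub>0.
      regular_model \<mu> \<Theta> P p s \<longrightarrow>
      consistent_quantizer \<mu> \<Theta> P p s T k \<longrightarrow>
      Q\<^sub>0 \<in> private_channels \<alpha> \<mu> Z\<^sub>0 \<longrightarrow>
      (\<forall>n\<ge>1. \<forall>est Q.
         est \<in> sample_space Z\<^sub>0 n \<rightarrow>\<^sub>M borel_on \<Theta> \<longrightarrow>
         measurable_maximizer \<alpha> \<Theta> P (T n) (k n) Q \<longrightarrow>
         (let info = (\<lambda>\<theta>' z. fisher_information \<Theta>
                (image_model (\<lambda>x. kernel_at Q (k n (est z)) (est z) (T n x (est z))) P) \<theta>')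
          in \<forall>\<theta>\<in>\<Theta>. \<forall>\<theta>\<^sub>n\<in>\<Theta>.
               info \<theta>\<^sub>n \<in> borel_measurable (sample_space Z\<^sub>0 n) \<and>
               (\<forall>z\<in>space (sample_space Z\<^sub>0 n).
                  let gap = optimal_private_information TYPE('z::infinite) \<alpha> \<mu> \<Theta> P \<theta> - info \<theta>\<^sub>n z
                  in (\<theta>\<^sub>n = \<theta> \<longrightarrow> 0 \<le> gap) \<and>
                     - phi \<alpha> \<mu> \<Theta> P p s \<theta> \<theta>\<^sub>n \<le> gap \<and>
                     gap \<le> upper_bound C \<alpha> \<mu> \<Theta> P p s T k n \<theta> (est z) \<theta>\<^sub>n))) \<and>
      (\<forall>est \<theta> \<theta>\<^sub>n.
         (\<forall>n\<ge>1. est n \<in> sample_space Z\<^sub>0 n \<rightarrow>\<^sub>M borel_on \<Theta>) \<longrightarrow>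
         \<theta> \<in> \<Theta> \<longrightarrow> (\<forall>n. \<theta>\<^sub>n n \<in> \<Theta>) \<longrightarrow> \<theta>\<^sub>n \<longlonglongrightarrow> \<theta> \<longrightarrow>
         tendsto_in_prob (\<lambda>n. sample_space (P \<theta> \<bind> Q\<^sub>0) n) est \<theta> \<longrightarrow>
         tendsto_in_prob (\<lambda>n. sample_space (P \<theta> \<bind> Q\<^sub>0) n)
           (\<lambda>n z. upper_bound C \<alpha> \<mu> \<Theta> P p s T k n \<theta> (est n z) (\<theta>\<^sub>n n)) 0)"
proof (intro exI[of _ "4 * exp \<alpha> + 2 * exp (2 * \<alpha>)"] conjI allI impI)
  show "0 < 4 * exp \<alpha> + 2 * exp (2 * \<alpha>)" by (intro add_pos_pos) auto
next
  fix \<mu> :: "'x measure" and \<Theta> P p s T k and Z\<^sub>0 :: "'y measure" and Q\<^sub>0 and n :: nat and est Q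
  assume reg: "regular_model \<mu> \<Theta> P p s" and cq: "consistent_quantizer \<mu> \<Theta> P p s T k"
    and n: "1 \<le> n" and est: "est \<in> sample_space Z\<^sub>0 n \<rightarrow>\<^sub>M borel_on \<Theta>"
    and mm: "measurable_maximizer \<alpha> \<Theta> P (T n) (k n) Q"
  show "let info = (\<lambda>\<theta>' z. fisher_information \<Theta>
                (image_model (\<lambda>x. kernel_at Q (k n (est z)) (est z) (T n x (est z))) P) \<theta>')
          in \<forall>\<theta>\<in>\<Theta>. \<forall>\<theta>\<^sub>n\<in>\<Theta>.
               info \<theta>\<^sub>n \<in> borel_measurable (sample_space Z\<^sub>0 n) \<and>
               (\<forall>z\<in>space (sample_space Z\<^sub>0 n).
                  let gap = optimal_private_information TYPE('z::infinite) \<alpha> \<mu> \<Theta> P \<theta> - info \<theta>\<^sub>n z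
                  in (\<theta>\<^sub>n = \<theta> \<longrightarrow> 0 \<le> gap) \<and>
                     - phi \<alpha> \<mu> \<Theta> P p s \<theta> \<theta>\<^sub>n \<le> gap \<and>
                     gap \<le> upper_bound (4 * exp \<alpha> + 2 * exp (2 * \<alpha>)) \<alpha> \<mu> \<Theta> P p s T k n \<theta> (est z) \<theta>\<^sub>n)"
    unfolding Let_def
  proof (intro ballI conjI impI)
    fix \<theta> \<theta>\<^sub>n assume th: "\<theta> \<in> \<Theta>" "\<theta>\<^sub>n \<in> \<Theta>"
    have "(\<lambda>\<tau>. fisher_information \<Theta> (image_model (\<lambda>x. kernel_at Q (k n \<tau>) \<tau> (T n x \<tau>)) P) \<theta>\<^sub>n) \<in> borel_measurable (borel_on \<Theta>)"
      using mm th(2) by (simp add: measurable_maximizer_def)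
    from measurable_compose[OF est this]
    show "(\<lambda>z. fisher_information \<Theta>
                (image_model (\<lambda>x. kernel_at Q (k n (est z)) (est z) (T n x (est z))) P) \<theta>\<^sub>n)
        \<in> borel_measurable (sample_space Z\<^sub>0 n)" .
    fix z assume "z \<in> space (sample_space Z\<^sub>0 n)"
    then have \<tau>: "est z \<in> \<Theta>" using measurable_space[OF est] by (simp add: space_restrict_space)
    note gap = information_gap[where T=T and k=k and 'z='z, OF assms reg cq n mm \<tau>]
    let ?i = "\<lambda>t. fisher_information \<Theta> (image_model (\<lambda>x. kernel_at Q (k n (est z)) (est z) (T n x (est z))) P) t"
    let ?o = "optimal_private_information TYPE('z::infinite) \<alpha> \<mu> \<Theta> P \<theta>"
    show "0 \<le> ?o - ?i \<theta>\<^sub>n" if "\<theta>\<^sub>n = \<theta>" using gap(1)[OF th] that by simp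
    show "- phi \<alpha> \<mu> \<Theta> P p s \<theta> \<theta>\<^sub>n \<le> ?o - ?i \<theta>\<^sub>n" using gap(2)[OF th] by simp
    show "?o - ?i \<theta>\<^sub>n \<le> upper_bound (4 * exp \<alpha> + 2 * exp (2 * \<alpha>)) \<alpha> \<mu> \<Theta> P p s T k n \<theta> (est z) \<theta>\<^sub>n"
      using gap(3)[OF th] by simp
  qed
next
  fix \<mu> :: "'x measure" and \<Theta> P p s T k and Z\<^sub>0 :: "'y measure" and Q\<^sub>0 est \<theta> \<theta>\<^sub>n
  assume "regular_model \<mu> \<Theta> P p s" "consistent_quantizer \<mu> \<Theta> P p s T k" "Q\<^sub>0 \<in> private_channels \<alpha> \<mu> Z\<^sub>0"
    "\<forall>n\<ge>1. est n \<in> sample_space Z\<^sub>0 n \<rightarrow>\<^sub>M borel_on \<Theta>" "\<theta> \<in> \<Theta>" "\<forall>n. \<theta>\<^sub>n n \<in> \<Theta>" "\<theta>\<^sub>n \<longlonglongrightarrow> \<theta>"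
    "tendsto_in_prob (\<lambda>n. sample_space (P \<theta> \<bind> Q\<^sub>0) n) est \<theta>"
  then show "tendsto_in_prob (\<lambda>n. sample_space (P \<theta> \<bind> Q\<^sub>0) n)
           (\<lambda>n z. upper_bound (4 * exp \<alpha> + 2 * exp (2 * \<alpha>)) \<alpha> \<mu> \<Theta> P p s T k n \<theta> (est n z) (\<theta>\<^sub>n n)) 0"
    by (intro upper_bound_tendsto_in_prob) auto
qed

end
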